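(* Let $n\geq 1$ be an integer and let $1<p_{0},\dots,p_{n}<\infty$ satisfy $\sum_{i=0}^{n} p_{i}^{-1}=1$. Then there exists a function $c:\mathbb{N}\to[0,\infty)$, depending on $n,p_{0},\dots,p_{n}$ (and on the fixed data $\mathbb{V}$, $k$, $\phi$), with $\lim_{N\to\infty}c(N)/N=0$, such that for every finite interval $\mathbf{S}\subset\mathbb{Z}$ and all functions $F_{i}\in L^{p_{i}}(\mathbb{V}^{n})$, $i=0,\dots,n$, $$|\Lambda_{\mathbf{S}}(F_{0},\dots,F_{n})|\leq c(|\mathbf{S}|)\prod_{i=0}^{n}\|F_{i}\|_{L^{p_{i}}(\mathbb{V}^{n})}.$$ In other words, $|\Lambda_{\mathbf{S}}(F_{0},\dots,F_{n})|\leq o_{n,p_{0},\dots,p_{n}}(|\mathbf{S}|)\prod_{i=0}^{n}\|F_{i}\|_{p_{i}}$.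
   Context: $\mathbb{V}=\mathbb{R}^{D}$ for some integer $D\ge1$. Fix a translation-invariant Calderón--Zygmund kernel $k:\mathbb{V}\setminus\{0\}\to\mathbb{C}$ which defines an $L^{2}(\mathbb{V})$ bounded convolution operator (i.e. the operators of convolution with $k\mathbf{1}_{\{r<|x|<R\}}$ are bounded on $L^2(\mathbb{V})$ uniformly in $0<r<R<\infty$) and which satisfies $|\partial^{\alpha}k(x)|\leq C|x|^{-D-|\alpha|}$ for all multiindices $\alpha$ with $0\leq|\alpha|\leq D+1$. Fix an even smooth function $\phi$ on $\mathbb{R}$, supported on $[-4,-1]\cup[1,4]$, with $\sum_{s\in\mathbb{Z}}\phi(2^{-s}t)=1$ for all $t\neq 0$. For $s\in\mathbb{Z}$ put $\psi_{s}(x)=\phi(2^{-s}|x|)k(x)$, and for a finite interval $\mathbf{S}\subset\mathbb{Z}$ (with $|\mathbf{S}|$ elements) put $\psi_{\mathbf{S}}=\sum_{s\in\mathbf{S}}\psi_{s}$. The truncated simplex Calderón--Zygmund form is $$\Lambda_{\mathbf{S}}(F_{0},\dots,F_{n}):=\int_{\mathbb{V}^{n+1}}\prod_{i=0}^{n}F_{i}(x_{(i)})\ \psi_{\mathbf{S}}\Big(\sum_{i=0}^{n}x_{i}\Big)\,dx,$$ where $x=(x_{0},\dots,x_{n})\in\mathbb{V}^{n+1}$ and $x_{(i)}=(x_{0},\dots,x_{i-1},x_{i+1},\dots,x_{n})\in\mathbb{V}^n$ denotes omission of the $i$-th coordinate. *)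

theory Defs
  imports "HOL-Analysis.Analysis"
begin

section \<open>Lebesgue spaces and convolution\<close>

definition Lp_space :: "'a measure \<Rightarrow> real \<Rightarrow> ('a \<Rightarrow> complex) set" where
  "Lp_space M p = {f \<in> borel_measurable M. integrable M (\<lambda>x. norm (f x) powr p)}"

definition Lp_norm :: "'a measure \<Rightarrow> real \<Rightarrow> ('a \<Rightarrow> complex) \<Rightarrow> real" where
  "Lp_norm M p f = (LINT x|M. norm (f x) powr p) powr (1 / p)"

definition convolution ::
    "('v::euclidean_space \<Rightarrow> complex) \<Rightarrow> ('v \<Rightarrow> complex) \<Rightarrow> 'v \<Rightarrow> complex" where
  "convolution g f x = (LINT y|lebesgue. g (x - y) * f y)"

section \<open>Iterated partial derivatives\<close>

text \<open>
  The list names the directions of differentiation; with all its entries in \<open>Basis\<close> this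
  is the partial derivative for the multiindex that counts how often each basis vector
  occurs in the list. The order of the list is immaterial for the functions considered here.
\<close>

fun iter_partial ::
    "'v::euclidean_space list \<Rightarrow> ('v \<Rightarrow> 'b::real_normed_vector) \<Rightarrow> 'v \<Rightarrow> 'b" where
  "iter_partial [] f = f"
| "iter_partial (b # bs) f = (\<lambda>x. frechet_derivative (iter_partial bs f) (at x) b)"

text \<open>Meant for open \<open>S\<close>. Continuity of the derivatives of top order is not required.\<close>

definition times_differentiable_on ::
    "nat \<Rightarrow> ('v::euclidean_space \<Rightarrow> 'b::real_normed_vector) \<Rightarrow> 'v set \<Rightarrow> bool" where
  "times_differentiable_on m f S \<longleftrightarrow>
     (\<forall>bs. set bs \<subseteq> Basis \<and> length bs < m \<longrightarrow>
        (\<forall>x\<in>S. iter_partial bs f differentiable (at x)))"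

definition smooth_on ::
    "('v::euclidean_space \<Rightarrow> 'b::real_normed_vector) \<Rightarrow> 'v set \<Rightarrow> bool" where
  "smooth_on f S \<longleftrightarrow> (\<forall>m. times_differentiable_on m f S)"

section \<open>Calderon--Zygmund kernels and dyadic cutoffs\<close>

text \<open>
  Kernels are total functions here; their value at \<open>0\<close> enters neither the following
  definition nor, when \<open>\<phi> 0 = 0\<close>, the dyadic pieces below.
\<close>

definition annulus_truncation ::
    "real \<Rightarrow> real \<Rightarrow> ('v::euclidean_space \<Rightarrow> complex) \<Rightarrow> 'v \<Rightarrow> complex" where
  "annulus_truncation r R k x = (if r < norm x \<and> norm x < R then k x else 0)"

definition CZ_kernel :: "('v::euclidean_space \<Rightarrow> complex) \<Rightarrow> bool" where
  "CZ_kernel k \<longleftrightarrow>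
     times_differentiable_on (DIM('v) + 1) k (- {0}) \<and>
     (\<exists>C. \<forall>bs. set bs \<subseteq> Basis \<and> length bs \<le> DIM('v) + 1 \<longrightarrow>
        (\<forall>x. x \<noteq> 0 \<longrightarrow> norm (iter_partial bs k x) \<le> C / norm x ^ (DIM('v) + length bs))) \<and>
     (\<exists>A. \<forall>r R. 0 < r \<and> r < R \<longrightarrow> (\<forall>f \<in> Lp_space lebesgue 2.
        convolution (annulus_truncation r R k) f \<in> Lp_space lebesgue 2 \<and>
        Lp_norm lebesgue 2 (convolution (annulus_truncation r R k) f)
          \<le> A * Lp_norm lebesgue 2 f))"

definition dyadic_cutoff :: "(real \<Rightarrow> complex) \<Rightarrow> bool" where
  "dyadic_cutoff \<phi> \<longleftrightarrow>
     smooth_on \<phi> UNIV \<and>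
     (\<forall>t. \<phi> (- t) = \<phi> t) \<and>
     (\<forall>t. t \<notin> {-4..-1} \<union> {1..4} \<longrightarrow> \<phi> t = 0) \<and>
     (\<forall>t. t \<noteq> 0 \<longrightarrow> ((\<lambda>s::int. \<phi> (2 powi (- s) * t)) has_sum 1) UNIV)"

definition psi ::
    "('v::euclidean_space \<Rightarrow> complex) \<Rightarrow> (real \<Rightarrow> complex) \<Rightarrow> int \<Rightarrow> 'v \<Rightarrow> complex" where
  "psi k \<phi> s x = \<phi> (2 powi (- s) * norm x) * k x"

definition psi_sum ::
    "('v::euclidean_space \<Rightarrow> complex) \<Rightarrow> (real \<Rightarrow> complex) \<Rightarrow> int set \<Rightarrow> 'v \<Rightarrow> complex" where
  "psi_sum k \<phi> S x = (\<Sum>s\<in>S. psi k \<phi> s x)"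

section \<open>The truncated simplex form\<close>

text \<open>
  Lebesgue measure on the \<open>m\<close>-fold power of \<open>'v\<close>, whose points are the functions on
  \<open>{..<m}\<close> that are \<open>undefined\<close> elsewhere.
\<close>

definition power_lebesgue :: "nat \<Rightarrow> (nat \<Rightarrow> 'v::euclidean_space) measure" where
  "power_lebesgue m = completion (PiM {..<m} (\<lambda>_. lborel))"

text \<open>Omission of coordinate \<open>i\<close> of \<open>(x 0, ..., x n)\<close>; later coordinates move down by one.\<close>

definition omit :: "nat \<Rightarrow> nat \<Rightarrow> (nat \<Rightarrow> 'v) \<Rightarrow> nat \<Rightarrow> 'v" where
  "omit n i x = (\<lambda>j\<in>{..<n}. if j < i then x j else x (Suc j))"

definition simplex_form ::
    "nat \<Rightarrow> ('v::euclidean_space \<Rightarrow> complex) \<Rightarrow> (real \<Rightarrow> complex) \<Rightarrow> int set \<Rightarrow>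
     (nat \<Rightarrow> (nat \<Rightarrow> 'v) \<Rightarrow> complex) \<Rightarrow> complex" where
  "simplex_form n k \<phi> S F =
     (LINT x|power_lebesgue (Suc n).
        (\<Prod>i\<le>n. F i (omit n i x)) * psi_sum k \<phi> S (\<Sum>i\<le>n. x i))"

end

theory Submission
  imports Defs
begin

text \<open>
  Each single scale contributes at most a constant, by Hoelder's inequality with respect to the
  measure \<open>|\<psi>\<^sub>s(x\<^sub>0 + \<dots> + x\<^sub>n)| dx\<close>, so the trivial bound grows like the number \<open>N\<close> of scales.
  The proof improves this to \<open>C N powr (1 - \<delta>)\<close> for some \<open>\<delta> > 0\<close> by iterating a \<open>TT\<^sup>*\<close> argument
  that lowers \<open>n\<close> by one.

  Let the kernels \<open>\<eta> s\<close> have mean zero and live at scale \<open>2\<^sup>s\<close> (\<open>scale_kernels\<close>). Integrating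
  out one variable \<open>u\<close> writes the form as \<open>\<integral> f \<cdot> \<Sum>\<^sub>s d\<^sub>s\<close>, where \<open>f\<close> is the function that does
  not depend on \<open>u\<close>. By Cauchy--Schwarz it suffices to bound \<open>\<integral> |\<Sum>\<^sub>s d\<^sub>s|\<^sup>2\<close>, hence, for each \<open>t\<close>, the
  pairing of \<open>d\<^sub>t\<close> with \<open>\<Sum>\<^sub>s\<^sub>\<le>\<^sub>t d\<^sub>s\<close>. In this pairing two copies \<open>u\<close> and \<open>u + h\<close> of the
  integrated variable occur. Since \<open>\<eta> t\<close> varies slowly compared with \<open>\<eta> s\<close>, \<open>s \<le> t\<close>, the
  coarse kernel may be replaced by \<open>\<eta> t h\<close>, with errors that sum geometrically
  (\<open>scale_pairing_bound\<close>). For fixed \<open>u\<close> and \<open>h\<close> what remains is a form of the same kind in one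
  variable less, with the products \<open>F\<^sub>i(\<dots>, u) \<cdot> cnj (F\<^sub>i(\<dots>, u + h))\<close>. The induction ends with a single
  variable, where the form is a multiple of an integral of mean zero kernels and vanishes.

  The induction is run for functions with \<open>|F\<^sub>i| \<le> 1\<close> and \<open>\<integral> |F\<^sub>i| \<le> V\<close>, a class that is stable under
  forming the products above, with the bound \<open>C N powr (1 - \<delta>) V\<close> (\<open>ex_bounded_form_estimate\<close>). General
  exponents follow from a real interpolation (\<open>index_form_interpolation\<close>): where the functions
  \<open>|F\<^sub>i|\<^sup>p\<^sup>i\<close> lie on equal or neighbouring levels of the scale of powers of \<open>R\<close>, the form is a sum over
  these levels of forms with bounded functions; elsewhere the product \<open>\<Prod> |F\<^sub>i|\<close> gains a negative power
  of \<open>R\<close> over the trivial bound. Choosing \<open>R\<close> as a small power of \<open>N\<close> balances the two.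

  The dyadic pieces \<open>\<psi>\<^sub>s\<close> of the kernel do not themselves have mean zero, but the integrals of
  \<open>\<Sum>\<^sub>s \<psi>\<^sub>s\<close> over intervals of scales are uniformly bounded, because the truncated convolutions are
  bounded on \<open>L\<^sup>2\<close>. Summation by parts therefore turns \<open>\<psi>\<^sub>s\<close> into mean zero kernels up to one
  integrable remainder (\<open>ex_mean_zero_kernels\<close>).
\<close>

section \<open>Pairings of different scales\<close>

lemma integrable_translate_iff:
  fixes f :: "'v::euclidean_space \<Rightarrow> 'b::{banach, second_countable_topology}"
  shows "integrable lborel (\<lambda>x. f (x + c)) \<longleftrightarrow> integrable lborel f"
proof -
  have *: "integrable lborel (\<lambda>x. f (x + c))" if "integrable lborel f" for f :: "'v \<Rightarrow> 'b" and c
  proof -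
    have "integrable (distr lborel borel ((+) c)) f"
      using that by (simp add: lborel_distr_plus)
    thus ?thesis
      by (subst (asm) integrable_distr_eq) (use that in \<open>auto simp: add.commute\<close>)
  qed
  show ?thesis using *[of f c] *[of "\<lambda>x. f (x + c)" "-c"] by auto
qed

lemma integral_translate:
  fixes f :: "'v::euclidean_space \<Rightarrow> 'b::{banach, second_countable_topology}"
  shows "(LINT x|lborel. f (x + c)) = (LINT x|lborel. f x)"
proof (cases "integrable lborel f")
  case True
  hence m: "f \<in> borel_measurable borel" by auto
  have "(LINT x|lborel. f x) = (LINT x|distr lborel borel ((+) c). f x)"
    by (simp add: lborel_distr_plus)
  also have "\<dots> = (LINT x|lborel. f (x + c))"
    by (subst integral_distr) (use m in \<open>auto simp: add.commute\<close>)
  finally show ?thesis by simp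
next
  case False
  hence "\<not> integrable lborel (\<lambda>x. f (x + c))" by (simp add: integrable_translate_iff)
  with False show ?thesis by (simp add: not_integrable_integral_eq)
qed

text \<open>
  The only features of the kernels that the induction uses. The fourth clause is a Lipschitz
  condition in the mean at scale \<open>2\<^sup>s\<close>; together with the support condition it makes the
  interaction of the scales \<open>s \<le> t\<close> decay like \<open>2\<^sup>s / 2\<^sup>t\<close>.
\<close>

definition scale_kernels :: "real \<Rightarrow> int set \<Rightarrow> (int \<Rightarrow> 'v::euclidean_space \<Rightarrow> complex) \<Rightarrow> bool" where
  "scale_kernels B S \<eta> \<longleftrightarrow> (\<forall>s\<in>S.
     integrable lborel (\<eta> s) \<and> (LINT v|lborel. norm (\<eta> s v)) \<le> B \<and>
     (\<forall>v. B * 2 powi s < norm v \<longrightarrow> \<eta> s v = 0) \<and>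
     (\<forall>u. (LINT v|lborel. norm (\<eta> s (v + u) - \<eta> s v)) \<le> B * norm u / 2 powi s) \<and>
     (LINT v|lborel. \<eta> s v) = 0)"

lemma scale_kernelsD:
  assumes "scale_kernels B S \<eta>" "s \<in> S"
  shows "integrable lborel (\<eta> s)" "(LINT v|lborel. norm (\<eta> s v)) \<le> B"
    "B * 2 powi s < norm v \<Longrightarrow> \<eta> s v = 0"
    "(LINT v|lborel. norm (\<eta> s (v + u) - \<eta> s v)) \<le> B * norm u / 2 powi s"
    "(LINT v|lborel. \<eta> s v) = 0"
  using assms unfolding scale_kernels_def by auto

text \<open>
  Expanding the square and ordering the pairs counts every off-diagonal pair once and the diagonal
  twice. Using partial sums rather than individual products keeps the finer scales together, so that
  the lower-dimensional form is again a sum over an interval of scales.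
\<close>

lemma norm_sum_square_le:
  fixes d :: "int \<Rightarrow> complex"
  shows "(norm (\<Sum>s\<in>{a..b}. d s))\<^sup>2 \<le> 2 * Re (\<Sum>t\<in>{a..b}. (\<Sum>s\<in>{a..t}. d s) * cnj (d t))"
proof (cases "a \<le> b")
  case True
  then show ?thesis
  proof (induction b rule: int_ge_induct)
    case base
    have "(norm (d a))\<^sup>2 \<ge> 0" by simp
    thus ?case by (simp add: cmod_power2 flip: power2_eq_square)
  next
    case (step b)
    have e: "{a..b+1} = insert (b+1) {a..b}" using step by auto
    define D where "D = (\<Sum>s\<in>{a..b}. d s)"
    have "(norm (D + d (b+1)))\<^sup>2 = (norm D)\<^sup>2 + 2 * Re (D * cnj (d (b+1))) + (norm (d (b+1)))\<^sup>2"
      by (simp add: cmod_power2) (simp add: power2_eq_square algebra_simps)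
    also have "\<dots> \<le> (norm D)\<^sup>2 + 2 * Re ((D + d (b+1)) * cnj (d (b+1)))"
      by (simp add: cmod_power2) (simp add: power2_eq_square algebra_simps)
    finally have A: "(norm (D + d (b+1)))\<^sup>2 \<le> (norm D)\<^sup>2 + 2 * Re ((D + d (b+1)) * cnj (d (b+1)))" .
    have s: "(\<Sum>s\<in>{a..b+1}. d s) = D + d (b+1)" unfolding e by (simp add: D_def add.commute)
    have "(\<Sum>t\<in>{a..b+1}. (\<Sum>s\<in>{a..t}. d s) * cnj (d t)) = (\<Sum>t\<in>{a..b}. (\<Sum>s\<in>{a..t}. d s) * cnj (d t)) + (D + d (b+1)) * cnj (d (b+1))"
      unfolding s[symmetric] by (subst e, subst sum.insert) (auto simp: add.commute)
    thus ?case using step(2) A unfolding s by (simp add: D_def[symmetric] del: Re_sum)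
  qed
qed auto

lemma sum_powi_int_le:
  "(\<Sum>s\<in>{a..t::int}. 2 powi s) \<le> 2 * (2::real) powi t"
proof (cases "a \<le> t")
  case True
  then show ?thesis
  proof (induction t rule: int_ge_induct)
    case (step b)
    have e: "{a..b+1} = insert (b+1) {a..b}" using step by auto
    show ?case using step(2) unfolding e by (simp add: power_int_add_1)
  qed auto
qed auto

lemma integrable_bounded_mult:
  fixes f g :: "'a \<Rightarrow> complex"
  assumes "integrable M f" "g \<in> borel_measurable M" "\<And>x. norm (g x) \<le> c"
  shows "integrable M (\<lambda>x. f x * g x)" "integrable M (\<lambda>x. g x * f x)"
proof -
  have m: "f \<in> borel_measurable M" using assms by auto
  show *: "integrable M (\<lambda>x. f x * g x)"
  proof (rule Bochner_Integration.integrable_bound)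
    show "integrable M (\<lambda>x. c * norm (f x))" using assms by auto
    show "AE x in M. norm (f x * g x) \<le> norm (c * norm (f x))"
    proof (rule AE_I2)
      fix x
      have "norm (f x * g x) \<le> c * norm (f x)"
        using mult_left_mono[OF assms(3)[of x], of "norm (f x)"] by (simp add: norm_mult mult.commute)
      thus "norm (f x * g x) \<le> norm (c * norm (f x))" by simp
    qed
  qed (use m assms in simp)
  thus "integrable M (\<lambda>x. g x * f x)" by (simp add: mult.commute)
qed

lemma borel_measurable_cnj_compose [measurable (raw)]:
  "f \<in> borel_measurable M \<Longrightarrow> (\<lambda>x. cnj (f x)) \<in> borel_measurable M"
  by (rule borel_measurable_continuous_on[where f=cnj]) (auto intro: continuous_intros)

lemma measurable_uncurried:
  fixes g :: "'v::euclidean_space \<Rightarrow> 'x \<Rightarrow> complex"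
  assumes g: "(\<lambda>(x, u). g u x) \<in> borel_measurable (X \<Otimes>\<^sub>M lborel)"
    and f: "f \<in> borel_measurable N" and h: "h \<in> measurable N X"
  shows "(\<lambda>z. g (f z) (h z)) \<in> borel_measurable N"
proof -
  have "(\<lambda>z. (h z, f z)) \<in> measurable N (X \<Otimes>\<^sub>M lborel)"
    using f h by (intro measurable_Pair) auto
  from measurable_compose[OF this g] show ?thesis by simp
qed

text \<open>
  The heart of the induction step. Write the second factor at the point \<open>u + h\<close> and compare
  \<open>\<eta> t (h + (u + \<sigma> x))\<close> with \<open>\<eta> t h\<close>: on the support of \<open>\<eta> s (u + \<sigma> x)\<close> the shift is at most
  \<open>B 2\<^sup>s\<close>, so the difference costs \<open>2\<^sup>s / 2\<^sup>t\<close> and the sum over \<open>s \<le> t\<close> converges. After the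
  replacement the kernel \<open>\<eta> t h\<close> no longer sees \<open>x\<close>, and the integral over \<open>x\<close> for fixed \<open>u\<close> and
  \<open>h\<close> is the lower-dimensional form that \<open>w\<close> controls.
\<close>

lemma scale_pairing_bound:
  fixes \<sigma> :: "'x \<Rightarrow> 'v::euclidean_space" and g :: "'v \<Rightarrow> 'x \<Rightarrow> complex"
  assumes X: "sigma_finite_measure X"
    and g: "(\<lambda>(x, u). g u x) \<in> borel_measurable (X \<Otimes>\<^sub>M lborel)" and g1: "\<And>u x. norm (g u x) \<le> 1"
    and \<sigma>[measurable]: "\<sigma> \<in> borel_measurable X"
    and K: "scale_kernels B {a..t} \<eta>" and B: "B \<ge> 0" and at: "a \<le> t"
    and I: "\<And>s. s \<in> {a..t} \<Longrightarrow> integrable (X \<Otimes>\<^sub>M lborel) (\<lambda>(x, u). g u x * \<eta> s (u + \<sigma> x))"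
    and IV: "\<And>s. s \<in> {a..t} \<Longrightarrow>
       (LINT (x, u)|(X \<Otimes>\<^sub>M lborel). norm (g u x * \<eta> s (u + \<sigma> x))) \<le> B * V"
    and C: "AE u in lborel. \<forall>h. norm (LINT x|X. g u x * cnj (g (u + h) x) * (\<Sum>s=a..t. \<eta> s (u + \<sigma> x))) \<le> w u"
    and w: "integrable lborel w" "(LINT u|lborel. w u) \<le> W"
  shows "norm (LINT x|X. (\<Sum>s=a..t. LINT u|lborel. g u x * \<eta> s (u + \<sigma> x)) *
            cnj (LINT u|lborel. g u x * \<eta> t (u + \<sigma> x))) \<le> 2 * B^3 * V + B * W"
proof -
  interpret X: sigma_finite_measure X by (rule X)
  interpret P: pair_sigma_finite X lborel by unfold_locales
  note [measurable] = g
  note [measurable (raw)] = measurable_uncurried[OF g]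
  have \<eta>i: "integrable lborel (\<eta> s)" if "s \<in> {a..t}" for s
    using scale_kernelsD(1)[OF K that] .
  have \<eta>m[measurable]: "\<eta> s \<in> borel_measurable borel" if "s \<in> {a..t}" for s
    using \<eta>i[OF that] by auto
  have tt: "t \<in> {a..t}" using at by auto
  note [measurable] = \<eta>m[OF tt]
  define k where "k = (\<lambda>v. \<Sum>s=a..t. \<eta> s v)"
  have km[measurable]: "k \<in> borel_measurable borel"
    unfolding k_def by (intro borel_measurable_sum) auto
  have ki: "integrable lborel (\<lambda>u. k (u + c))" for c
    unfolding k_def integrable_translate_iff[of "\<lambda>u. \<Sum>s=a..t. \<eta> s u" c] using \<eta>i by auto
  have gi: "integrable lborel (\<lambda>u. g u x * \<eta> s (u + c))" if "s \<in> {a..t}" "x \<in> space X" for s c x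
    by (rule integrable_bounded_mult[where c=1]) (use \<eta>i that g1 in \<open>auto simp: integrable_translate_iff\<close>)
  have gki: "integrable lborel (\<lambda>u. g u x * k (u + c))" if "x \<in> space X" for c x
    by (rule integrable_bounded_mult[where c=1]) (use ki that g1 in auto)
  have Ik: "integrable (X \<Otimes>\<^sub>M lborel) (\<lambda>(x, u). g u x * k (u + \<sigma> x))"
    using Bochner_Integration.integrable_sum[OF I, of "{a..t}"] 
    by (simp add: k_def sum_distrib_left case_prod_unfold)
  define \<Gamma> where "\<Gamma> = (\<lambda>u x. LINT h|lborel. g (u + h) x * \<eta> t h)"
  define \<Delta> where "\<Delta> = (\<lambda>u x. LINT h|lborel. g (u + h) x * (\<eta> t (h + (u + \<sigma> x)) - \<eta> t h))"
  have \<Gamma>m[measurable]: "(\<lambda>z. \<Gamma> (snd z) (fst z)) \<in> borel_measurable (X \<Otimes>\<^sub>M lborel)"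
    unfolding \<Gamma>_def by measurable
  have \<Delta>m[measurable]: "(\<lambda>z. \<Delta> (snd z) (fst z)) \<in> borel_measurable (X \<Otimes>\<^sub>M lborel)"
    unfolding \<Delta>_def by measurable
  have ghi: "integrable lborel (\<lambda>h. g (u + h) x * \<eta> t (h + c))" if "x \<in> space X" for u c x
    by (rule integrable_bounded_mult[where c=1]) (use \<eta>i[OF tt] that g1 in \<open>auto simp: integrable_translate_iff\<close>)
  have \<Gamma>b: "norm (\<Gamma> u x) \<le> B" if "x \<in> space X" for u x
  proof -
    have "norm (\<Gamma> u x) \<le> (LINT h|lborel. norm (g (u + h) x * \<eta> t h))"
      unfolding \<Gamma>_def by (rule integral_norm_bound)
    also have "\<dots> \<le> (LINT h|lborel. norm (\<eta> t h))"
      using \<eta>i[OF tt] ghi[OF that, of u 0] g1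
      by (intro integral_mono integrable_norm) (auto simp: norm_mult mult_left_le_one_le)
    also have "\<dots> \<le> B" using scale_kernelsD(2)[OF K tt] .
    finally show ?thesis .
  qed
  have \<Delta>b: "norm (\<Delta> u x) \<le> B * norm (u + \<sigma> x) / 2 powi t" if "x \<in> space X" for u x
  proof -
    have i: "integrable lborel (\<lambda>h. \<eta> t (h + (u + \<sigma> x)) - \<eta> t h)"
      using \<eta>i[OF tt] by (auto simp: integrable_translate_iff[of "\<eta> t"])
    have "norm (\<Delta> u x) \<le> (LINT h|lborel. norm (g (u + h) x * (\<eta> t (h + (u + \<sigma> x)) - \<eta> t h)))"
      unfolding \<Delta>_def by (rule integral_norm_bound)
    also have "\<dots> \<le> (LINT h|lborel. norm (\<eta> t (h + (u + \<sigma> x)) - \<eta> t h))"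
    proof (rule integral_mono)
      show "integrable lborel (\<lambda>h. norm (g (u + h) x * (\<eta> t (h + (u + \<sigma> x)) - \<eta> t h)))"
        by (intro integrable_norm integrable_bounded_mult(2)[OF i, where c=1]) (use g1 that in auto)
    qed (use i g1 in \<open>auto simp: norm_mult mult_left_le_one_le\<close>)
    also have "\<dots> \<le> B * norm (u + \<sigma> x) / 2 powi t" using scale_kernelsD(4)[OF K tt] .
    finally show ?thesis .
  qed
  \<comment> \<open>\<open>\<Gamma>\<close> carries the frozen kernel \<open>\<eta> t h\<close>, \<open>\<Delta>\<close> the error of freezing it\<close>
  have dec: "(LINT u'|lborel. g u' x * \<eta> t (u' + \<sigma> x)) = \<Gamma> u x + \<Delta> u x" if "x \<in> space X" for u x
  proof -
    have "(LINT u'|lborel. g u' x * \<eta> t (u' + \<sigma> x)) = (LINT h|lborel. g (u + h) x * \<eta> t (h + (u + \<sigma> x)))"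
      using integral_translate[of "\<lambda>u'. g u' x * \<eta> t (u' + \<sigma> x)" u, symmetric] by (simp add: ac_simps)
    also have "\<dots> = (LINT h|lborel. g (u + h) x * \<eta> t h + g (u + h) x * (\<eta> t (h + (u + \<sigma> x)) - \<eta> t h))"
      by (simp add: algebra_simps)
    also have "\<dots> = \<Gamma> u x + \<Delta> u x" unfolding \<Gamma>_def \<Delta>_def
      using ghi[OF that, of u 0] ghi[OF that, of u "u + \<sigma> x"]
      by (subst Bochner_Integration.integral_add) (auto simp: right_diff_distrib)
    finally show ?thesis .
  qed
  have i1: "integrable (X \<Otimes>\<^sub>M lborel) (\<lambda>z. (g (snd z) (fst z) * k (snd z + \<sigma> (fst z))) * cnj (\<Gamma> (snd z) (fst z)))"
  proof (rule Bochner_Integration.integrable_bound)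
    show "integrable (X \<Otimes>\<^sub>M lborel) (\<lambda>z. B * norm (g (snd z) (fst z) * k (snd z + \<sigma> (fst z))))"
      using Ik by (simp add: case_prod_unfold)
    show "AE z in X \<Otimes>\<^sub>M lborel. norm ((g (snd z) (fst z) * k (snd z + \<sigma> (fst z))) * cnj (\<Gamma> (snd z) (fst z)))
       \<le> norm (B * norm (g (snd z) (fst z) * k (snd z + \<sigma> (fst z))))"
      using B \<Gamma>b by (intro AE_I2) (auto simp: norm_mult space_pair_measure mult.commute mult_right_mono)
  qed measurable
  have dom: "norm ((g u x * k (u + \<sigma> x)) * cnj (\<Delta> u x)) \<le> (\<Sum>s=a..t. norm (g u x * \<eta> s (u + \<sigma> x)) * (B^2 * 2 powi s / 2 powi t))"
    if x: "x \<in> space X" for x u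
  proof -
    have "norm ((g u x * k (u + \<sigma> x)) * cnj (\<Delta> u x)) \<le> (\<Sum>s=a..t. norm (g u x * \<eta> s (u + \<sigma> x))) * norm (\<Delta> u x)"
      unfolding k_def sum_distrib_left norm_mult[of _ "cnj (\<Delta> u x)"] complex_mod_cnj by (intro mult_right_mono norm_sum) auto
    also have "\<dots> = (\<Sum>s=a..t. norm (g u x * \<eta> s (u + \<sigma> x)) * norm (\<Delta> u x))" by (rule sum_distrib_right)
    also have "\<dots> \<le> (\<Sum>s=a..t. norm (g u x * \<eta> s (u + \<sigma> x)) * (B^2 * 2 powi s / 2 powi t))"
    proof (rule sum_mono)
      fix s assume s: "s \<in> {a..t}"
      show "norm (g u x * \<eta> s (u + \<sigma> x)) * norm (\<Delta> u x) \<le> norm (g u x * \<eta> s (u + \<sigma> x)) * (B^2 * 2 powi s / 2 powi t)"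
      proof (cases "B * 2 powi s < norm (u + \<sigma> x)")
        case True
        thus ?thesis using scale_kernelsD(3)[OF K s True] by simp
      next
        case False
        have "norm (\<Delta> u x) \<le> B * norm (u + \<sigma> x) / 2 powi t" by (rule \<Delta>b[OF x])
        also have "\<dots> \<le> B * (B * 2 powi s) / 2 powi t" using False B
          by (intro divide_right_mono mult_left_mono) auto
        finally show ?thesis by (intro mult_left_mono) (auto simp: power2_eq_square mult.assoc)
      qed
    qed
    finally show ?thesis .
  qed
  have idom: "integrable (X \<Otimes>\<^sub>M lborel) (\<lambda>z. \<Sum>s=a..t. norm (g (snd z) (fst z) * \<eta> s (snd z + \<sigma> (fst z))) * (B^2 * 2 powi s / 2 powi t))"
    by (intro Bochner_Integration.integrable_sum integrable_mult_left integrable_norm) (use I in \<open>simp add: case_prod_unfold\<close>)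
  have i2: "integrable (X \<Otimes>\<^sub>M lborel) (\<lambda>z. (g (snd z) (fst z) * k (snd z + \<sigma> (fst z))) * cnj (\<Delta> (snd z) (fst z)))"
  proof (rule Bochner_Integration.integrable_bound[OF idom])
    show "AE z in X \<Otimes>\<^sub>M lborel. norm ((g (snd z) (fst z) * k (snd z + \<sigma> (fst z))) * cnj (\<Delta> (snd z) (fst z)))
      \<le> norm (\<Sum>s=a..t. norm (g (snd z) (fst z) * \<eta> s (snd z + \<sigma> (fst z))) * (B^2 * 2 powi s / 2 powi t))"
      using dom by (intro AE_I2) (fastforce simp: space_pair_measure intro: order_trans[OF _ abs_ge_self])
  qed measurable
  have e1: "(\<Sum>s=a..t. LINT u|lborel. g u x * \<eta> s (u + \<sigma> x)) * cnj (LINT u|lborel. g u x * \<eta> t (u + \<sigma> x))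
     = (LINT u|lborel. (g u x * k (u + \<sigma> x)) * cnj (\<Gamma> u x) + (g u x * k (u + \<sigma> x)) * cnj (\<Delta> u x))"
    if x: "x \<in> space X" for x
  proof -
    have "(\<Sum>s=a..t. LINT u|lborel. g u x * \<eta> s (u + \<sigma> x)) = (LINT u|lborel. g u x * k (u + \<sigma> x))"
      unfolding k_def sum_distrib_left by (rule Bochner_Integration.integral_sum[symmetric]) (use gi x in auto)
    hence "(\<Sum>s=a..t. LINT u|lborel. g u x * \<eta> s (u + \<sigma> x)) * cnj (LINT u|lborel. g u x * \<eta> t (u + \<sigma> x))
      = (LINT u|lborel. g u x * k (u + \<sigma> x) * cnj (LINT u|lborel. g u x * \<eta> t (u + \<sigma> x)))"
      using gki[OF x] by simp
    also have "\<dots> = (LINT u|lborel. (g u x * k (u + \<sigma> x)) * cnj (\<Gamma> u x + \<Delta> u x))"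
      using dec[OF x] by simp
    finally show ?thesis by (simp add: algebra_simps)
  qed
  let ?A = "\<lambda>z. (g (snd z) (fst z) * k (snd z + \<sigma> (fst z))) * cnj (\<Gamma> (snd z) (fst z))"
  let ?E = "\<lambda>z. (g (snd z) (fst z) * k (snd z + \<sigma> (fst z))) * cnj (\<Delta> (snd z) (fst z))"
  have "(LINT x|X. (\<Sum>s=a..t. LINT u|lborel. g u x * \<eta> s (u + \<sigma> x)) * cnj (LINT u|lborel. g u x * \<eta> t (u + \<sigma> x)))
    = (LINT x|X. LINT u|lborel. ?A (x,u) + ?E (x,u))"
    by (rule Bochner_Integration.integral_cong[OF refl]) (use e1 in simp)
  also have "\<dots> = (LINT z|(X \<Otimes>\<^sub>M lborel). ?A z + ?E z)"
    using P.integral_fst'[OF Bochner_Integration.integrable_add[OF i1 i2]] by simp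
  also have "\<dots> = (LINT z|(X \<Otimes>\<^sub>M lborel). ?A z) + (LINT z|(X \<Otimes>\<^sub>M lborel). ?E z)"
    by (rule Bochner_Integration.integral_add[OF i1 i2])
  also have "norm \<dots> \<le> norm (LINT z|(X \<Otimes>\<^sub>M lborel). ?A z) + norm (LINT z|(X \<Otimes>\<^sub>M lborel). ?E z)"
    by (rule norm_triangle_ineq)
  finally have main: "norm (LINT x|X. (\<Sum>s=a..t. LINT u|lborel. g u x * \<eta> s (u + \<sigma> x)) * cnj (LINT u|lborel. g u x * \<eta> t (u + \<sigma> x)))
    \<le> norm (LINT z|(X \<Otimes>\<^sub>M lborel). ?A z) + norm (LINT z|(X \<Otimes>\<^sub>M lborel). ?E z)" .
  have V0: "0 \<le> B * V" using IV[OF tt] by (rule order_trans[rotated]) (auto intro!: integral_nonneg_AE)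
  have "norm (LINT z|(X \<Otimes>\<^sub>M lborel). ?E z) \<le> (LINT z|(X \<Otimes>\<^sub>M lborel). norm (?E z))"
    by (rule integral_norm_bound)
  also have "\<dots> \<le> (LINT z|(X \<Otimes>\<^sub>M lborel). (\<Sum>s=a..t. norm (g (snd z) (fst z) * \<eta> s (snd z + \<sigma> (fst z))) * (B^2 * 2 powi s / 2 powi t)))"
    by (intro integral_mono integrable_norm i2 idom) (use dom in \<open>auto simp: space_pair_measure\<close>)
  also have "\<dots> = (\<Sum>s=a..t. (LINT z|(X \<Otimes>\<^sub>M lborel). norm (g (snd z) (fst z) * \<eta> s (snd z + \<sigma> (fst z)))) * (B^2 * 2 powi s / 2 powi t))"
    by (subst Bochner_Integration.integral_sum) 
       (auto intro!: integrable_mult_left integrable_norm I[unfolded case_prod_unfold])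
  also have "\<dots> \<le> (\<Sum>s=a..t. (B * V) * (B^2 * 2 powi s / 2 powi t))"
    by (intro sum_mono mult_right_mono) (use IV in \<open>auto simp: case_prod_unfold\<close>)
  also have "\<dots> = (B^3 * V) * ((\<Sum>s=a..t. 2 powi s) / 2 powi t)"
    by (simp add: sum_distrib_left sum_divide_distrib power2_eq_square power3_eq_cube mult_ac)
  also have "\<dots> \<le> (B^3 * V) * 2"
  proof (rule mult_left_mono)
    show "(\<Sum>s=a..t. 2 powi s) / 2 powi t \<le> (2::real)" using sum_powi_int_le[of a t] by (simp add: divide_le_eq)
    have *: "B^3 * V = B^2 * (B * V)" by (simp add: power2_eq_square power3_eq_cube)
    show "0 \<le> B^3 * V" unfolding * by (rule mult_nonneg_nonneg[OF zero_le_power2 V0])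
  qed
  finally have EE: "norm (LINT z|(X \<Otimes>\<^sub>M lborel). ?E z) \<le> 2 * B^3 * V" by simp
  have fixu: "norm (LINT x|X. ?A (x, u)) \<le> B * w u"
    if iu: "integrable X (\<lambda>x. g u x * k (u + \<sigma> x))"
      and wu: "\<forall>h. norm (LINT x|X. g u x * cnj (g (u + h) x) * (\<Sum>s=a..t. \<eta> s (u + \<sigma> x))) \<le> w u" for u
  proof -
    have w0: "0 \<le> w u" using wu norm_ge_zero order_trans by blast
    have ih: "integrable (X \<Otimes>\<^sub>M lborel) (\<lambda>z. (g u (fst z) * k (u + \<sigma> (fst z))) * cnj (g (u + snd z) (fst z) * \<eta> t (snd z)))"
    proof (rule Bochner_Integration.integrable_bound)
      have "integrable (X \<Otimes>\<^sub>M lborel) (\<lambda>z. norm (g u (fst z) * k (u + \<sigma> (fst z))) * norm (\<eta> t (snd z)))"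
      proof (rule P.Fubini_integrable)
        show "integrable X (\<lambda>x. LINT y|lborel. norm (norm (g u (fst (x, y)) * k (u + \<sigma> (fst (x, y)))) * norm (\<eta> t (snd (x, y)))))"
          using iu by auto
        show "AE x in X. integrable lborel (\<lambda>y. norm (g u (fst (x, y)) * k (u + \<sigma> (fst (x, y)))) * norm (\<eta> t (snd (x, y))))"
          using \<eta>i[OF tt] by auto
      qed measurable
      thus "integrable (X \<Otimes>\<^sub>M lborel) (\<lambda>z. norm (g u (fst z) * k (u + \<sigma> (fst z))) * norm (\<eta> t (snd z)))" .
      show "AE z in X \<Otimes>\<^sub>M lborel. norm ((g u (fst z) * k (u + \<sigma> (fst z))) * cnj (g (u + snd z) (fst z) * \<eta> t (snd z)))
         \<le> norm (norm (g u (fst z) * k (u + \<sigma> (fst z))) * norm (\<eta> t (snd z)))"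
        using g1 by (intro AE_I2) (auto simp: norm_mult intro!: mult_left_mono mult_left_le_one_le)
    qed measurable
    have "(LINT x|X. ?A (x, u)) = (LINT x|X. LINT h|lborel. (g u x * k (u + \<sigma> x)) * cnj (g (u + h) x * \<eta> t h))"
      unfolding \<Gamma>_def by (intro Bochner_Integration.integral_cong refl) (use ghi[of _ u 0] in \<open>simp add: integral_cnj[symmetric] del: complex_cnj_mult integral_cnj\<close>)
    also have "\<dots> = (LINT h|lborel. LINT x|X. (g u x * k (u + \<sigma> x)) * cnj (g (u + h) x * \<eta> t h))"
      using P.Fubini_integral[of "\<lambda>x h. (g u x * k (u + \<sigma> x)) * cnj (g (u + h) x * \<eta> t h)"] ih by (simp add: case_prod_unfold)
    also have "\<dots> = (LINT h|lborel. (LINT x|X. g u x * cnj (g (u + h) x) * k (u + \<sigma> x)) * cnj (\<eta> t h))"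
      by (subst integral_mult_left_zero[symmetric]) (simp add: mult_ac)
    also have "norm \<dots> \<le> (LINT h|lborel. norm ((LINT x|X. g u x * cnj (g (u + h) x) * k (u + \<sigma> x)) * cnj (\<eta> t h)))"
      by (rule integral_norm_bound)
    also have "\<dots> \<le> (LINT h|lborel. w u * norm (\<eta> t h))"
    proof (rule integral_mono_AE')
      show "integrable lborel (\<lambda>h. w u * norm (\<eta> t h))" using \<eta>i[OF tt] by auto
      show "AE h in lborel. norm ((LINT x|X. g u x * cnj (g (u + h) x) * k (u + \<sigma> x)) * cnj (\<eta> t h)) \<le> w u * norm (\<eta> t h)"
        using wu unfolding k_def by (auto simp: norm_mult intro!: mult_right_mono AE_I2)
    qed (use w0 in auto)
    also have "\<dots> = w u * (LINT h|lborel. norm (\<eta> t h))" by simp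
    also have "\<dots> \<le> w u * B" using scale_kernelsD(2)[OF K tt] w0 by (intro mult_left_mono) auto
    finally show ?thesis by (simp add: mult.commute)
  qed
  have "norm (LINT z|(X \<Otimes>\<^sub>M lborel). ?A z) = norm (LINT u|lborel. LINT x|X. ?A (x, u))"
    using P.integral_snd[of "\<lambda>x u. ?A (x, u)"] i1 by (simp add: case_prod_unfold)
  also have "\<dots> \<le> (LINT u|lborel. norm (LINT x|X. ?A (x, u)))" by (rule integral_norm_bound)
  also have "\<dots> \<le> (LINT u|lborel. B * w u)"
  proof (rule integral_mono_AE)
    show "integrable lborel (\<lambda>u. norm (LINT x|X. ?A (x, u)))"
      using P.integrable_snd[of "\<lambda>x u. ?A (x, u)"] i1 by (simp add: case_prod_unfold)
    have "AE u in lborel. integrable X (\<lambda>x. g u x * k (u + \<sigma> x))"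
      using P.AE_integrable_snd[of "\<lambda>x u. g u x * k (u + \<sigma> x)"] Ik by simp
    thus "AE u in lborel. norm (LINT x|X. ?A (x, u)) \<le> B * w u"
      using C by eventually_elim (rule fixu)
  qed (use w in auto)
  also have "\<dots> \<le> B * W" using w B by (simp add: mult_left_mono)
  finally show ?thesis using main EE by linarith
qed

text \<open>
  Cauchy--Schwarz in the form \<open>2 |f| |D| \<le> l |f|\<^sup>2 + |D|\<^sup>2 / l\<close>, with the free parameter \<open>l\<close> to be
  optimised by the caller. As \<open>|f| \<le> 1\<close>, the norm of \<open>f\<close> in \<open>L\<^sup>2\<close> is controlled by the one in \<open>L\<^sup>1\<close>.
\<close>

lemma multiscale_pairing_bound:
  fixes \<sigma> :: "'x \<Rightarrow> 'v::euclidean_space" and g :: "'v \<Rightarrow> 'x \<Rightarrow> complex"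
  assumes X: "sigma_finite_measure X"
    and f: "integrable X f" and f1: "\<And>x. norm (f x) \<le> 1" and fV: "(LINT x|X. norm (f x)) \<le> V"
    and g: "(\<lambda>(x, u). g u x) \<in> borel_measurable (X \<Otimes>\<^sub>M lborel)" and g1: "\<And>u x. norm (g u x) \<le> 1"
    and \<sigma>[measurable]: "\<sigma> \<in> borel_measurable X"
    and K: "scale_kernels B {a..b} \<eta>" and B: "B \<ge> 0"
    and I: "\<And>s. s \<in> {a..b} \<Longrightarrow> integrable (X \<Otimes>\<^sub>M lborel) (\<lambda>(x, u). g u x * \<eta> s (u + \<sigma> x))"
    and IV: "\<And>s. s \<in> {a..b} \<Longrightarrow>
       (LINT (x, u)|(X \<Otimes>\<^sub>M lborel). norm (g u x * \<eta> s (u + \<sigma> x))) \<le> B * V"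
    and C: "\<And>t. t \<in> {a..b} \<Longrightarrow>
       AE u in lborel. \<forall>h. norm (LINT x|X. g u x * cnj (g (u + h) x) * (\<Sum>s=a..t. \<eta> s (u + \<sigma> x))) \<le> w u"
    and w: "integrable lborel w" "(LINT u|lborel. w u) \<le> W" and l: "l > 0"
  shows "norm (LINT x|X. f x * (\<Sum>s=a..b. LINT u|lborel. g u x * \<eta> s (u + \<sigma> x)))
     \<le> (l * V + 2 * real (card {a..b}) * (2 * B^3 * V + B * W) / l) / 2"
proof -
  interpret X: sigma_finite_measure X by (rule X)
  interpret P: pair_sigma_finite X lborel by unfold_locales
  note [measurable (raw)] = measurable_uncurried[OF g]
  have \<eta>i: "integrable lborel (\<eta> s)" if "s \<in> {a..b}" for s
    using scale_kernelsD(1)[OF K that] .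
  have fm[measurable]: "f \<in> borel_measurable X" using f by auto
  define d where "d = (\<lambda>s x. LINT u|lborel. g u x * \<eta> s (u + \<sigma> x))"
  have di: "integrable X (d s)" if "s \<in> {a..b}" for s
    using P.integrable_fst[OF I[OF that]] by (simp add: d_def)
  have dm[measurable]: "d s \<in> borel_measurable X" if "s \<in> {a..b}" for s
    using di[OF that] by auto
  have db: "norm (d s x) \<le> B" if s: "s \<in> {a..b}" and x: "x \<in> space X" for s x
  proof -
    have "norm (d s x) \<le> (LINT u|lborel. norm (g u x * \<eta> s (u + \<sigma> x)))"
      unfolding d_def by (rule integral_norm_bound)
    also have "\<dots> \<le> (LINT u|lborel. norm (\<eta> s (u + \<sigma> x)))"
      using \<eta>i[OF s] g1 x
      by (intro integral_mono integrable_norm integrable_bounded_mult[where c=1])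
         (auto simp: norm_mult mult_left_le_one_le integrable_translate_iff)
    also have "\<dots> \<le> B" using scale_kernelsD(2)[OF K s]
      by (simp add: integral_translate[of "\<lambda>u. norm (\<eta> s u)"])
    finally show ?thesis .
  qed
  define E where "E = (\<lambda>t x. (\<Sum>s=a..t. d s x) * cnj (d t x))"
  have Ei: "integrable X (E t)" if t: "t \<in> {a..b}" for t
  proof (rule Bochner_Integration.integrable_bound)
    show "integrable X (\<lambda>x. (\<Sum>s=a..t. norm (d s x)) * B)"
      using di t by (intro integrable_mult_left Bochner_Integration.integrable_sum integrable_norm) auto
    have "norm (E t x) \<le> (\<Sum>s=a..t. norm (d s x)) * B" if "x \<in> space X" for x
      unfolding E_def norm_mult complex_mod_cnj
      by (rule mult_mono[OF norm_sum db[OF t that]]) (auto intro: sum_nonneg)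
    thus "AE x in X. norm (E t x) \<le> norm ((\<Sum>s=a..t. norm (d s x)) * B)"
      by (intro AE_I2) (fastforce intro: order_trans[OF _ abs_ge_self])
    have "(\<lambda>x. \<Sum>s=a..t. d s x) \<in> borel_measurable X"
      using t by (intro borel_measurable_sum dm) auto
    thus "E t \<in> borel_measurable X" unfolding E_def using dm[OF t] by measurable
  qed
  have Eb: "norm (LINT x|X. E t x) \<le> 2 * B^3 * V + B * W" if t: "t \<in> {a..b}" for t
  proof -
    have K': "scale_kernels B {a..t} \<eta>" using K t unfolding scale_kernels_def by auto
    show ?thesis unfolding E_def d_def
      by (rule scale_pairing_bound[OF X g g1 \<sigma> K' B _ _ _ C[OF t] w]) (use t I IV in auto)
  qed
  define R where "R = (\<lambda>x. (l * norm (f x) + (2 / l) * (\<Sum>t=a..b. Re (E t x))) / 2)"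
  have Ri: "integrable X R" unfolding R_def
    by (intro integrable_divide Bochner_Integration.integrable_add integrable_mult_right Bochner_Integration.integrable_sum integrable_Re integrable_norm f Ei) auto
  have pt: "norm (f x * (\<Sum>s=a..b. d s x)) \<le> R x" for x
  proof -
    let ?D = "norm (\<Sum>s=a..b. d s x)"
    have "0 \<le> (l * norm (f x) - ?D)\<^sup>2 / l" using l by simp
    hence "2 * (norm (f x) * ?D) \<le> l * (norm (f x))\<^sup>2 + ?D\<^sup>2 / l"
      using l by (simp add: power2_eq_square field_simps)
    also have "l * (norm (f x))\<^sup>2 \<le> l * norm (f x)"
      using l f1[of x] by (simp add: power2_eq_square mult_left_le_one_le)
    also have "?D\<^sup>2 / l \<le> (2 * Re (\<Sum>t=a..b. E t x)) / l"
      unfolding E_def using l by (intro divide_right_mono norm_sum_square_le) auto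
    finally show ?thesis unfolding R_def by (simp add: norm_mult)
  qed
  have "norm (LINT x|X. f x * (\<Sum>s=a..b. d s x)) \<le> (LINT x|X. norm (f x * (\<Sum>s=a..b. d s x)))"
    by (rule integral_norm_bound)
  also have "\<dots> \<le> (LINT x|X. R x)"
    by (rule integral_mono_AE'[OF Ri]) (use pt in \<open>auto intro: order_trans[OF norm_ge_zero pt]\<close>)
  also have "\<dots> = (l * (LINT x|X. norm (f x)) + (2 / l) * (\<Sum>t=a..b. Re (LINT x|X. E t x))) / 2"
  proof -
    have "(LINT x|X. l * norm (f x) + (2 / l) * (\<Sum>t=a..b. Re (E t x)))
       = (LINT x|X. l * norm (f x)) + (LINT x|X. (2 / l) * (\<Sum>t=a..b. Re (E t x)))"
      by (intro Bochner_Integration.integral_add integrable_mult_right Bochner_Integration.integrable_sum integrable_Re integrable_norm f Ei) auto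
    also have "(LINT x|X. (2 / l) * (\<Sum>t=a..b. Re (E t x))) = (2 / l) * (\<Sum>t=a..b. LINT x|X. Re (E t x))"
      by (simp only: integral_mult_right_zero, subst Bochner_Integration.integral_sum, rule integrable_Re, rule Ei, assumption, simp)
    also have "(\<Sum>t=a..b. LINT x|X. Re (E t x)) = (\<Sum>t=a..b. Re (LINT x|X. E t x))"
      by (intro sum.cong refl integral_Re Ei) auto
    finally show ?thesis unfolding R_def by simp
  qed
  also have "\<dots> \<le> (l * V + (2 / l) * (\<Sum>t=a..b. 2 * B^3 * V + B * W)) / 2"
    using l fV Eb by (intro divide_right_mono add_mono mult_left_mono sum_mono order_trans[OF complex_Re_le_cmod]) auto
  finally show ?thesis unfolding d_def by (simp add: mult_ac)
qed

section \<open>Forms indexed by a finite set of variables\<close>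

abbreviation lebesgue_power :: "nat set \<Rightarrow> (nat \<Rightarrow> 'v::euclidean_space) measure" where
  "lebesgue_power I \<equiv> PiM I (\<lambda>_. lborel)"

interpretation lborel_product: product_sigma_finite "\<lambda>_::nat. lborel :: 'v::euclidean_space measure"
  by unfold_locales

lemma sigma_finite_lebesgue_power: "finite I \<Longrightarrow> sigma_finite_measure (lebesgue_power I)"
  by (rule lborel_product.sigma_finite)

text \<open>
  Allows Fubini's theorem for binary products to be used for splitting off one coordinate.
\<close>

lemma lebesgue_power_insert:
  assumes "finite J" "j \<notin> J"
  shows "distr (lebesgue_power J \<Otimes>\<^sub>M lborel) (lebesgue_power (insert j J)) (\<lambda>(x, u). x(j := u)) = lebesgue_power (insert j J)"
proof (rule measure_eqI)
  fix A :: "(nat \<Rightarrow> 'a) set"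
  assume "A \<in> sets (distr (lebesgue_power J \<Otimes>\<^sub>M lborel) (lebesgue_power (insert j J)) (\<lambda>(x, u). x(j := u)))"
  hence A[measurable]: "A \<in> sets (lebesgue_power (insert j J))" by simp
  have [measurable]: "(\<lambda>(x, u). x(j := u)) \<in> measurable (lebesgue_power J \<Otimes>\<^sub>M lborel) (lebesgue_power (insert j J))"
    by (rule measurable_add_dim)
  have "emeasure (distr (lebesgue_power J \<Otimes>\<^sub>M lborel) (lebesgue_power (insert j J)) (\<lambda>(x, u). x(j := u))) A
     = (\<integral>\<^sup>+ z. indicator A z \<partial>distr (lebesgue_power J \<Otimes>\<^sub>M lborel) (lebesgue_power (insert j J)) (\<lambda>(x, u). x(j := u)))"
    by (subst nn_integral_indicator) auto
  also have "\<dots> = (\<integral>\<^sup>+ z. indicator A ((fst z)(j := snd z)) \<partial>(lebesgue_power J \<Otimes>\<^sub>M lborel))"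
    by (subst nn_integral_distr) (auto simp: case_prod_unfold)
  also have "\<dots> = (\<integral>\<^sup>+ x. \<integral>\<^sup>+ u. indicator A (x(j := u)) \<partial>lborel \<partial>lebesgue_power J)"
    by (subst lborel.nn_integral_fst[symmetric]) (auto simp: case_prod_unfold intro: measurable_compose[OF measurable_add_dim[unfolded case_prod_unfold]])
  also have "\<dots> = emeasure (lebesgue_power (insert j J)) A"
    by (subst lborel_product.product_nn_integral_insert[OF assms, symmetric]) auto
  finally show "emeasure (distr (lebesgue_power J \<Otimes>\<^sub>M lborel) (lebesgue_power (insert j J)) (\<lambda>(x, u). x(j := u))) A
     = emeasure (lebesgue_power (insert j J)) A" .
qed simp

lemma integrable_lebesgue_power_insert:
  fixes f :: "(nat \<Rightarrow> 'v::euclidean_space) \<Rightarrow> 'b::{banach, second_countable_topology}"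
  assumes J: "finite J" "j \<notin> J" and f: "f \<in> borel_measurable (lebesgue_power (insert j J))"
  shows "integrable (lebesgue_power (insert j J)) f \<longleftrightarrow>
     integrable (lebesgue_power J \<Otimes>\<^sub>M lborel) (\<lambda>(x, u). f (x(j := u)))"
    and "integral\<^sup>L (lebesgue_power (insert j J)) f =
     integral\<^sup>L (lebesgue_power J \<Otimes>\<^sub>M lborel) (\<lambda>(x, u). f (x(j := u)))"
proof -
  have m: "(\<lambda>(x, u). x(j := u)) \<in> measurable (lebesgue_power J \<Otimes>\<^sub>M lborel) (lebesgue_power (insert j J))"
    by (rule measurable_add_dim)
  show "integrable (lebesgue_power (insert j J)) f \<longleftrightarrow>
     integrable (lebesgue_power J \<Otimes>\<^sub>M lborel) (\<lambda>(x, u). f (x(j := u)))"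
    using integrable_distr_eq[OF m f] unfolding lebesgue_power_insert[OF J] by (simp add: case_prod_unfold)
  show "integral\<^sup>L (lebesgue_power (insert j J)) f =
     integral\<^sup>L (lebesgue_power J \<Otimes>\<^sub>M lborel) (\<lambda>(x, u). f (x(j := u)))"
    using integral_distr[OF m f] unfolding lebesgue_power_insert[OF J] by (simp add: case_prod_unfold)
qed

text \<open>
  Integrating the omitted variable \<open>x i\<close> first, the kernel contributes its \<open>L\<^sup>1\<close> norm by translation
  invariance, whatever the other variables are. All trivial bounds for the form rest on this.
\<close>

lemma lebesgue_power_marginal:
  fixes f :: "(nat \<Rightarrow> 'v::euclidean_space) \<Rightarrow> 'b::{real_normed_algebra, banach, second_countable_topology}"
  assumes I: "finite I" "i \<in> I" and f: "integrable (lebesgue_power (I - {i})) f"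
    and k: "integrable lborel k"
  shows "integrable (lebesgue_power I) (\<lambda>x. norm (f (restrict x (I - {i}))) * norm (k (\<Sum>j\<in>I. x j) :: 'b))"
    and "(LINT x|lebesgue_power I. norm (f (restrict x (I - {i}))) * norm (k (\<Sum>j\<in>I. x j)))
      = (LINT x|lebesgue_power (I - {i}). norm (f x)) * (LINT v|lborel. norm (k v))"
proof -
  define J where "J = I - {i}"
  have J: "finite J" "i \<notin> J" and IJ: "I = insert i J" using I unfolding J_def by auto
  interpret X: sigma_finite_measure "lebesgue_power J :: (nat \<Rightarrow> 'v) measure"
    by (rule sigma_finite_lebesgue_power[OF J(1)])
  interpret P: pair_sigma_finite "lebesgue_power J :: (nat \<Rightarrow> 'v) measure" lborel by unfold_locales
  have fi: "integrable (lebesgue_power J) f" using f by (simp add: J_def)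
  have [measurable]: "f \<in> borel_measurable (lebesgue_power J)" "k \<in> borel_measurable borel" using fi k by auto
  have [measurable]: "(\<lambda>x. restrict x J) \<in> measurable (lebesgue_power I) (lebesgue_power J)"
    by (rule measurable_restrict_subset) (auto simp: IJ)
  let ?h = "\<lambda>x. norm (f (restrict x J)) * norm (k (\<Sum>j\<in>I. x j))"
  have [measurable]: "?h \<in> borel_measurable (lebesgue_power I)" by measurable
  have hI: "?h \<in> borel_measurable (lebesgue_power (insert i J))" using \<open>?h \<in> borel_measurable (lebesgue_power I)\<close> by (simp add: IJ)
  have eq: "?h (x(i := u)) = norm (f x) * norm (k (u + (\<Sum>j\<in>J. x j)))" if "x \<in> space (lebesgue_power J)" for x u
  proof -
    have "restrict (x(i := u)) J = x" using that J by (auto simp: space_PiM PiE_def extensional_def restrict_def fun_eq_iff)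
    moreover have "(\<Sum>j\<in>I. (x(i := u)) j) = u + (\<Sum>j\<in>J. x j)" using J by (auto simp: IJ intro!: sum.cong)
    ultimately show ?thesis by simp
  qed
  have ki: "integrable lborel (\<lambda>u. norm (k (u + c)))" for c using k by (auto simp: integrable_translate_iff)
  have pi: "integrable (lebesgue_power J \<Otimes>\<^sub>M lborel) (\<lambda>(x, u). norm (f x) * norm (k (u + (\<Sum>j\<in>J. x j))))"
  proof (rule P.Fubini_integrable)
    show "integrable (lebesgue_power J) (\<lambda>x. LINT y|lborel. norm (case (x, y) of (x, u) \<Rightarrow> norm (f x) * norm (k (u + (\<Sum>j\<in>J. x j)))))"
      using fi by (simp add: integral_translate[of "\<lambda>u. norm (k u)"])
    show "AE x in lebesgue_power J. integrable lborel (\<lambda>y. case (x, y) of (x, u) \<Rightarrow> norm (f x) * norm (k (u + (\<Sum>j\<in>J. x j))))"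
      using ki by auto
  qed measurable
  have cong: "integrable (lebesgue_power J \<Otimes>\<^sub>M lborel) (\<lambda>(x, u). ?h (x(i := u))) \<longleftrightarrow>
      integrable (lebesgue_power J \<Otimes>\<^sub>M lborel) (\<lambda>(x, u). norm (f x) * norm (k (u + (\<Sum>j\<in>J. x j))))"
    by (rule Bochner_Integration.integrable_cong[OF refl]) (simp only: case_prod_unfold, rule eq, auto simp: space_pair_measure)
  have "integrable (lebesgue_power (insert i J)) ?h"
    unfolding integrable_lebesgue_power_insert(1)[OF J hI] cong by (rule pi)
  thus "integrable (lebesgue_power I) (\<lambda>x. norm (f (restrict x (I - {i}))) * norm (k (\<Sum>j\<in>I. x j) :: 'b))"
    by (simp add: IJ J_def[symmetric] J)
  have "integral\<^sup>L (lebesgue_power (insert i J)) ?h = integral\<^sup>L (lebesgue_power J \<Otimes>\<^sub>M lborel) (\<lambda>(x, u). ?h (x(i := u)))"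
    by (rule integrable_lebesgue_power_insert(2)[OF J hI])
  also have "\<dots> = integral\<^sup>L (lebesgue_power J \<Otimes>\<^sub>M lborel) (\<lambda>(x, u). norm (f x) * norm (k (u + (\<Sum>j\<in>J. x j))))"
    by (rule Bochner_Integration.integral_cong[OF refl]) (simp only: case_prod_unfold, rule eq, auto simp: space_pair_measure)
  also have "\<dots> = (LINT x|lebesgue_power J. LINT u|lborel. norm (f x) * norm (k (u + (\<Sum>j\<in>J. x j))))"
    by (rule P.integral_fst[symmetric, OF pi])
  also have "\<dots> = (LINT x|lebesgue_power J. norm (f x)) * (LINT v|lborel. norm (k v))"
    by (simp add: integral_translate[of "\<lambda>u. norm (k u)"])
  finally show "(LINT x|lebesgue_power I. norm (f (restrict x (I - {i}))) * norm (k (\<Sum>j\<in>I. x j)))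
      = (LINT x|lebesgue_power (I - {i}). norm (f x)) * (LINT v|lborel. norm (k v))"
    by (simp add: IJ J_def[symmetric] J)
qed

text \<open>
  The simplex form with variables indexed by an arbitrary finite set. Restricting to \<open>I - {i}\<close>
  instead of renumbering makes the removal of a variable in the induction free of index shifts.
\<close>

definition index_form ::
    "nat set \<Rightarrow> ('v::euclidean_space \<Rightarrow> complex) \<Rightarrow> (nat \<Rightarrow> (nat \<Rightarrow> 'v) \<Rightarrow> complex) \<Rightarrow> complex" where
  "index_form I K F = (LINT x|lebesgue_power I. (\<Prod>i\<in>I. F i (restrict x (I - {i}))) * K (\<Sum>i\<in>I. x i))"

lemma measurable_restrict_coordinate [measurable]:
  "(\<lambda>x. restrict x (I - {i})) \<in> measurable (lebesgue_power I) (lebesgue_power (I - {i}))"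
  by (rule measurable_restrict_subset) auto

lemma norm_prod_le_factor:
  fixes z :: "'i \<Rightarrow> complex"
  assumes "finite J" "i \<in> J" "\<And>j. j \<in> J \<Longrightarrow> norm (z j) \<le> 1"
  shows "norm (\<Prod>j\<in>J. z j) \<le> norm (z i)"
proof -
  have "norm (\<Prod>j\<in>J. z j) = norm (z i) * (\<Prod>j\<in>J-{i}. norm (z j))"
    using assms by (simp add: prod.remove[of J i] norm_mult prod_norm)
  moreover have "(\<Prod>j\<in>J-{i}. norm (z j)) \<le> 1" using assms by (intro prod_le_1) auto
  ultimately show ?thesis using mult_left_mono[of _ 1 "norm (z i)"] by simp
qed

lemma index_form_integrable:
  fixes F :: "nat \<Rightarrow> (nat \<Rightarrow> 'v::euclidean_space) \<Rightarrow> complex"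
  assumes I: "finite I" "i \<in> I"
    and F: "\<And>j. j \<in> I \<Longrightarrow> F j \<in> borel_measurable (lebesgue_power (I - {j}))"
    and J: "i \<in> J" "J \<subseteq> I" and F1: "\<And>j x. j \<in> J \<Longrightarrow> norm (F j x) \<le> 1" 
    and Fi: "integrable (lebesgue_power (I - {i})) (F i)" and K: "integrable lborel K"
  shows "integrable (lebesgue_power I) (\<lambda>x. (\<Prod>j\<in>J. F j (restrict x (I - {j}))) * K (\<Sum>j\<in>I. x j))" (is ?A)
    and "(LINT x|lebesgue_power I. norm ((\<Prod>j\<in>J. F j (restrict x (I - {j}))) * K (\<Sum>j\<in>I. x j)))
      \<le> (LINT x|lebesgue_power (I - {i}). norm (F i x)) * (LINT v|lborel. norm (K v))"
proof -
  have [measurable]: "K \<in> borel_measurable borel" using K by auto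
  have [measurable]: "(\<lambda>x. F j (restrict x (I - {j}))) \<in> borel_measurable (lebesgue_power I)" if "j \<in> J" for j
    using that J by (intro measurable_compose[OF measurable_restrict_coordinate F]) auto
  have m[measurable]: "(\<lambda>x. (\<Prod>j\<in>J. F j (restrict x (I - {j}))) * K (\<Sum>j\<in>I. x j)) \<in> borel_measurable (lebesgue_power I)"
    by (intro borel_measurable_times borel_measurable_prod) auto
  note M = lebesgue_power_marginal[OF I Fi K]
  have fJ: "finite J" using I J finite_subset by auto
  have le: "norm ((\<Prod>j\<in>J. F j (restrict x (I - {j}))) * K (\<Sum>j\<in>I. x j))
      \<le> norm (F i (restrict x (I - {i}))) * norm (K (\<Sum>j\<in>I. x j))" for x
    unfolding norm_mult by (intro mult_right_mono norm_prod_le_factor[OF fJ J(1)] F1) auto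
  show ?A
    by (rule Bochner_Integration.integrable_bound[OF M(1) m]) (use le in \<open>auto simp: norm_mult\<close>)
  show "(LINT x|lebesgue_power I. norm ((\<Prod>j\<in>J. F j (restrict x (I - {j}))) * K (\<Sum>j\<in>I. x j)))
      \<le> (LINT x|lebesgue_power (I - {i}). norm (F i x)) * (LINT v|lborel. norm (K v))"
    unfolding M(2)[symmetric] by (rule integral_mono[OF integrable_norm[OF \<open>?A\<close>] M(1) le])
qed

lemma AE_slice_integrable:
  fixes f :: "(nat \<Rightarrow> 'v::euclidean_space) \<Rightarrow> complex"
  assumes J: "finite J" "j \<notin> J" and f: "integrable (lebesgue_power (insert j J)) f"
  shows "AE u in lborel. integrable (lebesgue_power J) (\<lambda>z. f (z(j := u)))"
    and "integrable lborel (\<lambda>u. LINT z|lebesgue_power J. norm (f (z(j := u))))"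
    and "(LINT u|lborel. LINT z|lebesgue_power J. norm (f (z(j := u)))) = (LINT x|lebesgue_power (insert j J). norm (f x))"
proof -
  interpret X: sigma_finite_measure "lebesgue_power J :: (nat \<Rightarrow> 'v) measure"
    by (rule sigma_finite_lebesgue_power[OF J(1)])
  interpret P: pair_sigma_finite "lebesgue_power J :: (nat \<Rightarrow> 'v) measure" lborel by unfold_locales
  have m: "f \<in> borel_measurable (lebesgue_power (insert j J))"
    "(\<lambda>x. norm (f x)) \<in> borel_measurable (lebesgue_power (insert j J))" using f by auto
  note i = f[unfolded integrable_lebesgue_power_insert(1)[OF J m(1)]]
  note n = integrable_norm[OF f, unfolded integrable_lebesgue_power_insert(1)[OF J m(2)]]
  show "AE u in lborel. integrable (lebesgue_power J) (\<lambda>z. f (z(j := u)))"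
    using P.AE_integrable_snd[OF i] .
  show "integrable lborel (\<lambda>u. LINT z|lebesgue_power J. norm (f (z(j := u))))"
    using P.integrable_snd[OF n] .
  show "(LINT u|lborel. LINT z|lebesgue_power J. norm (f (z(j := u)))) = (LINT x|lebesgue_power (insert j J). norm (f x))"
    using P.integral_snd[OF n] integrable_lebesgue_power_insert(2)[OF J m(2)] by simp
qed

text \<open>
  The shift \<open>y\<close> is part of the statement because freezing a variable translates the kernels.
\<close>

definition bounded_form_estimate :: "'v::euclidean_space itself \<Rightarrow> nat set \<Rightarrow> real \<Rightarrow> real \<Rightarrow> real \<Rightarrow> bool" where
  "bounded_form_estimate _ I B C \<delta> \<longleftrightarrow>
     (\<forall>a b. \<forall>\<eta> :: int \<Rightarrow> 'v \<Rightarrow> complex. \<forall>F V y. scale_kernels B {a..b} \<eta> \<longrightarrow>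
        (\<forall>i\<in>I. integrable (lebesgue_power (I - {i})) (F i) \<and> (\<forall>x. norm (F i x) \<le> 1) \<and>
            (LINT x|lebesgue_power (I - {i}). norm (F i x)) \<le> V) \<longrightarrow>
        norm (index_form I (\<lambda>v. \<Sum>s=a..b. \<eta> s (y + v)) F) \<le> C * real (card {a..b}) powr (1 - \<delta>) * V)"

lemma bounded_form_estimateD:
  fixes \<eta> :: "int \<Rightarrow> 'v::euclidean_space \<Rightarrow> complex"
  assumes "bounded_form_estimate TYPE('v) I B C \<delta>" "scale_kernels B {a..b} \<eta>"
    "\<And>i. i \<in> I \<Longrightarrow> integrable (lebesgue_power (I - {i})) (F i)" "\<And>i x. i \<in> I \<Longrightarrow> norm (F i x) \<le> 1"
    "\<And>i. i \<in> I \<Longrightarrow> (LINT x|lebesgue_power (I - {i}). norm (F i x)) \<le> V"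
  shows "norm (index_form I (\<lambda>v. \<Sum>s=a..b. \<eta> s (y + v)) F) \<le> C * real (card {a..b}) powr (1 - \<delta>) * V"
  using assms unfolding bounded_form_estimate_def by blast

text \<open>
  With one variable the single function is a constant, and the mean zero condition kills the form.
\<close>

lemma bounded_form_estimate_singleton:
  "bounded_form_estimate TYPE('v::euclidean_space) {j} B 0 1"
  unfolding bounded_form_estimate_def
proof safe
  fix a b :: int and \<eta> :: "int \<Rightarrow> 'v \<Rightarrow> complex" and F :: "nat \<Rightarrow> (nat \<Rightarrow> 'v) \<Rightarrow> complex" and V y
  assume K: "scale_kernels B {a..b} \<eta>"
  define k where "k = (\<lambda>v. \<Sum>s=a..b. \<eta> s (y + v))"
  have t: "integrable lborel (\<lambda>v. \<eta> s (y + v))" "(LINT v|lborel. \<eta> s (y + v)) = 0" if "s \<in> {a..b}" for s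
    using integrable_translate_iff[of "\<eta> s" y] integral_translate[of "\<eta> s" y] scale_kernelsD(1,5)[OF K that]
    by (simp_all add: add.commute)
  have k: "integrable lborel k" "(LINT v|lborel. k v) = 0"
    unfolding k_def using t by (auto simp: Bochner_Integration.integral_sum)
  have [simp]: "restrict x {} = (\<lambda>_. undefined)" for x :: "nat \<Rightarrow> 'v" by (auto simp: restrict_def)
  have "index_form {j} k F = (LINT x|lebesgue_power {j}. (\<lambda>v. F j (\<lambda>_. undefined) * k v) (x j))"
    unfolding index_form_def by simp
  also have "\<dots> = (LINT v|lborel. F j (\<lambda>_. undefined) * k v)"
    by (rule lborel_product.product_integral_singleton) (use k in auto)
  also have "\<dots> = 0" using k by simp
  finally show "norm (index_form {j} (\<lambda>v. \<Sum>s=a..b. \<eta> s (y + v)) F) \<le> 0 * real (card {a..b}) powr (1 - 1) * V"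
    by (simp add: k_def)
qed

lemma restrict_upd_insert:
  assumes "i \<in> J" "j \<notin> J"
  shows "restrict (x(j := u)) (insert j J - {i}) = (restrict x (J - {i}))(j := u)"
  using assms by (auto simp: restrict_def fun_eq_iff)

text \<open>
  The variable \<open>j\<close> is integrated out; the function \<open>F j\<close> does not depend on it and plays the role of
  \<open>f\<close> in \<open>multiscale_pairing_bound\<close>. The square of the resulting bound is \<open>N\<close> times the estimate for
  \<open>J\<close>, whence the exponent gain is halved.
\<close>

lemma bounded_form_estimate_insert:
  assumes J: "finite J" "J \<noteq> {}" "j \<notin> J" and B: "B \<ge> 0"
    and Q: "bounded_form_estimate TYPE('v::euclidean_space) J B C \<delta>" and C: "C \<ge> 0" and \<delta>: "\<delta> \<le> 1"
  shows "bounded_form_estimate TYPE('v) (insert j J) B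
     (sqrt (4 * B^3 + 2 * B * C * real (card J) + 1)) (\<delta> / 2)"
  unfolding bounded_form_estimate_def
proof (intro allI impI)
  fix a b :: int and \<eta> :: "int \<Rightarrow> 'v \<Rightarrow> complex" and F :: "nat \<Rightarrow> (nat \<Rightarrow> 'v) \<Rightarrow> complex" and V y
  define I where "I = insert j J"
  define M where "M = 4 * B^3 + 2 * B * C * real (card J) + 1"
  define N where "N = real (card {a..b})"
  define k where "k = (\<lambda>v. \<Sum>s=a..b. \<eta> s (y + v))"
  assume K: "scale_kernels B {a..b} \<eta>"
    and F: "\<forall>i\<in>insert j J. integrable (lebesgue_power (insert j J - {i})) (F i) \<and> (\<forall>x. norm (F i x) \<le> 1) \<and>
            (LINT x|lebesgue_power (insert j J - {i}). norm (F i x)) \<le> V"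
  have I: "finite I" "j \<in> I" "J \<subseteq> I" "I - {j} = J" unfolding I_def using J by auto
  have IJ: "I - {i} = insert j (J - {i})" if "i \<in> J" for i using that J unfolding I_def by auto
  have Fi: "integrable (lebesgue_power (I - {i})) (F i)" and F1: "norm (F i x) \<le> 1"
    and FV: "(LINT x|lebesgue_power (I - {i}). norm (F i x)) \<le> V" if "i \<in> I" for i x
    using F that unfolding I_def by blast+
  have Fm: "F i \<in> borel_measurable (lebesgue_power (I - {i}))" if "i \<in> I" for i using Fi[OF that] by auto
  have V0: "0 \<le> V" using FV[OF I(2)] by (rule order_trans[rotated]) (auto intro!: integral_nonneg_AE)
  have M1: "M \<ge> 1" unfolding M_def using B C by simp
  have \<eta>i: "integrable lborel (\<lambda>v. \<eta> s (y + v))" if "s \<in> {a..b}" for s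
    using integrable_translate_iff[of "\<eta> s" y] scale_kernelsD(1)[OF K that] by (simp add: add.commute)
  have \<eta>B: "(LINT v|lborel. norm (\<eta> s (y + v))) \<le> B" if "s \<in> {a..b}" for s
    using integral_translate[of "\<lambda>v. norm (\<eta> s v)" y] scale_kernelsD(2)[OF K that] by (simp add: add.commute)
  have ki: "integrable lborel k" unfolding k_def using \<eta>i by auto
  let ?X = "lebesgue_power J :: (nat \<Rightarrow> 'v) measure"
  have sX: "sigma_finite_measure ?X" by (rule sigma_finite_lebesgue_power[OF J(1)])
  define \<sigma> where "\<sigma> = (\<lambda>x::nat \<Rightarrow> 'v. y + (\<Sum>i\<in>J. x i))"
  define g where "g = (\<lambda>u x. \<Prod>i\<in>J. F i (restrict (x(j := u)) (I - {i})))"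
  have \<sigma>m: "\<sigma> \<in> borel_measurable ?X" unfolding \<sigma>_def by measurable
  have sumI: "(\<Sum>i\<in>I. (x(j := u)) i) = u + (\<Sum>i\<in>J. x i)" for x :: "nat \<Rightarrow> 'v" and u
  proof -
    have "(\<Sum>i\<in>J. (x(j := u)) i) = (\<Sum>i\<in>J. x i)"
      using J(3) by (intro sum.cong refl) (metis fun_upd_other)
    thus ?thesis using J unfolding I_def by simp
  qed
  have gm: "(\<lambda>(x, u). g u x) \<in> borel_measurable (?X \<Otimes>\<^sub>M lborel)"
    unfolding g_def case_prod_unfold
  proof (intro borel_measurable_prod)
    fix i assume i: "i \<in> J"
    have "(\<lambda>z. (fst z)(j := snd z)) \<in> measurable (?X \<Otimes>\<^sub>M lborel) (lebesgue_power I)"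
      using measurable_add_dim[of j J "\<lambda>_. lborel :: 'v measure"] by (simp add: case_prod_unfold I_def)
    from measurable_compose[OF measurable_compose[OF this measurable_restrict_coordinate] Fm[of i]] i
    show "(\<lambda>z. F i (restrict ((fst z)(j := snd z)) (I - {i}))) \<in> borel_measurable (?X \<Otimes>\<^sub>M lborel)"
      using I by auto
  qed
  have g1: "norm (g u x) \<le> 1" for u x
    unfolding g_def prod_norm[symmetric] by (rule prod_le_1) (use F1 I in auto)
  have fV: "(LINT x|?X. norm (F j x)) \<le> V" and fi: "integrable ?X (F j)" using FV[OF I(2)] Fi[OF I(2)] I by auto
  obtain i0 where i0: "i0 \<in> J" using J by auto
  \<comment> \<open>the trivial estimate uses a function other than \<open>F j\<close>, which is absent from \<open>g\<close>\<close>
  have gI: "integrable (?X \<Otimes>\<^sub>M lborel) (\<lambda>(x, u). g u x * \<eta> s (u + \<sigma> x))" (is ?A)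
    and gV: "(LINT (x, u)|(?X \<Otimes>\<^sub>M lborel). norm (g u x * \<eta> s (u + \<sigma> x))) \<le> B * V" (is ?B)
    if s: "s \<in> {a..b}" for s
  proof -
    let ?h = "\<lambda>x. (\<Prod>j\<in>J. F j (restrict x (I - {j}))) * \<eta> s (y + (\<Sum>j\<in>I. x j))"
    have i0I: "i0 \<in> I" using i0 I by auto
    have h: "integrable (lebesgue_power I) ?h"
      by (rule index_form_integrable(1)[OF I(1) i0I Fm i0 I(3) _ Fi[OF i0I] \<eta>i[OF s]]) (use F1 I in auto)
    have "(LINT x|lebesgue_power I. norm (?h x)) \<le> (LINT x|lebesgue_power (I - {i0}). norm (F i0 x)) * (LINT v|lborel. norm (\<eta> s (y + v)))"
      by (rule index_form_integrable(2)[OF I(1) i0I Fm i0 I(3) _ Fi[OF i0I] \<eta>i[OF s]]) (use F1 I in auto)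
    also have "\<dots> \<le> V * B" using FV[OF i0I] \<eta>B[OF s] V0 by (intro mult_mono) (auto intro!: integral_nonneg_AE)
    finally have hV: "(LINT x|lebesgue_power I. norm (?h x)) \<le> B * V" by (simp add: mult.commute)
    have hm: "?h \<in> borel_measurable (lebesgue_power (insert j J))" 
      "(\<lambda>x. norm (?h x)) \<in> borel_measurable (lebesgue_power (insert j J))" using h by (auto simp: I_def)
    have e: "?h (x(j := u)) = g u x * \<eta> s (u + \<sigma> x)" for x u
      unfolding g_def sumI \<sigma>_def by (simp add: add_ac)
    show ?A using integrable_lebesgue_power_insert(1)[OF J(1,3) hm(1)] h e by (simp add: I_def)
    show ?B using integrable_lebesgue_power_insert(2)[OF J(1,3) hm(2)] hV e by (simp add: I_def)
  qed
  define v where "v = (\<lambda>i u. LINT z|lebesgue_power (J - {i}). norm (F i (z(j := u))))"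
  have v: "AE u in lborel. integrable (lebesgue_power (J - {i})) (\<lambda>z. F i (z(j := u)))"
    "integrable lborel (v i)" "(LINT u|lborel. v i u) \<le> V" if i: "i \<in> J" for i
  proof -
    have "finite (J - {i})" "j \<notin> J - {i}" using J by auto
    note S = AE_slice_integrable[OF this, of "F i", folded IJ[OF i], OF Fi]
    show "AE u in lborel. integrable (lebesgue_power (J - {i})) (\<lambda>z. F i (z(j := u)))" by (rule S) (use I i in auto)
    show "integrable lborel (v i)" unfolding v_def by (rule S) (use I i in auto)
    show "(LINT u|lborel. v i u) \<le> V" unfolding v_def by (subst S(3)) (use I i FV in auto)
  qed
  define w where "w = (\<lambda>u. C * N powr (1 - \<delta>) * (\<Sum>i\<in>J. v i u))"
  have v0: "0 \<le> v i u" for i u unfolding v_def by (auto intro!: integral_nonneg_AE)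
  have lower: "AE u in lborel. \<forall>h. norm (LINT x|?X. g u x * cnj (g (u + h) x) * (\<Sum>s=a..t. \<eta> s (u + \<sigma> x))) \<le> w u"
    if t: "t \<in> {a..b}" for t
  proof -
    have K': "scale_kernels B {a..t} \<eta>" using K t unfolding scale_kernels_def by auto
    have "AE u in lborel. \<forall>i\<in>J. integrable (lebesgue_power (J - {i})) (\<lambda>z. F i (z(j := u)))"
      using v(1) J(1) by (simp add: AE_finite_all)
    thus ?thesis
    proof (eventually_elim, intro allI)
      fix u h assume iu: "\<forall>i\<in>J. integrable (lebesgue_power (J - {i})) (\<lambda>z. F i (z(j := u)))"
      define H where "H = (\<lambda>i z. F i (z(j := u)) * cnj (F i (z(j := u + h))))"
      have Hm: "(\<lambda>z. F i (z(j := u'))) \<in> borel_measurable (lebesgue_power (J - {i}))" if i: "i \<in> J" for i u'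
      proof (rule measurable_compose[OF _ Fm])
        show "(\<lambda>z. z(j := u')) \<in> measurable (lebesgue_power (J - {i})) (lebesgue_power (I - {i}))"
          unfolding IJ[OF i] by (rule measurable_fun_upd[where J="J - {i}"]) auto
      qed (use I i in auto)
      have Hi: "integrable (lebesgue_power (J - {i})) (H i)" if i: "i \<in> J" for i
        unfolding H_def by (rule integrable_bounded_mult[where c=1]) (use iu i Hm I F1 in auto)
      have H1: "norm (H i z) \<le> 1" if "i \<in> J" for i z
        unfolding H_def norm_mult using F1 that I by (auto intro!: mult_le_one)
      have Hv: "(LINT z|lebesgue_power (J - {i}). norm (H i z)) \<le> (\<Sum>i\<in>J. v i u)" if i: "i \<in> J" for i
      proof -
        have "(LINT z|lebesgue_power (J - {i}). norm (H i z)) \<le> v i u"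
          unfolding v_def using Hi[OF i] iu i I F1
          by (intro integral_mono integrable_norm) (auto simp: H_def norm_mult mult_left_le)
        also have "\<dots> \<le> (\<Sum>i\<in>J. v i u)" by (rule member_le_sum) (use i v0 J in auto)
        finally show ?thesis .
      qed
      have "(LINT x|?X. g u x * cnj (g (u + h) x) * (\<Sum>s=a..t. \<eta> s (u + \<sigma> x)))
          = index_form J (\<lambda>v. \<Sum>s=a..t. \<eta> s ((u + y) + v)) H"
        unfolding index_form_def
      proof (rule Bochner_Integration.integral_cong[OF refl])
        fix x :: "nat \<Rightarrow> 'v"
        have "g u' x = (\<Prod>i\<in>J. F i ((restrict x (J - {i}))(j := u')))" for u'
          unfolding g_def I_def using J restrict_upd_insert[of _ J j x u'] by (intro prod.cong) auto
        thus "g u x * cnj (g (u + h) x) * (\<Sum>s=a..t. \<eta> s (u + \<sigma> x))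
          = (\<Prod>i\<in>J. H i (restrict x (J - {i}))) * (\<Sum>s=a..t. \<eta> s ((u + y) + (\<Sum>i\<in>J. x i)))"
          unfolding H_def \<sigma>_def by (simp add: prod.distrib add_ac)
      qed
      also have "norm \<dots> \<le> C * real (card {a..t}) powr (1 - \<delta>) * (\<Sum>i\<in>J. v i u)"
        by (rule bounded_form_estimateD[OF Q K' Hi H1 Hv])
      also have "\<dots> \<le> w u" unfolding w_def N_def
      proof (intro mult_right_mono mult_left_mono powr_mono2)
        show "real (card {a..t}) \<le> real (card {a..b})" using t by (intro of_nat_mono card_mono) auto
      qed (use C \<delta> v0 in \<open>auto intro: sum_nonneg\<close>)
      finally show "norm (LINT x|?X. g u x * cnj (g (u + h) x) * (\<Sum>s=a..t. \<eta> s (u + \<sigma> x))) \<le> w u" .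
    qed
  qed
  have wi: "integrable lborel w" unfolding w_def using v(2) by auto
  have wW: "(LINT u|lborel. w u) \<le> C * N powr (1 - \<delta>) * (real (card J) * V)"
  proof -
    have "(LINT u|lborel. w u) = C * N powr (1 - \<delta>) * (\<Sum>i\<in>J. LINT u|lborel. v i u)"
      unfolding w_def using v(2) by (simp add: Bochner_Integration.integral_sum)
    also have "\<dots> \<le> C * N powr (1 - \<delta>) * (\<Sum>i\<in>J. V)"
      using v(3) C by (intro mult_left_mono sum_mono) auto
    finally show ?thesis by simp
  qed
  have form: "index_form I k F = (LINT x|?X. F j x * (\<Sum>s=a..b. LINT u|lborel. g u x * \<eta> s (u + \<sigma> x)))"
  proof -
    have h: "integrable (lebesgue_power I) (\<lambda>x. (\<Prod>i\<in>I. F i (restrict x (I - {i}))) * k (\<Sum>i\<in>I. x i))"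
      by (rule index_form_integrable(1)[OF I(1,2) Fm I(2) _ _ Fi ki]) (use F1 I in auto)
    have "index_form I k F = (LINT x|?X. LINT u|lborel. (\<Prod>i\<in>I. F i (restrict (x(j := u)) (I - {i}))) * k (\<Sum>i\<in>I. (x(j := u)) i))"
      unfolding index_form_def using lborel_product.product_integral_insert[OF J(1,3), folded I_def, OF h] .
    also have "\<dots> = (LINT x|?X. F j x * (\<Sum>s=a..b. LINT u|lborel. g u x * \<eta> s (u + \<sigma> x)))"
    proof (rule Bochner_Integration.integral_cong[OF refl])
      fix x assume x: "x \<in> space ?X"
      have r: "restrict (x(j := u)) (I - {j}) = x" for u
        using x J I by (auto simp: space_PiM PiE_def extensional_def restrict_def fun_eq_iff)
      have gi: "integrable lborel (\<lambda>u. g u x * \<eta> s (u + \<sigma> x))" if "s \<in> {a..b}" for s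
        by (rule integrable_bounded_mult[where c=1])
           (use g1 x scale_kernelsD(1)[OF K that] measurable_uncurried[OF gm, of "\<lambda>u. u" lborel "\<lambda>_. x"] in \<open>auto simp: integrable_translate_iff\<close>)
      have "(LINT u|lborel. (\<Prod>i\<in>I. F i (restrict (x(j := u)) (I - {i}))) * k (\<Sum>i\<in>I. (x(j := u)) i))
        = (LINT u|lborel. F j x * (\<Sum>s=a..b. g u x * \<eta> s (u + \<sigma> x)))"
      proof (rule Bochner_Integration.integral_cong[OF refl])
        fix u
        have "(\<Prod>i\<in>I. F i (restrict (x(j := u)) (I - {i}))) = F j x * g u x"
          unfolding g_def using J r[of u] by (subst I_def, subst prod.insert) auto
        thus "(\<Prod>i\<in>I. F i (restrict (x(j := u)) (I - {i}))) * k (\<Sum>i\<in>I. (x(j := u)) i) = F j x * (\<Sum>s=a..b. g u x * \<eta> s (u + \<sigma> x))"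
          unfolding sumI k_def \<sigma>_def by (simp add: sum_distrib_left add_ac mult_ac)
      qed
      also have "\<dots> = F j x * (\<Sum>s=a..b. LINT u|lborel. g u x * \<eta> s (u + \<sigma> x))"
        using gi by (simp add: Bochner_Integration.integral_sum)
      finally show "(LINT u|lborel. (\<Prod>i\<in>I. F i (restrict (x(j := u)) (I - {i}))) * k (\<Sum>i\<in>I. (x(j := u)) i))
         = F j x * (\<Sum>s=a..b. LINT u|lborel. g u x * \<eta> s (u + \<sigma> x))" .
    qed
    finally show ?thesis .
  qed
  have "norm (index_form I k F) \<le> sqrt M * N powr (1 - \<delta> / 2) * V"
  proof (cases "a \<le> b")
    case False
    thus ?thesis unfolding form using M1 V0 by simp
  next
    case True
    hence N1: "N \<ge> 1" unfolding N_def by simp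
    \<comment> \<open>balances the two terms of \<open>multiscale_pairing_bound\<close>\<close>
    define l where "l = sqrt M * N powr (1 - \<delta> / 2)"
    have l: "l > 0" unfolding l_def using M1 N1 by simp
    have "norm (index_form I k F) \<le> (l * V + 2 * N * (2 * B^3 * V + B * (C * N powr (1 - \<delta>) * (real (card J) * V))) / l) / 2"
      unfolding form N_def
      by (rule multiscale_pairing_bound[OF sX fi F1[OF I(2)] fV gm g1 \<sigma>m K B gI gV lower wi wW[unfolded N_def] l])
    also have "2 * N * (2 * B^3 * V + B * (C * N powr (1 - \<delta>) * (real (card J) * V))) \<le> l\<^sup>2 * V"
    proof -
      have p: "1 \<le> N powr (1 - \<delta>)" using N1 \<delta> by (simp add: ge_one_powr_ge_zero)
      have "2 * N * (2 * B^3 * V + B * (C * N powr (1 - \<delta>) * (real (card J) * V)))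
        \<le> 2 * N * (2 * B^3 * V * N powr (1 - \<delta>) + B * (C * N powr (1 - \<delta>) * (real (card J) * V)))"
        using N1 B V0 mult_left_mono[OF p, of "2 * B^3 * V"] by (intro mult_left_mono add_right_mono) auto
      also have "\<dots> = (M - 1) * (N * N powr (1 - \<delta>)) * V" unfolding M_def by (simp add: algebra_simps)
      also have "\<dots> \<le> M * (N * N powr (1 - \<delta>)) * V" using N1 V0 by (intro mult_right_mono) auto
      also have "N * N powr (1 - \<delta>) = (N powr (1 - \<delta> / 2))\<^sup>2"
      proof -
        have "(N powr (1 - \<delta> / 2))\<^sup>2 = N powr (1 + (1 - \<delta>))"
          by (simp add: power2_eq_square powr_add[symmetric])
        also have "\<dots> = N powr 1 * N powr (1 - \<delta>)" by (rule powr_add)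
        finally show ?thesis using N1 by simp
      qed
      finally show ?thesis unfolding l_def using M1 by (simp add: power_mult_distrib)
    qed
    finally have "norm (index_form I k F) \<le> (l * V + l\<^sup>2 * V / l) / 2" using l by (simp add: divide_right_mono)
    also have "l\<^sup>2 * V / l = l * V" using l by (simp add: power2_eq_square)
    finally show ?thesis by (simp add: l_def mult_ac)
  qed
  thus "norm (index_form (insert j J) (\<lambda>v. \<Sum>s=a..b. \<eta> s (y + v)) F)
     \<le> sqrt (4 * B^3 + 2 * B * C * real (card J) + 1) * real (card {a..b}) powr (1 - \<delta> / 2) * V"
    by (simp add: I_def k_def M_def N_def)
qed

lemma ex_bounded_form_estimate:
  assumes "finite I" "I \<noteq> {}" "B \<ge> 0"
  shows "\<exists>C \<delta>. 0 \<le> C \<and> 0 < \<delta> \<and> \<delta> \<le> 1 \<and> bounded_form_estimate TYPE('v::euclidean_space) I B C \<delta>"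
  using assms(1,2)
proof (induction I rule: finite_ne_induct)
  case (singleton j)
  show ?case using bounded_form_estimate_singleton by (intro exI[of _ 0] exI[of _ 1]) auto
next
  case (insert j J)
  then obtain C \<delta> where C: "0 \<le> C" "0 < \<delta>" "\<delta> \<le> 1" "bounded_form_estimate TYPE('v::euclidean_space) J B C \<delta>" by blast
  show ?case
    using bounded_form_estimate_insert[OF insert(1,2,3) assms(3) C(4,1,3)] C assms(3)
    by (intro exI[of _ "sqrt (4 * B^3 + 2 * B * C * real (card J) + 1)"] exI[of _ "\<delta> / 2"]) auto
qed

section \<open>General exponents by real interpolation\<close>

lemma norm_suminf_le:
  fixes c :: "nat \<Rightarrow> complex"
  assumes "\<And>n. (\<Sum>m<n. norm (c m)) \<le> M"
  shows "norm (suminf c) \<le> M"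
proof -
  have s: "summable (\<lambda>m. norm (c m))"
    by (rule summableI_nonneg_bounded[where x=M]) (use assms in auto)
  have "norm (suminf c) \<le> (\<Sum>m. norm (c m))" by (rule summable_norm[OF s])
  also have "\<dots> \<le> M" by (rule suminf_le_const[OF s assms])
  finally show ?thesis .
qed

text \<open>
  The source of the gain: if the largest value \<open>M\<close> and some \<open>A j\<close> are far apart, the geometric mean is
  much smaller than \<open>M\<close>. Dividing by \<open>M\<close> makes all factors at most \<open>1\<close>, and all but one are dropped.
\<close>

lemma prod_powr_le_factor:
  fixes A p :: "'i \<Rightarrow> real"
  assumes I: "finite I" "j \<in> I" and p: "\<And>i. i \<in> I \<Longrightarrow> 0 < p i" "(\<Sum>i\<in>I. 1 / p i) = 1"
    and A: "\<And>i. i \<in> I \<Longrightarrow> 0 \<le> A i" "\<And>i. i \<in> I \<Longrightarrow> A i \<le> M" and M: "M > 0"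
  shows "(\<Prod>i\<in>I. A i powr (1 / p i)) \<le> M * (A j / M) powr (1 / p j)"
proof -
  have "(\<Prod>i\<in>I. M powr (1 / p i)) = M"
    using M I p(2) by (simp add: powr_sum[symmetric])
  hence "(\<Prod>i\<in>I. A i powr (1 / p i)) = M * (\<Prod>i\<in>I. (A i / M) powr (1 / p i))"
    using A M by (simp add: powr_divide prod_dividef)
  also have "(\<Prod>i\<in>I. (A i / M) powr (1 / p i)) = (A j / M) powr (1 / p j) * (\<Prod>i\<in>I-{j}. (A i / M) powr (1 / p i))"
    using I by (simp add: prod.remove)
  also have "\<dots> \<le> (A j / M) powr (1 / p j) * 1"
    using A M p(1) by (intro mult_left_mono prod_le_1) (auto intro!: powr_le1 simp: less_imp_le)
  finally show ?thesis using M by simp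
qed

lemma prod_powr_le_sum:
  fixes A p :: "'i \<Rightarrow> real"
  assumes I: "finite I" and p: "\<And>i. i \<in> I \<Longrightarrow> 0 < p i" "(\<Sum>i\<in>I. 1 / p i) = 1"
    and A: "\<And>i. i \<in> I \<Longrightarrow> 0 \<le> A i"
  shows "(\<Prod>i\<in>I. A i powr (1 / p i)) \<le> (\<Sum>i\<in>I. A i)"
proof (cases "\<exists>i\<in>I. A i = 0")
  case True
  hence "(\<Prod>i\<in>I. A i powr (1 / p i)) = 0" using I by (auto simp: prod_zero_iff)
  thus ?thesis using A by (simp add: sum_nonneg)
next
  case False
  have "I \<noteq> {}" using p(2) by auto
  then obtain j where j: "j \<in> I" by auto
  define M where "M = (\<Sum>i\<in>I. A i)"
  have le: "A i \<le> M" if "i \<in> I" for i unfolding M_def using that I A by (intro member_le_sum) auto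
  have M0: "M > 0" using le[OF j] False A[OF j] j by force
  have "(\<Prod>i\<in>I. A i powr (1 / p i)) \<le> M * (A j / M) powr (1 / p j)"
    by (rule prod_powr_le_factor[OF I j p A le M0])
  also have "\<dots> \<le> M * 1" using M0 A[OF j] le[OF j] p(1)[OF j] by (intro mult_left_mono powr_le1) (auto simp: less_imp_le)
  finally show ?thesis by (simp add: M_def)
qed

lemma sum_levels_le:
  fixes z R :: real and T :: "int set"
  assumes R: "R > 1" and T: "finite T" and z: "z \<ge> 0"
  shows "(\<Sum>r\<in>T. if z \<in> {R powr r..<R powr (real_of_int r + 1)} then z else 0) \<le> z"
proof -
  have "(\<Sum>r\<in>T. if z \<in> {R powr r..<R powr (real_of_int r + 1)} then z else 0)
     \<le> (\<Sum>r\<in>T. if r = \<lfloor>log R z\<rfloor> then z else 0)"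
  proof (rule sum_mono)
    fix r :: int
    show "(if z \<in> {R powr r..<R powr (real_of_int r + 1)} then z else 0) \<le> (if r = \<lfloor>log R z\<rfloor> then z else 0)"
    proof (cases "z \<in> {R powr r..<R powr (real_of_int r + 1)}")
      case True
      hence z: "R powr r \<le> z" "z < R powr (real_of_int r + 1)" by auto
      have "0 < R powr r" using R by simp
      hence z0: "0 < z" using z(1) by linarith
      have "real_of_int r \<le> log R z" "log R z < real_of_int r + 1"
        using z by (simp_all only: le_log_iff[OF R z0] log_less_iff[OF R z0])
      hence "\<lfloor>log R z\<rfloor> = r" by (rule floor_unique)
      thus ?thesis using z0 by simp
    next
      case False
      thus ?thesis using z by (simp only: if_False) simp
    qed
  qed
  also have "\<dots> \<le> z" using T z by simp
  finally show ?thesis .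
qed

text \<open>
  On the level where \<open>|F i| powr p i\<close> is about \<open>R powr r\<close>, division by \<open>R powr ((r + d) / p i)\<close> makes
  the functions bounded by \<open>1\<close> with \<open>L\<^sup>1\<close> norm about \<open>R powr (- r)\<close> times the mass of the level. Because
  the reciprocal exponents sum to \<open>1\<close>, undoing the normalisation multiplies the form by
  \<open>R powr (r + d)\<close>, and the dependence on \<open>r\<close> cancels.
\<close>

lemma level_form_estimate:
  fixes \<eta> :: "int \<Rightarrow> 'v::euclidean_space \<Rightarrow> complex" and F :: "nat \<Rightarrow> (nat \<Rightarrow> 'v) \<Rightarrow> complex"
    and r d :: real
  assumes Q: "bounded_form_estimate TYPE('v) I B C \<delta>" and K: "scale_kernels B {a..b} \<eta>" and I: "finite I"
    and p: "\<And>i. i \<in> I \<Longrightarrow> 0 < p i" "(\<Sum>i\<in>I. 1 / p i) = 1" and R: "R > 1"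
    and F[measurable]: "\<And>i. i \<in> I \<Longrightarrow> F i \<in> borel_measurable (lebesgue_power (I - {i}))"
    and Fp: "\<And>i. i \<in> I \<Longrightarrow> integrable (lebesgue_power (I - {i})) (\<lambda>x. norm (F i x) powr p i)"
  defines "L \<equiv> \<lambda>i x. norm (F i x) powr p i \<in> {R powr r..<R powr (r + d)}"
  shows "norm (index_form I (\<lambda>v. \<Sum>s=a..b. \<eta> s v) (\<lambda>i x. if L i x then F i x else 0))
    \<le> R powr d * C * real (card {a..b}) powr (1 - \<delta>) *
       (\<Sum>i\<in>I. LINT x|lebesgue_power (I - {i}). (if L i x then norm (F i x) powr p i else 0))"
proof -
  define \<beta> where "\<beta> = (\<lambda>i. LINT x|lebesgue_power (I - {i}). (if L i x then norm (F i x) powr p i else 0))"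
  define G where "G = (\<lambda>i x. if L i x then F i x else 0)"
  define H where "H = (\<lambda>i x. G i x / of_real (R powr ((r + d) / p i)))"
  have R0: "R powr e > 0" for e using R by simp
  have Lm[measurable]: "Measurable.pred (lebesgue_power (I - {i})) (L i)" if i: "i \<in> I" for i
    unfolding L_def atLeastLessThan_iff using F[OF i] by measurable
  have Gm: "G i \<in> borel_measurable (lebesgue_power (I - {i}))" if i: "i \<in> I" for i
    unfolding G_def using F[OF i] Lm[OF i] by measurable
  have Gb: "norm (F i x) \<le> R powr ((r + d) / p i)" if "L i x" "i \<in> I" for i x
  proof -
    have "norm (F i x) = (norm (F i x) powr p i) powr (1 / p i)"
      using p(1)[OF that(2)] by (simp add: powr_powr)
    also have "\<dots> \<le> (R powr (r + d)) powr (1 / p i)"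
      using that p(1)[OF that(2)] unfolding L_def by (intro powr_mono2) (auto simp: less_imp_le)
    finally show ?thesis by (simp add: powr_powr)
  qed
  have H1: "norm (H i x) \<le> 1" if "i \<in> I" for i x
    using Gb[of i x] that R0[of "(r + d) / p i"] by (auto simp: H_def G_def norm_divide divide_le_eq)
  have \<beta>i: "integrable (lebesgue_power (I - {i})) (\<lambda>x. if L i x then norm (F i x) powr p i else 0)" if i: "i \<in> I" for i
  proof (rule Bochner_Integration.integrable_bound[OF Fp[OF i]])
    show "(\<lambda>x. if L i x then norm (F i x) powr p i else 0) \<in> borel_measurable (lebesgue_power (I - {i}))"
      using F[OF i] Lm[OF i] by measurable
  qed auto
  have Hle: "norm (H i x) \<le> R powr (-r) * (if L i x then norm (F i x) powr p i else 0)" if i: "i \<in> I" for i x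
  proof (cases "L i x")
    case True
    have "norm (H i x) \<le> 1" by (rule H1[OF i])
    also have "\<dots> = R powr (-r) * R powr r" using R by (simp add: powr_add[symmetric])
    also have "\<dots> \<le> R powr (-r) * norm (F i x) powr p i" using True unfolding L_def by (intro mult_left_mono) auto
    finally show ?thesis using True by simp
  qed (simp add: H_def G_def)
  have Hm: "H i \<in> borel_measurable (lebesgue_power (I - {i}))" if i: "i \<in> I" for i
    unfolding H_def using Gm[OF i] by measurable
  have Hi: "integrable (lebesgue_power (I - {i})) (H i)" if i: "i \<in> I" for i
    by (rule Bochner_Integration.integrable_bound[OF integrable_mult_right[OF \<beta>i[OF i], of "R powr (-r)"] Hm[OF i]])
       (use Hle[OF i] in \<open>auto intro!: AE_I2 intro: order_trans[OF _ abs_ge_self]\<close>)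
  have \<beta>0: "0 \<le> \<beta> i" for i unfolding \<beta>_def by (auto intro!: integral_nonneg_AE)
  have HV: "(LINT x|lebesgue_power (I - {i}). norm (H i x)) \<le> R powr (-r) * (\<Sum>i\<in>I. \<beta> i)" if i: "i \<in> I" for i
  proof -
    have "(LINT x|lebesgue_power (I - {i}). norm (H i x)) \<le> R powr (-r) * \<beta> i"
      unfolding \<beta>_def integral_mult_right_zero[symmetric]
      by (intro integral_mono integrable_norm integrable_mult_right Hi \<beta>i Hle i)
    also have "\<dots> \<le> R powr (-r) * (\<Sum>i\<in>I. \<beta> i)"
      using i I \<beta>0 by (intro mult_left_mono member_le_sum) auto
    finally show ?thesis .
  qed
  have "index_form I (\<lambda>v. \<Sum>s=a..b. \<eta> s v) G = (LINT x|lebesgue_power I. of_real (R powr (r + d)) * ((\<Prod>i\<in>I. H i (restrict x (I - {i}))) * (\<Sum>s=a..b. \<eta> s (\<Sum>i\<in>I. x i))))"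
    unfolding index_form_def
  proof (rule Bochner_Integration.integral_cong[OF refl])
    fix x
    have "(\<Sum>i\<in>I. (r + d) / p i) = r + d"
      using p(2) by (simp add: divide_inverse sum_distrib_left[symmetric])
    hence "(\<Prod>i\<in>I. R powr ((r + d) / p i)) = R powr (r + d)"
      using R I by (simp add: powr_sum[symmetric])
    hence e: "(\<Prod>i\<in>I. of_real (R powr ((r + d) / p i)) :: complex) = of_real (R powr (r + d))"
      by (simp only: of_real_prod[symmetric])
    have "(\<Prod>i\<in>I. G i (restrict x (I - {i}))) = (\<Prod>i\<in>I. of_real (R powr ((r + d) / p i)) * H i (restrict x (I - {i})))"
      unfolding H_def using R0 R by (intro prod.cong) (auto simp: less_imp_neq[OF R0, symmetric])
    also have "\<dots> = of_real (R powr (r + d)) * (\<Prod>i\<in>I. H i (restrict x (I - {i})))"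
      by (simp only: prod.distrib e)
    finally show "(\<Prod>i\<in>I. G i (restrict x (I - {i}))) * (\<Sum>s=a..b. \<eta> s (\<Sum>i\<in>I. x i)) = of_real (R powr (r + d)) * ((\<Prod>i\<in>I. H i (restrict x (I - {i}))) * (\<Sum>s=a..b. \<eta> s (\<Sum>i\<in>I. x i)))"
      by simp
  qed
  also have "\<dots> = of_real (R powr (r + d)) * index_form I (\<lambda>v. \<Sum>s=a..b. \<eta> s (0 + v)) H"
    unfolding index_form_def by simp
  also have "norm \<dots> = R powr (r + d) * norm (index_form I (\<lambda>v. \<Sum>s=a..b. \<eta> s (0 + v)) H)"
    using R0[of "r + d"] by (simp add: norm_mult)
  also have "\<dots> \<le> R powr (r + d) * (C * real (card {a..b}) powr (1 - \<delta>) * (R powr (-r) * (\<Sum>i\<in>I. \<beta> i)))"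
    by (intro mult_left_mono bounded_form_estimateD[OF Q K Hi H1 HV]) auto
  also have "\<dots> = (R powr (r + d) * R powr (-r)) * C * real (card {a..b}) powr (1 - \<delta>) * (\<Sum>i\<in>I. \<beta> i)"
    by (simp only: mult_ac)
  also have "R powr (r + d) * R powr (-r) = R powr d" by (simp add: powr_add[symmetric])
  finally show ?thesis unfolding G_def \<beta>_def .
qed

text \<open>
  The trivial estimate. By \<open>prod_powr_le_sum\<close> the product of the \<open>|F i|\<close> is dominated by the sum of the
  \<open>|F i| powr p i\<close>, each of which is integrated by \<open>lebesgue_power_marginal\<close>.
\<close>

lemma index_form_Lp:
  fixes F :: "nat \<Rightarrow> (nat \<Rightarrow> 'v::euclidean_space) \<Rightarrow> complex"
  assumes I: "finite I" and p: "\<And>i. i \<in> I \<Longrightarrow> 0 < p i" "(\<Sum>i\<in>I. 1 / p i) = 1"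
    and F: "\<And>i. i \<in> I \<Longrightarrow> F i \<in> borel_measurable (lebesgue_power (I - {i}))"
    and Fp: "\<And>i. i \<in> I \<Longrightarrow> integrable (lebesgue_power (I - {i})) (\<lambda>x. norm (F i x) powr p i)"
    and F1: "\<And>i. i \<in> I \<Longrightarrow> (LINT x|lebesgue_power (I - {i}). norm (F i x) powr p i) \<le> 1"
    and k: "integrable lborel k"
  shows "integrable (lebesgue_power I) (\<lambda>x. (\<Prod>i\<in>I. F i (restrict x (I - {i}))) * k (\<Sum>i\<in>I. x i))"
    and "norm (\<Prod>i\<in>I. F i (restrict x (I - {i}))) = (\<Prod>i\<in>I. (norm (F i (restrict x (I - {i}))) powr p i) powr (1 / p i))"
    and "integrable (lebesgue_power I) (\<lambda>x. (\<Sum>i\<in>I. norm (F i (restrict x (I - {i}))) powr p i) * norm (k (\<Sum>i\<in>I. x i)))"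
    and "(LINT x|lebesgue_power I. (\<Sum>i\<in>I. norm (F i (restrict x (I - {i}))) powr p i) * norm (k (\<Sum>i\<in>I. x i)))
      \<le> real (card I) * (LINT v|lborel. norm (k v))"
    and "norm (index_form I k F) \<le> real (card I) * (LINT v|lborel. norm (k v))"
proof -
  let ?M = "lebesgue_power I :: (nat \<Rightarrow> 'v) measure"
  define A where "A = (\<lambda>i x. norm (F i (restrict x (I - {i}))) powr p i)"
  define f where "f = (\<lambda>x. (\<Prod>i\<in>I. F i (restrict x (I - {i}))) * k (\<Sum>i\<in>I. x i))"
  have km[measurable]: "k \<in> borel_measurable borel" using k by auto
  have fm: "f \<in> borel_measurable ?M" unfolding f_def
    by (intro borel_measurable_times borel_measurable_prod measurable_compose[OF measurable_restrict_coordinate F]) auto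
  have Ai: "integrable ?M (\<lambda>x. A i x * norm (k (\<Sum>j\<in>I. x j)))"
    and AB: "(LINT x|?M. A i x * norm (k (\<Sum>j\<in>I. x j))) \<le> (LINT v|lborel. norm (k v))" if i: "i \<in> I" for i
  proof -
    define c where "c = (\<lambda>x. complex_of_real (norm (F i x) powr p i))"
    have ci: "integrable (lebesgue_power (I - {i})) c" using Fp[OF i] unfolding c_def by simp
    have nc: "norm (c x) = norm (F i x) powr p i" for x unfolding c_def by simp
    note M = lebesgue_power_marginal[OF I i ci k, unfolded nc]
    show "integrable ?M (\<lambda>x. A i x * norm (k (\<Sum>j\<in>I. x j)))" using M(1) by (simp add: A_def)
    have "(LINT x|?M. A i x * norm (k (\<Sum>j\<in>I. x j))) = (LINT x|lebesgue_power (I - {i}). norm (F i x) powr p i) * (LINT v|lborel. norm (k v))"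
      using M(2) by (simp add: A_def)
    also have "\<dots> \<le> 1 * (LINT v|lborel. norm (k v))" using F1[OF i] by (intro mult_right_mono) (auto intro!: integral_nonneg_AE)
    finally show "(LINT x|?M. A i x * norm (k (\<Sum>j\<in>I. x j))) \<le> (LINT v|lborel. norm (k v))" by simp
  qed
  show nF: "norm (\<Prod>i\<in>I. F i (restrict x (I - {i}))) = (\<Prod>i\<in>I. (norm (F i (restrict x (I - {i}))) powr p i) powr (1 / p i))" for x
    unfolding prod_norm[symmetric] by (intro prod.cong refl) (use p(1) in \<open>force simp: powr_powr\<close>)
  have le: "norm (f x) \<le> (\<Sum>i\<in>I. A i x) * norm (k (\<Sum>j\<in>I. x j))" for x
    unfolding f_def norm_mult nF A_def by (intro mult_right_mono prod_powr_le_sum I p) auto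
  show S: "integrable ?M (\<lambda>x. (\<Sum>i\<in>I. norm (F i (restrict x (I - {i}))) powr p i) * norm (k (\<Sum>i\<in>I. x i)))"
    unfolding sum_distrib_right using Ai by (auto simp: A_def)
  have "(LINT x|?M. (\<Sum>i\<in>I. A i x) * norm (k (\<Sum>j\<in>I. x j))) = (\<Sum>i\<in>I. LINT x|?M. A i x * norm (k (\<Sum>j\<in>I. x j)))"
    unfolding sum_distrib_right using Ai by (intro Bochner_Integration.integral_sum)
  also have "\<dots> \<le> (\<Sum>i\<in>I. LINT v|lborel. norm (k v))" by (intro sum_mono AB)
  finally show SB: "(LINT x|?M. (\<Sum>i\<in>I. norm (F i (restrict x (I - {i}))) powr p i) * norm (k (\<Sum>i\<in>I. x i)))
      \<le> real (card I) * (LINT v|lborel. norm (k v))" by (simp add: A_def)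
  have fi: "integrable ?M f"
    by (rule Bochner_Integration.integrable_bound[OF S fm])
       (use le in \<open>auto simp: A_def intro!: AE_I2 intro: order_trans[OF _ abs_ge_self]\<close>)
  thus "integrable ?M (\<lambda>x. (\<Prod>i\<in>I. F i (restrict x (I - {i}))) * k (\<Sum>i\<in>I. x i))" unfolding f_def .
  have "norm (index_form I k F) \<le> (LINT x|?M. norm (f x))"
    unfolding index_form_def f_def by (rule integral_norm_bound)
  also have "\<dots> \<le> (LINT x|?M. (\<Sum>i\<in>I. norm (F i (restrict x (I - {i}))) powr p i) * norm (k (\<Sum>i\<in>I. x i)))"
    using le unfolding A_def by (intro integral_mono integrable_norm fi S)
  finally show "norm (index_form I k F) \<le> real (card I) * (LINT v|lborel. norm (k v))" using SB by linarith
qed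

text \<open>
  The parameter \<open>R\<close> is free. The region where the levels of all functions differ by at most one is
  the disjoint union of the sets \<open>U r\<close>, on which the lowest level is \<open>r\<close>. The indicator of \<open>U r\<close> is
  not a product of functions that each omit a variable, but it is the difference of two such products:
  all levels in \<open>{r, r + 1}\<close>, minus all levels equal to \<open>r + 1\<close>.
\<close>

lemma index_form_interpolation:
  fixes \<eta> :: "int \<Rightarrow> 'v::euclidean_space \<Rightarrow> complex" and F :: "nat \<Rightarrow> (nat \<Rightarrow> 'v) \<Rightarrow> complex"
  assumes Q: "bounded_form_estimate TYPE('v) I B C \<delta>" and C: "C \<ge> 0" and K: "scale_kernels B {a..b} \<eta>" and I: "finite I"
    and p: "\<And>i. i \<in> I \<Longrightarrow> 0 < p i" "(\<Sum>i\<in>I. 1 / p i) = 1" and R: "R > 1"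
    and F: "\<And>i. i \<in> I \<Longrightarrow> F i \<in> borel_measurable (lebesgue_power (I - {i}))"
    and Fp: "\<And>i. i \<in> I \<Longrightarrow> integrable (lebesgue_power (I - {i})) (\<lambda>x. norm (F i x) powr p i)"
    and F1: "\<And>i. i \<in> I \<Longrightarrow> (LINT x|lebesgue_power (I - {i}). norm (F i x) powr p i) \<le> 1"
    and \<epsilon>: "0 < \<epsilon>" "\<And>i. i \<in> I \<Longrightarrow> \<epsilon> \<le> 1 / p i"
  shows "norm (index_form I (\<lambda>v. \<Sum>s=a..b. \<eta> s v) F)
    \<le> 3 * R powr 2 * C * real (card {a..b}) powr (1 - \<delta>) * real (card I)
       + R powr (- \<epsilon>) * (B * real (card {a..b})) * real (card I)"
proof -
  define N where "N = real (card {a..b})"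
  define k where "k = (\<lambda>v. \<Sum>s=a..b. \<eta> s v)"
  let ?M = "lebesgue_power I :: (nat \<Rightarrow> 'v) measure"
  define A where "A = (\<lambda>i x. norm (F i (restrict x (I - {i}))) powr p i)"
  define f where "f = (\<lambda>x. (\<Prod>i\<in>I. F i (restrict x (I - {i}))) * k (\<Sum>i\<in>I. x i))"
  define lev where "lev = (\<lambda>r d i x. A i x \<in> {R powr r..<R powr (r + d)})"
  have R0: "R powr e > 0" for e using R by simp
  have ki: "integrable lborel k" unfolding k_def using scale_kernelsD(1)[OF K] by auto
  have km[measurable]: "k \<in> borel_measurable borel" using ki by auto
  have kB: "(LINT v|lborel. norm (k v)) \<le> B * N"
  proof -
    have "(LINT v|lborel. norm (k v)) \<le> (LINT v|lborel. (\<Sum>s=a..b. norm (\<eta> s v)))"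
      unfolding k_def using scale_kernelsD(1)[OF K]
      by (intro integral_mono integrable_norm norm_sum) auto
    also have "\<dots> = (\<Sum>s=a..b. LINT v|lborel. norm (\<eta> s v))"
      using scale_kernelsD(1)[OF K] by (intro Bochner_Integration.integral_sum) auto
    also have "\<dots> \<le> (\<Sum>s=a..b. B)" by (intro sum_mono scale_kernelsD(2)[OF K])
    finally show ?thesis by (simp add: N_def mult.commute)
  qed
  have Fr: "(\<lambda>x. F i (restrict x (I - {i}))) \<in> borel_measurable ?M" if "i \<in> I" for i
    by (rule measurable_compose[OF measurable_restrict_coordinate F[OF that]])
  have Am: "A i \<in> borel_measurable ?M" if "i \<in> I" for i
    unfolding A_def using Fr[OF that] by measurable
  have A0: "0 \<le> A i x" for i x unfolding A_def by simp
  have nF: "norm (\<Prod>i\<in>I. F i (restrict x (I - {i}))) = (\<Prod>i\<in>I. A i x powr (1 / p i))" for x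
    unfolding A_def by (rule index_form_Lp(2)[OF I p F Fp F1 ki])
  have nf: "norm (f x) = (\<Prod>i\<in>I. A i x powr (1 / p i)) * norm (k (\<Sum>i\<in>I. x i))" for x
    unfolding f_def norm_mult nF ..
  have Si: "integrable ?M (\<lambda>x. (\<Sum>i\<in>I. A i x) * norm (k (\<Sum>j\<in>I. x j)))"
    unfolding A_def by (rule index_form_Lp(3)[OF I p F Fp F1 ki])
  have "(LINT x|?M. (\<Sum>i\<in>I. A i x) * norm (k (\<Sum>j\<in>I. x j))) \<le> real (card I) * (LINT v|lborel. norm (k v))"
    unfolding A_def by (rule index_form_Lp(4)[OF I p F Fp F1 ki])
  also have "\<dots> \<le> real (card I) * (B * N)" by (intro mult_left_mono kB) simp
  finally have SB: "(LINT x|?M. (\<Sum>i\<in>I. A i x) * norm (k (\<Sum>j\<in>I. x j))) \<le> B * N * real (card I)"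
    by (simp add: mult_ac)
  have fi: "integrable ?M f"
    unfolding f_def by (rule index_form_Lp(1)[OF I p F Fp F1 ki])
  have levm: "Measurable.pred ?M (\<lambda>x. lev r d i x)" if "i \<in> I" for r d i
    unfolding lev_def atLeastLessThan_iff using Am[OF that] by measurable
  define U where "U = (\<lambda>r::int. {x \<in> space ?M. (\<forall>i\<in>I. lev (real_of_int r) 2 i x) \<and> \<not> (\<forall>i\<in>I. lev (real_of_int r + 1) 1 i x)})"
  have "I \<noteq> {}" using p(2) by auto
  have Um: "U r \<in> sets ?M" for r
  proof -
    have all: "{x \<in> space ?M. \<forall>i\<in>I. lev e d i x} \<in> sets ?M" for e d
      by (intro sets.sets_Collect_finite_All' I \<open>I \<noteq> {}\<close> predE levm)
    have "U r = {x \<in> space ?M. \<forall>i\<in>I. lev (real_of_int r) 2 i x} - {x \<in> space ?M. \<forall>i\<in>I. lev (real_of_int r + 1) 1 i x}"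
      unfolding U_def by blast
    thus ?thesis using all by simp
  qed
  have Ud: "U r \<inter> U r' = {}" if "r < r'" for r r'
  proof -
    have *: "lev (real_of_int r + 1) 1 i x" if "lev (real_of_int r) 2 i x" "lev (real_of_int r') 2 i x" for i x
    proof -
      have "R powr (real_of_int r + 1) \<le> R powr (real_of_int r')" using \<open>r < r'\<close> R by (intro powr_mono) linarith+
      thus ?thesis using that unfolding lev_def by (auto simp: add.assoc)
    qed
    show ?thesis
    proof (rule ccontr)
      assume "U r \<inter> U r' \<noteq> {}"
      then obtain x where x: "x \<in> U r" "x \<in> U r'" by blast
      hence "\<forall>i\<in>I. lev (real_of_int r + 1) 1 i x" using * unfolding U_def by simp
      thus False using x(1) unfolding U_def by simp
    qed
  qed
  define \<beta> where "\<beta> = (\<lambda>i r d. LINT x|lebesgue_power (I - {i}). (if norm (F i x) powr p i \<in> {R powr r..<R powr (r + d)} then norm (F i x) powr p i else 0))"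
  define G where "G = (\<lambda>r d i x. if norm (F i x) powr p i \<in> {R powr r..<R powr (r + d)} then F i x else 0)"
  have Gest: "norm (index_form I k (G r d)) \<le> R powr d * C * N powr (1 - \<delta>) * (\<Sum>i\<in>I. \<beta> i r d)" for r d
    unfolding G_def \<beta>_def k_def N_def by (rule level_form_estimate[OF Q K I p R F Fp])
  have Gprod: "(\<Prod>i\<in>I. G r d i (restrict x (I - {i}))) = (if \<forall>i\<in>I. lev r d i x then \<Prod>i\<in>I. F i (restrict x (I - {i})) else 0)" for r d x
    using I by (auto simp: G_def lev_def A_def prod_zero_iff)
  have Gi: "integrable ?M (\<lambda>x. (\<Prod>i\<in>I. G r d i (restrict x (I - {i}))) * k (\<Sum>i\<in>I. x i))" for r d
  proof (rule Bochner_Integration.integrable_bound[OF fi])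
    have "(\<lambda>x. G r d i (restrict x (I - {i}))) \<in> borel_measurable ?M" if "i \<in> I" for i
      using Fr[OF that] levm[OF that, of r d] unfolding G_def lev_def A_def by measurable
    thus "(\<lambda>x. (\<Prod>i\<in>I. G r d i (restrict x (I - {i}))) * k (\<Sum>i\<in>I. x i)) \<in> borel_measurable ?M"
      by (intro borel_measurable_times borel_measurable_prod) auto
  qed (auto simp: Gprod f_def)
  have Udiff: "(LINT x:U r|?M. f x) = index_form I k (G (real_of_int r) 2) - index_form I k (G (real_of_int r + 1) 1)" for r :: int
  proof -
    have "(LINT x:U r|?M. f x) = (LINT x|?M. (\<Prod>i\<in>I. G (real_of_int r) 2 i (restrict x (I - {i}))) * k (\<Sum>i\<in>I. x i)
        - (\<Prod>i\<in>I. G (real_of_int r + 1) 1 i (restrict x (I - {i}))) * k (\<Sum>i\<in>I. x i))"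
      unfolding set_lebesgue_integral_def
    proof (rule Bochner_Integration.integral_cong[OF refl])
      fix x assume x: "x \<in> space ?M"
      have sub: "lev (real_of_int r) 2 i x" if "lev (real_of_int r + 1) 1 i x" for i
      proof -
        have "R powr real_of_int r \<le> R powr (real_of_int r + 1)" using R by (intro powr_mono) auto
        thus ?thesis using that unfolding lev_def by (auto simp: add.assoc)
      qed
      show "indicator (U r) x *\<^sub>R f x = (\<Prod>i\<in>I. G (real_of_int r) 2 i (restrict x (I - {i}))) * k (\<Sum>i\<in>I. x i)
        - (\<Prod>i\<in>I. G (real_of_int r + 1) 1 i (restrict x (I - {i}))) * k (\<Sum>i\<in>I. x i)"
      proof (cases "\<forall>i\<in>I. lev (real_of_int r + 1) 1 i x")
        case True
        hence "x \<notin> U r" "\<forall>i\<in>I. lev (real_of_int r) 2 i x" using sub unfolding U_def by simp_all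
        thus ?thesis unfolding Gprod using True by simp
      next
        case False
        hence "x \<in> U r \<longleftrightarrow> (\<forall>i\<in>I. lev (real_of_int r) 2 i x)" using x unfolding U_def by simp
        thus ?thesis unfolding Gprod if_not_P[OF False]
          by (cases "\<forall>i\<in>I. lev (real_of_int r) 2 i x") (simp_all only: if_P if_not_P f_def, simp_all)
      qed
    qed
    thus ?thesis unfolding index_form_def using Gi by simp
  qed
  define E where "E = (\<lambda>r::int. (\<Sum>i\<in>I. \<beta> i r 1))"
  have \<beta>i: "integrable (lebesgue_power (I - {i})) (\<lambda>x. if norm (F i x) powr p i \<in> {R powr r..<R powr (r + d)} then norm (F i x) powr p i else 0)" if i: "i \<in> I" for i r d
  proof (rule Bochner_Integration.integrable_bound[OF Fp[OF i]])
    show "(\<lambda>x. if norm (F i x) powr p i \<in> {R powr r..<R powr (r + d)} then norm (F i x) powr p i else 0) \<in> borel_measurable (lebesgue_power (I - {i}))"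
      unfolding atLeastLessThan_iff using F[OF i] by measurable
  qed auto
  have \<beta>2: "\<beta> i r 2 = \<beta> i r 1 + \<beta> i (r + 1) 1" if i: "i \<in> I" for i r
  proof -
    have "R powr r < R powr (r + 1)" "R powr (r + 1) < R powr (r + 2)" using R by (auto intro!: powr_less_mono)
    hence e: "(if norm (F i x) powr p i \<in> {R powr r..<R powr (r + 2)} then norm (F i x) powr p i else 0)
      = (if norm (F i x) powr p i \<in> {R powr r..<R powr (r + 1)} then norm (F i x) powr p i else 0)
      + (if norm (F i x) powr p i \<in> {R powr (r + 1)..<R powr (r + 1 + 1)} then norm (F i x) powr p i else 0)" for x
      by (auto simp: add.assoc)
    show ?thesis unfolding \<beta>_def e by (rule Bochner_Integration.integral_add[OF \<beta>i[OF i] \<beta>i[OF i]])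
  qed
  have E0: "0 \<le> E r" for r unfolding E_def \<beta>_def by (intro sum_nonneg integral_nonneg_AE) auto
  have Ub: "norm (LINT x:U r|?M. f x) \<le> R powr 2 * C * N powr (1 - \<delta>) * (E r + 2 * E (r + 1))" for r
  proof -
    have "norm (LINT x:U r|?M. f x) \<le> norm (index_form I k (G (real_of_int r) 2)) + norm (index_form I k (G (real_of_int r + 1) 1))"
      unfolding Udiff by (rule norm_triangle_ineq4)
    also have "\<dots> \<le> R powr 2 * C * N powr (1 - \<delta>) * (\<Sum>i\<in>I. \<beta> i r 2) + R powr 1 * C * N powr (1 - \<delta>) * (\<Sum>i\<in>I. \<beta> i (real_of_int r + 1) 1)"
      by (intro add_mono Gest)
    also have "R powr 1 * C * N powr (1 - \<delta>) * (\<Sum>i\<in>I. \<beta> i (real_of_int r + 1) 1) \<le> R powr 2 * C * N powr (1 - \<delta>) * (\<Sum>i\<in>I. \<beta> i (real_of_int r + 1) 1)"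
    proof (intro mult_right_mono)
      show "R powr 1 \<le> R powr 2" using R by (intro powr_mono) auto
      show "0 \<le> (\<Sum>i\<in>I. \<beta> i (real_of_int r + 1) 1)" using E0[of "r + 1"] by (simp add: E_def)
    qed (use C in auto)
    also have "(\<Sum>i\<in>I. \<beta> i r 2) = E r + E (r + 1)" unfolding E_def by (simp add: \<beta>2 sum.distrib)
    also have "(\<Sum>i\<in>I. \<beta> i (real_of_int r + 1) 1) = E (r + 1)" unfolding E_def by simp
    finally show ?thesis by (simp add: algebra_simps)
  qed
  have Esum: "(\<Sum>r\<in>T. E r) \<le> real (card I)" if T: "finite T" for T :: "int set"
  proof -
    have "(\<Sum>r\<in>T. \<beta> i r 1) \<le> 1" if i: "i \<in> I" for i
    proof -
      have "(\<Sum>r\<in>T. \<beta> i r 1) = (LINT x|lebesgue_power (I - {i}). (\<Sum>r\<in>T. if norm (F i x) powr p i \<in> {R powr r..<R powr (real_of_int r + 1)} then norm (F i x) powr p i else 0))"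
        unfolding \<beta>_def using \<beta>i[OF i] by (intro Bochner_Integration.integral_sum[symmetric])
      also have "\<dots> \<le> (LINT x|lebesgue_power (I - {i}). norm (F i x) powr p i)"
      proof (intro integral_mono Fp[OF i] Bochner_Integration.integrable_sum \<beta>i[OF i])
        fix x
        show "(\<Sum>r\<in>T. if norm (F i x) powr p i \<in> {R powr r..<R powr (real_of_int r + 1)} then norm (F i x) powr p i else 0) \<le> norm (F i x) powr p i"
          by (rule sum_levels_le[OF R T]) simp
      qed
      also have "\<dots> \<le> 1" by (rule F1[OF i])
      finally show ?thesis .
    qed
    hence "(\<Sum>i\<in>I. \<Sum>r\<in>T. \<beta> i r 1) \<le> (\<Sum>i\<in>I. 1)" by (intro sum_mono)
    thus ?thesis unfolding E_def by (subst sum.swap) simp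
  qed
  \<comment> \<open>the levels are integers, and countable additivity is stated for sequences\<close>
  define W where "W = (\<Union>m. U (int_decode m))"
  have Wm: "W \<in> sets ?M" unfolding W_def using Um by auto
  have Wi: "set_integrable ?M W f" unfolding set_integrable_def
    using integrable_mult_indicator[OF Wm fi] .
  have "(LINT x:W|?M. f x) = (\<Sum>m. (LINT x:U (int_decode m)|?M. f x))"
    unfolding W_def
  proof (rule lebesgue_integral_countable_add[OF Um])
    show "U (int_decode i) \<inter> U (int_decode j) = {}" if "i \<noteq> j" for i j
    proof -
      have "int_decode i \<noteq> int_decode j" using that inj_int_decode[of UNIV] by (auto dest: injD)
      then consider "int_decode i < int_decode j" | "int_decode j < int_decode i" by linarith
      thus ?thesis by cases (use Ud Int_commute in auto)
    qed
  qed (use Wi in \<open>simp add: W_def\<close>)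
  also have "norm \<dots> \<le> 3 * R powr 2 * C * N powr (1 - \<delta>) * real (card I)"
  proof (rule norm_suminf_le)
    fix n
    have ie: "inj_on int_decode {..<n}" by (rule inj_int_decode)
    have "(\<Sum>m<n. norm (LINT x:U (int_decode m)|?M. f x)) \<le> (\<Sum>m<n. R powr 2 * C * N powr (1 - \<delta>) * (E (int_decode m) + 2 * E (int_decode m + 1)))"
      by (intro sum_mono Ub)
    also have "\<dots> = R powr 2 * C * N powr (1 - \<delta>) * ((\<Sum>m<n. E (int_decode m)) + 2 * (\<Sum>m<n. E (int_decode m + 1)))"
      by (simp add: sum_distrib_left[symmetric] sum.distrib)
    also have "(\<Sum>m<n. E (int_decode m)) = (\<Sum>r\<in>int_decode ` {..<n}. E r)"
      using ie by (simp add: sum.reindex)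
    also have "(\<Sum>m<n. E (int_decode m + 1)) = (\<Sum>r\<in>(\<lambda>m. int_decode m + 1) ` {..<n}. E r)"
      by (subst sum.reindex) (use ie in \<open>simp_all add: inj_on_def\<close>)
    also have "R powr 2 * C * N powr (1 - \<delta>) * ((\<Sum>r\<in>int_decode ` {..<n}. E r) + 2 * (\<Sum>r\<in>(\<lambda>m. int_decode m + 1) ` {..<n}. E r))
      \<le> R powr 2 * C * N powr (1 - \<delta>) * (real (card I) + 2 * real (card I))"
      using C by (intro mult_left_mono add_mono Esum) auto
    finally show "(\<Sum>m<n. norm (LINT x:U (int_decode m)|?M. f x)) \<le> 3 * R powr 2 * C * N powr (1 - \<delta>) * real (card I)"
      by (simp add: mult_ac)
  qed
  finally have near: "norm (LINT x:W|?M. f x) \<le> 3 * R powr 2 * C * N powr (1 - \<delta>) * real (card I)" .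
  \<comment> \<open>outside \<open>W\<close> some value exceeds the smallest one by a factor of at least \<open>R\<close>, unless one vanishes\<close>
  have farp: "norm (f x) \<le> R powr (- \<epsilon>) * ((\<Sum>i\<in>I. A i x) * norm (k (\<Sum>j\<in>I. x j)))" if x: "x \<in> space ?M" "x \<notin> W" for x
  proof (cases "\<forall>i\<in>I. A i x > 0")
    case False
    then obtain i where "i \<in> I" "A i x = 0" using A0 by (metis order_le_less)
    hence "(\<Prod>i\<in>I. A i x powr (1 / p i)) = 0" using I by (auto simp: prod_zero_iff)
    thus ?thesis unfolding nf using A0 by (simp add: sum_nonneg)
  next
    case True
    have "I \<noteq> {}" using p(2) by auto
    obtain j where j: "j \<in> I" "\<And>i. i \<in> I \<Longrightarrow> A j x \<le> A i x"
      using arg_min_least[OF I \<open>I \<noteq> {}\<close>, of _ "\<lambda>i. A i x"] arg_min_if_finite(1)[OF I \<open>I \<noteq> {}\<close>, of "\<lambda>i. A i x"] by blast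
    define r where "r = \<lfloor>log R (A j x)\<rfloor>"
    have Aj: "A j x > 0" using True j by auto
    have "real_of_int r \<le> log R (A j x)" "log R (A j x) < real_of_int r + 1" unfolding r_def by linarith+
    hence rj: "R powr r \<le> A j x" "A j x < R powr (real_of_int r + 1)"
      by (simp_all only: le_log_iff[OF R Aj] log_less_iff[OF R Aj])
    have "\<not> lev (real_of_int r + 1) 1 j x" using rj unfolding lev_def by auto
    moreover have "x \<notin> U r"
    proof
      assume "x \<in> U r"
      hence "x \<in> U (int_decode (int_encode r))" by simp
      thus False using x(2) unfolding W_def by blast
    qed
    ultimately obtain i where i: "i \<in> I" "\<not> lev r 2 i x" using x(1) j(1) unfolding U_def by auto
    have "A i x \<ge> R powr (real_of_int r + 2)" using i j(2)[OF i(1)] rj unfolding lev_def by auto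
    also have "R powr (real_of_int r + 2) = R * R powr (real_of_int r + 1)"
      using R powr_add[of R "real_of_int r + 1" 1] by (simp add: add.assoc mult.commute)
    finally have far: "R * A j x \<le> A i x" using mult_left_mono[OF less_imp_le[OF rj(2)], of R] R by linarith
    define m where "m = (\<Sum>i\<in>I. A i x)"
    have mle: "A i x \<le> m" if "i \<in> I" for i unfolding m_def using that A0 I by (intro member_le_sum) auto
    have m0: "m > 0" using mle[OF j(1)] Aj by linarith
    have q: "A j x / m \<le> 1 / R"
      using far mle[OF i(1)] m0 R by (simp add: field_simps)
    have q1: "1 / R \<le> 1" using R by simp
    have "(\<Prod>i\<in>I. A i x powr (1 / p i)) \<le> m * (A j x / m) powr (1 / p j)"
      by (rule prod_powr_le_factor[OF I j(1) p A0 mle m0])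
    also have "(A j x / m) powr (1 / p j) \<le> (1 / R) powr (1 / p j)"
      using q Aj m0 p(1)[OF j(1)] by (intro powr_mono2) auto
    also have "(1 / R) powr (1 / p j) \<le> (1 / R) powr \<epsilon>"
      using \<epsilon>(2)[OF j(1)] R q1 by (intro powr_mono') auto
    also have "(1 / R) powr \<epsilon> = R powr (- \<epsilon>)" using R by (simp add: powr_divide powr_minus_divide)
    finally have "(\<Prod>i\<in>I. A i x powr (1 / p i)) \<le> m * R powr (- \<epsilon>)" using m0 by simp
    from mult_right_mono[OF this, of "norm (k (\<Sum>j\<in>I. x j))"] show ?thesis unfolding nf m_def by (simp add: mult_ac)
  qed
  have Ci: "integrable ?M (\<lambda>x. indicator (- W) x *\<^sub>R f x)"
  proof -
    have "integrable ?M (\<lambda>x. f x - indicator W x *\<^sub>R f x)"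
      using fi Wi unfolding set_integrable_def by auto
    also have "(\<lambda>x. f x - indicator W x *\<^sub>R f x) = (\<lambda>x. indicator (- W) x *\<^sub>R f x)"
      by (auto simp: fun_eq_iff indicator_def)
    finally show ?thesis .
  qed
  have "norm (LINT x|?M. indicator (- W) x *\<^sub>R f x) \<le> (LINT x|?M. norm (indicator (- W) x *\<^sub>R f x))"
    by (rule integral_norm_bound)
  also have "\<dots> \<le> (LINT x|?M. R powr (- \<epsilon>) * ((\<Sum>i\<in>I. A i x) * norm (k (\<Sum>j\<in>I. x j))))"
  proof (intro integral_mono integrable_norm Ci integrable_mult_right Si)
    fix x assume "x \<in> space ?M"
    thus "norm (indicator (- W) x *\<^sub>R f x) \<le> R powr (- \<epsilon>) * ((\<Sum>i\<in>I. A i x) * norm (k (\<Sum>j\<in>I. x j)))"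
      using farp[of x] A0 by (cases "x \<in> W") (auto simp: sum_nonneg)
  qed
  also have "\<dots> \<le> R powr (- \<epsilon>) * (B * N * real (card I))"
    unfolding integral_mult_right_zero by (intro mult_left_mono SB) auto
  finally have far: "norm (LINT x|?M. indicator (- W) x *\<^sub>R f x) \<le> R powr (- \<epsilon>) * (B * N * real (card I))" .
  have "index_form I k F = (LINT x|?M. indicator W x *\<^sub>R f x + indicator (- W) x *\<^sub>R f x)"
    unfolding index_form_def by (intro Bochner_Integration.integral_cong refl) (auto simp: f_def indicator_def)
  also have "\<dots> = (LINT x:W|?M. f x) + (LINT x|?M. indicator (- W) x *\<^sub>R f x)"
    unfolding set_lebesgue_integral_def using Wi Ci unfolding set_integrable_def by (rule Bochner_Integration.integral_add)
  also have "norm \<dots> \<le> 3 * R powr 2 * C * N powr (1 - \<delta>) * real (card I) + R powr (- \<epsilon>) * (B * N * real (card I))"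
    using near far by (intro order_trans[OF norm_triangle_ineq] add_mono)
  finally show ?thesis unfolding k_def N_def by (simp add: mult_ac)
qed

definition Lp_unit_family ::
    "nat set \<Rightarrow> (nat \<Rightarrow> real) \<Rightarrow> (nat \<Rightarrow> (nat \<Rightarrow> 'v::euclidean_space) \<Rightarrow> complex) \<Rightarrow> bool" where
  "Lp_unit_family I p F \<longleftrightarrow> (\<forall>i\<in>I. F i \<in> borel_measurable (lebesgue_power (I - {i})) \<and>
     integrable (lebesgue_power (I - {i})) (\<lambda>x. norm (F i x) powr p i) \<and>
     (LINT x|lebesgue_power (I - {i}). norm (F i x) powr p i) \<le> 1)"

text \<open>
  With \<open>R\<close> of size \<open>N powr (\<delta> / 4)\<close> the near part loses \<open>N powr (\<delta> / 2)\<close> of the gain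
  \<open>N powr \<delta>\<close>, while the far part gains \<open>N powr (\<epsilon> \<delta> / 4)\<close> over the trivial bound. The factor \<open>2\<close> in
  \<open>R\<close> keeps \<open>R > 1\<close> when \<open>N = 1\<close>.
\<close>

lemma ex_power_estimate:
  assumes I: "finite I" and B: "B \<ge> 0"
    and p0: "\<forall>i\<in>I. 0 < p i" and p1: "(\<Sum>i\<in>I. 1 / p i) = 1"
  shows "\<exists>C \<delta>. 0 \<le> C \<and> 0 < \<delta> \<and> \<delta> \<le> 1 \<and>
    (\<forall>a b. \<forall>\<eta> :: int \<Rightarrow> 'v::euclidean_space \<Rightarrow> complex. \<forall>F. scale_kernels B {a..b} \<eta> \<longrightarrow>
       Lp_unit_family I p F \<longrightarrow>
       norm (index_form I (\<lambda>v. \<Sum>s=a..b. \<eta> s v) F) \<le> C * real (card {a..b}) powr (1 - \<delta>))"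
proof -
  note p = p0[rule_format] p1
  have ne: "I \<noteq> {}" using p(2) by auto
  obtain C \<delta> where C: "0 \<le> C" "0 < \<delta>" "\<delta> \<le> 1" "bounded_form_estimate TYPE('v) I B C \<delta>"
    using ex_bounded_form_estimate[OF I ne B] by blast
  define \<epsilon> where "\<epsilon> = Min ((\<lambda>i. 1 / p i) ` I)"
  have \<epsilon>1: "\<epsilon> \<le> 1 / p i" if "i \<in> I" for i unfolding \<epsilon>_def using I that by simp
  have \<epsilon>0: "0 < \<epsilon>" unfolding \<epsilon>_def using I ne p(1) by (subst Min_gr_iff) auto
  obtain j where j: "j \<in> I" using ne by auto
  have "1 / p j \<le> (\<Sum>i\<in>I. 1 / p i)" using I j p(1) by (intro member_le_sum) (auto simp: less_imp_le)
  hence \<epsilon>2: "\<epsilon> \<le> 1" using \<epsilon>1[OF j] p(2) by simp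
  define c where "c = real (card I)"
  define \<delta>' where "\<delta>' = \<epsilon> * \<delta> / 4"
  have \<delta>': "0 < \<delta>'" "\<delta>' \<le> 1" "\<delta>' \<le> \<delta> / 2"
    using \<epsilon>0 C \<epsilon>2 mult_mono[of \<epsilon> 1 \<delta> 1] mult_right_mono[of \<epsilon> 1 \<delta>] by (auto simp: \<delta>'_def)
  show ?thesis
  proof (rule exI[of _ "c * (12 * C + B)"], rule exI[of _ \<delta>'], intro conjI allI impI)
    show "0 \<le> c * (12 * C + B)" using C B by (simp add: c_def)
    fix a b :: int and \<eta> :: "int \<Rightarrow> 'v \<Rightarrow> complex" and F :: "nat \<Rightarrow> (nat \<Rightarrow> 'v) \<Rightarrow> complex"
    assume K: "scale_kernels B {a..b} \<eta>" and F: "Lp_unit_family I p F"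
    define N where "N = real (card {a..b})"
    show "norm (index_form I (\<lambda>v. \<Sum>s=a..b. \<eta> s v) F) \<le> c * (12 * C + B) * real (card {a..b}) powr (1 - \<delta>')"
    proof (cases "a \<le> b")
      case False
      thus ?thesis by (simp add: index_form_def)
    next
      case True
      hence N1: "N \<ge> 1" unfolding N_def by simp
      define R where "R = 2 * N powr (\<delta> / 4)"
      have "1 \<le> N powr (\<delta> / 4)" using N1 C by (simp add: ge_one_powr_ge_zero)
      hence R: "R > 1" unfolding R_def by simp
      have R2: "R powr 2 * N powr (1 - \<delta>) \<le> 4 * N powr (1 - \<delta>')"
      proof -
        have "R powr 2 = 4 * N powr (\<delta> / 2)" unfolding R_def by (simp add: powr_mult powr_powr)
        hence "R powr 2 * N powr (1 - \<delta>) = 4 * N powr (1 - \<delta> / 2)" by (simp add: powr_add[symmetric])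
        also have "\<dots> \<le> 4 * N powr (1 - \<delta>')" using \<delta>' N1 by (intro mult_left_mono powr_mono) auto
        finally show ?thesis .
      qed
      have Re: "R powr (- \<epsilon>) * N \<le> N powr (1 - \<delta>')"
      proof -
        have "R powr (- \<epsilon>) \<le> (N powr (\<delta> / 4)) powr (- \<epsilon>)"
          unfolding R_def using N1 \<epsilon>0 by (intro powr_mono2') auto
        also have "\<dots> = N powr (- \<delta>')" by (simp add: powr_powr \<delta>'_def mult_ac)
        finally have "R powr (- \<epsilon>) * N \<le> N powr (- \<delta>') * N powr 1" using N1 by (intro mult_mono) auto
        also have "\<dots> = N powr (1 - \<delta>')" by (subst powr_add[symmetric]) simp
        finally show ?thesis .
      qed
      have "norm (index_form I (\<lambda>v. \<Sum>s=a..b. \<eta> s v) F)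
        \<le> 3 * R powr 2 * C * N powr (1 - \<delta>) * c + R powr (- \<epsilon>) * (B * N) * c"
        unfolding N_def c_def by (rule index_form_interpolation[OF C(4,1) K I p R _ _ _ \<epsilon>0 \<epsilon>1])
          (use F in \<open>auto simp: Lp_unit_family_def\<close>)
      also have "\<dots> = 3 * C * c * (R powr 2 * N powr (1 - \<delta>)) + B * c * (R powr (- \<epsilon>) * N)" by (simp add: mult_ac)
      also have "\<dots> \<le> 3 * C * c * (4 * N powr (1 - \<delta>')) + B * c * N powr (1 - \<delta>')"
        using C B by (intro add_mono mult_left_mono R2 Re) (auto simp: c_def)
      finally show ?thesis by (simp add: algebra_simps N_def)
    qed
  qed (use \<delta>' in auto)
qed

section \<open>Reduction of the kernel to mean zero pieces\<close>

text \<open>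
  An \<open>L\<^sup>1\<close>-normalised Lipschitz bump at scale \<open>q\<close>. The support radius \<open>4 q\<close> fits the dyadic cutoff, and
  leaves room for a tent of the next scale \<open>2 q\<close>.
\<close>

definition bump :: "real \<Rightarrow> real \<Rightarrow> ('v::euclidean_space \<Rightarrow> complex) \<Rightarrow> bool" where
  "bump c q f \<longleftrightarrow> (\<forall>x. norm (f x) \<le> c / q ^ DIM('v)) \<and> (\<forall>x. 4 * q < norm x \<longrightarrow> f x = 0) \<and>
     (\<forall>x y. norm (f x - f y) \<le> c * norm (x - y) / q ^ (DIM('v) + 1))"

lemma bump_add:
  fixes f g :: "'v::euclidean_space \<Rightarrow> complex"
  assumes "bump c q f" "bump c' q g"
  shows "bump (c + c') q (\<lambda>x. f x + g x)"
  unfolding bump_def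
proof (intro conjI allI impI)
  fix x y :: 'v
  show "norm (f x + g x) \<le> (c + c') / q ^ DIM('v)"
    using assms unfolding bump_def by (auto simp: add_divide_distrib intro: norm_triangle_mono)
  show "f x + g x = 0" if "4 * q < norm x" using assms that unfolding bump_def by auto
  have "norm ((f x - f y) + (g x - g y)) \<le> c * norm (x - y) / q ^ (DIM('v) + 1) + c' * norm (x - y) / q ^ (DIM('v) + 1)"
    using assms unfolding bump_def by (intro norm_triangle_mono) auto
  thus "norm (f x + g x - (f y + g y)) \<le> (c + c') * norm (x - y) / q ^ (DIM('v) + 1)"
    by (simp add: algebra_simps add_divide_distrib)
qed

lemma bump_scale:
  fixes f :: "'v::euclidean_space \<Rightarrow> complex"
  assumes "bump c q f" "norm a \<le> M" "c \<ge> 0" "q > 0"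
  shows "bump (M * c) q (\<lambda>x. a * f x)"
  unfolding bump_def
proof (intro conjI allI impI)
  have M: "M \<ge> 0" using assms(2) norm_ge_zero order_trans by blast
  fix x y :: 'v
  have "norm a * norm (f x) \<le> M * (c / q ^ DIM('v))"
    using assms M unfolding bump_def by (intro mult_mono) auto
  thus "norm (a * f x) \<le> M * c / q ^ DIM('v)" by (simp add: norm_mult)
  show "a * f x = 0" if "4 * q < norm x" using assms that unfolding bump_def by auto
  have "norm a * norm (f x - f y) \<le> M * (c * norm (x - y) / q ^ (DIM('v) + 1))"
    using assms M unfolding bump_def by (intro mult_mono) auto
  thus "norm (a * f x - a * f y) \<le> M * c * norm (x - y) / q ^ (DIM('v) + 1)"
    by (simp add: norm_mult right_diff_distrib[symmetric] mult.assoc)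
qed

lemma measure_cball_lborel:
  assumes "r \<ge> 0"
  shows "measure lborel (cball (c::'v::euclidean_space) r) = unit_ball_vol (real DIM('v)) * r ^ DIM('v)"
  using content_cball[OF assms, of c] by simp

lemma lipschitz_measurable:
  fixes f :: "'v::euclidean_space \<Rightarrow> complex"
  assumes "\<And>x y. norm (f x - f y) \<le> L * norm (x - y)"
  shows "f \<in> borel_measurable borel"
proof (rule borel_measurable_continuous_onI)
  have "(max L 1)-lipschitz_on UNIV f"
  proof (rule lipschitz_onI)
    fix x y :: 'v
    have "L * norm (x - y) \<le> max L 1 * norm (x - y)" by (intro mult_right_mono) auto
    thus "dist (f x) (f y) \<le> max L 1 * dist x y" using assms[of x y] by (simp add: dist_norm)
  qed auto
  thus "continuous_on UNIV f" by (rule lipschitz_on_continuous_on)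
qed

lemma bump_measurable:
  fixes f :: "'v::euclidean_space \<Rightarrow> complex"
  assumes "bump c q f" shows "f \<in> borel_measurable borel"
  by (rule lipschitz_measurable[where L="c / q ^ (DIM('v) + 1)"]) (use assms in \<open>auto simp: bump_def\<close>)

lemma integrable_indicator_cball:
  "integrable lborel (\<lambda>x. indicator (cball (c::'v::euclidean_space) r) x :: real)"
  by (rule integrable_real_indicator[OF _ emeasure_bounded_finite[OF bounded_cball]]) simp

lemma integral_bounded_support:
  fixes f :: "'v::euclidean_space \<Rightarrow> complex"
  assumes m: "f \<in> borel_measurable borel" and b: "\<And>x. norm (f x) \<le> M" and s: "\<And>x. r < norm x \<Longrightarrow> f x = 0" and r: "r \<ge> 0"
  shows "integrable lborel f" "(LINT x|lborel. norm (f x)) \<le> M * (unit_ball_vol (real DIM('v)) * r ^ DIM('v))"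
proof -
  have i: "integrable lborel (\<lambda>x. M * indicator (cball 0 r) x :: real)"
    by (intro integrable_mult_right integrable_indicator_cball)
  have le: "norm (f x) \<le> M * indicator (cball 0 r) x" for x
    using b[of x] s[of x] by (auto simp: indicator_def)
  show "integrable lborel f"
    by (rule Bochner_Integration.integrable_bound[OF i]) (use m le in \<open>auto intro: order_trans[OF _ abs_ge_self]\<close>)
  hence "(LINT x|lborel. norm (f x)) \<le> (LINT x|lborel. M * indicator (cball (0::'v) r) x)"
    using i le by (intro integral_mono) auto
  also have "\<dots> = M * measure lborel (cball (0::'v) r)" by simp
  finally show "(LINT x|lborel. norm (f x)) \<le> M * (unit_ball_vol (real DIM('v)) * r ^ DIM('v))"
    by (simp add: measure_cball_lborel[OF r])
qed

text \<open>
  For a shift \<open>u\<close> of size at most \<open>q\<close> the difference lives in a ball of radius \<open>5 q\<close> and the Lipschitz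
  bound applies; for larger shifts the triangle inequality is good enough.
\<close>

lemma bump_integral:
  fixes f :: "'v::euclidean_space \<Rightarrow> complex"
  assumes f: "bump c q f" and q: "q > 0" and c: "c \<ge> 0"
  shows "integrable lborel f" "(LINT x|lborel. norm (f x)) \<le> c * unit_ball_vol (real DIM('v)) * 4 ^ DIM('v)"
    "(LINT x|lborel. norm (f (x + u) - f x)) \<le> c * unit_ball_vol (real DIM('v)) * (2 * 5 ^ DIM('v)) * norm u / q"
proof -
  note m = bump_measurable[OF f]
  let ?\<omega> = "unit_ball_vol (real DIM('v))"
  have w: "?\<omega> \<ge> 0" by simp
  have b: "norm (f x) \<le> c / q ^ DIM('v)" "4 * q < norm x \<Longrightarrow> f x = 0" 
    "norm (f x - f y) \<le> c * norm (x - y) / q ^ (DIM('v) + 1)" for x y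
    using f unfolding bump_def by auto
  show i: "integrable lborel f" using integral_bounded_support(1)[OF m b(1,2)] q by auto
  show n: "(LINT x|lborel. norm (f x)) \<le> c * ?\<omega> * 4 ^ DIM('v)"
    using integral_bounded_support(2)[OF m b(1,2), of "4 * q"] q by (simp add: power_mult_distrib mult_ac)
  have it: "integrable lborel (\<lambda>x. f (x + u))" using i by (simp add: integrable_translate_iff)
  show "(LINT x|lborel. norm (f (x + u) - f x)) \<le> c * ?\<omega> * (2 * 5 ^ DIM('v)) * norm u / q"
  proof (cases "norm u \<le> q")
    case True
    have "(LINT x|lborel. norm (f (x + u) - f x)) \<le> (c * norm u / q ^ (DIM('v) + 1)) * (?\<omega> * (5 * q) ^ DIM('v))"
    proof (rule integral_bounded_support(2))
      show "(\<lambda>x. f (x + u) - f x) \<in> borel_measurable borel" using m by measurable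
      show "norm (f (x + u) - f x) \<le> c * norm u / q ^ (DIM('v) + 1)" for x using b(3)[of "x + u" x] by simp
      show "f (x + u) - f x = 0" if "5 * q < norm x" for x
      proof -
        have "norm x \<le> norm (x + u) + norm u" using norm_triangle_ineq4[of "x + u" u] by simp
        thus ?thesis using that True b(2)[of x] b(2)[of "x + u"] q by auto
      qed
    qed (use q in auto)
    also have "\<dots> = c * ?\<omega> * 5 ^ DIM('v) * norm u / q" using q by (simp add: power_mult_distrib)
    also have "\<dots> \<le> c * ?\<omega> * (2 * 5 ^ DIM('v)) * norm u / q"
      using q c by (intro divide_right_mono mult_right_mono mult_left_mono) auto
    finally show ?thesis .
  next
    case False
    have "(LINT x|lborel. norm (f (x + u) - f x)) \<le> (LINT x|lborel. norm (f (x + u)) + norm (f x))"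
      using i it by (intro integral_mono integrable_norm Bochner_Integration.integrable_diff Bochner_Integration.integrable_add norm_triangle_ineq4)
    also have "\<dots> = 2 * (LINT x|lborel. norm (f x))"
      using i it integral_translate[of "\<lambda>x. norm (f x)" u] by simp
    also have "\<dots> \<le> 2 * (c * ?\<omega> * 5 ^ DIM('v))"
      using n power_mono[of 4 "5::real" "DIM('v)"] c mult_left_mono[of "4 ^ DIM('v)" "5 ^ DIM('v)" "c * ?\<omega>"] by simp
    also have "\<dots> \<le> 2 * (c * ?\<omega> * 5 ^ DIM('v)) * (norm u / q)"
      using False q c mult_left_mono[of 1 "norm u / q" "2 * (c * ?\<omega> * 5 ^ DIM('v))"] by (simp add: le_divide_eq)
    finally show ?thesis by (simp add: mult_ac)
  qed
qed

lemma scale_kernels_bump: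
  fixes \<eta> :: "int \<Rightarrow> 'v::euclidean_space \<Rightarrow> complex"
  assumes "\<And>s. s \<in> S \<Longrightarrow> bump c (2 powi s) (\<eta> s)" "\<And>s. s \<in> S \<Longrightarrow> (LINT v|lborel. \<eta> s v) = 0" and c: "c \<ge> 0"
    and B: "B \<ge> 4" "B \<ge> c * unit_ball_vol (real DIM('v)) * (2 * 5 ^ DIM('v))"
  shows "scale_kernels B S \<eta>"
  unfolding scale_kernels_def
proof (intro ballI conjI allI impI)
  fix s assume s: "s \<in> S"
  have q: "(2::real) powi s > 0" by simp
  note i = bump_integral[OF assms(1)[OF s] q c]
  show "integrable lborel (\<eta> s)" by (rule i(1))
  show "(LINT v|lborel. \<eta> s v) = 0" by (rule assms(2)[OF s])
  have "(4::real) ^ DIM('v) \<le> 5 ^ DIM('v)" by (rule power_mono) auto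
  moreover have "(0::real) \<le> 5 ^ DIM('v)" by simp
  ultimately have "(4::real) ^ DIM('v) \<le> 2 * 5 ^ DIM('v)" by linarith
  hence "c * unit_ball_vol (real DIM('v)) * 4 ^ DIM('v) \<le> c * unit_ball_vol (real DIM('v)) * (2 * 5 ^ DIM('v))"
    using c by (intro mult_left_mono) auto
  thus "(LINT v|lborel. norm (\<eta> s v)) \<le> B" using i(2) B by linarith
  show "\<eta> s v = 0" if "B * 2 powi s < norm v" for v
  proof -
    have "4 * (2::real) powi s \<le> B * 2 powi s" using B by (intro mult_right_mono B) auto
    hence "4 * 2 powi s < norm v" using that by linarith
    thus ?thesis using assms(1)[OF s] unfolding bump_def by blast
  qed
  show "(LINT v|lborel. norm (\<eta> s (v + u) - \<eta> s v)) \<le> B * norm u / 2 powi s" for u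
    by (rule order_trans[OF i(3)]) (use B in \<open>auto intro!: divide_right_mono mult_right_mono\<close>)
qed

text \<open>
  The tents normalised to integral \<open>1\<close> serve to transport the mean of one scale to the next.
\<close>

definition tent :: "real \<Rightarrow> 'v::euclidean_space \<Rightarrow> real" where
  "tent q x = max 0 (1 - norm x / q)"

definition unit_tent :: "real \<Rightarrow> 'v::euclidean_space \<Rightarrow> complex" where
  "unit_tent q x = of_real (tent q x / (LINT y|lborel. tent q (y::'v)))"

lemma tent_lipschitz:
  assumes "q > 0"
  shows "\<bar>tent q x - tent q y\<bar> \<le> norm (x - y) / q"
proof -
  have "\<bar>tent q x - tent q y\<bar> \<le> \<bar>norm x / q - norm y / q\<bar>" unfolding tent_def by (auto simp: max_def)
  also have "\<dots> = \<bar>norm x - norm y\<bar> / q" using assms by (simp add: diff_divide_distrib[symmetric])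
  also have "\<dots> \<le> norm (x - y) / q" using assms by (intro divide_right_mono norm_triangle_ineq3) auto
  finally show ?thesis .
qed

lemma tent_integral:
  assumes q: "q > 0"
  shows "integrable lborel (tent q :: 'v::euclidean_space \<Rightarrow> real)"
    "unit_ball_vol (real DIM('v)) * q ^ DIM('v) / 2 ^ (DIM('v) + 1) \<le> (LINT y|lborel. tent q (y::'v))"
proof -
  have m[measurable]: "(tent q :: 'v \<Rightarrow> real) \<in> borel_measurable borel" unfolding tent_def by measurable
  have i: "integrable lborel (\<lambda>x::'v. indicator (cball 0 q) x :: real)" "integrable lborel (\<lambda>x::'v. (1/2) * indicator (cball 0 (q/2)) x :: real)"
    by (intro integrable_mult_right integrable_indicator_cball)+
  show t: "integrable lborel (tent q :: 'v \<Rightarrow> real)"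
    by (rule Bochner_Integration.integrable_bound[OF i(1)]) (use q in \<open>auto simp: tent_def indicator_def max_def field_simps\<close>)
  have "unit_ball_vol (real DIM('v)) * q ^ DIM('v) / 2 ^ (DIM('v) + 1) = (1/2) * measure lborel (cball (0::'v) (q/2))"
    using q by (simp add: measure_cball_lborel power_divide)
  also have "\<dots> = (LINT x|lborel. (1/2) * indicator (cball (0::'v) (q/2)) x)" by simp
  also have "\<dots> \<le> (LINT y|lborel. tent q (y::'v))"
    by (intro integral_mono i t) (use q in \<open>auto simp: tent_def indicator_def max_def field_simps\<close>)
  finally show "unit_ball_vol (real DIM('v)) * q ^ DIM('v) / 2 ^ (DIM('v) + 1) \<le> (LINT y|lborel. tent q (y::'v))" .
qed

lemma unit_tent_bump:
  assumes q: "q > 0"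
  shows "bump (2 ^ (DIM('v) + 1) / unit_ball_vol (real DIM('v))) q (unit_tent q :: 'v::euclidean_space \<Rightarrow> complex)" (is "bump ?c _ _")
    and "q < norm x \<Longrightarrow> unit_tent q (x::'v) = 0"
    and "(LINT x|lborel. unit_tent q (x::'v)) = 1"
proof -
  let ?m = "LINT y|lborel. tent q (y::'v)"
  have w: "unit_ball_vol (real DIM('v)) > 0" by simp
  have cq: "1 / ?m \<le> ?c / q ^ DIM('v)" and m0: "?m > 0"
  proof -
    have p: "0 < unit_ball_vol (real DIM('v)) * q ^ DIM('v) / 2 ^ (DIM('v) + 1)" using q w by simp
    thus "?m > 0" using tent_integral(2)[OF q, where 'v='v] by linarith
    have "1 / ?m \<le> 1 / (unit_ball_vol (real DIM('v)) * q ^ DIM('v) / 2 ^ (DIM('v) + 1))"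
      by (rule frac_le[OF _ order_refl p tent_integral(2)[OF q]]) simp
    thus "1 / ?m \<le> ?c / q ^ DIM('v)" by simp
  qed
  show z: "q < norm x \<Longrightarrow> unit_tent q x = 0" for x :: 'v
    unfolding unit_tent_def tent_def using q by (simp add: max_def field_simps)
  show "bump ?c q (unit_tent q :: 'v \<Rightarrow> complex)" unfolding bump_def
  proof (intro conjI allI impI)
    fix x y :: 'v
    have "0 \<le> tent q x" "tent q x \<le> 1" unfolding tent_def using q by auto
    hence "norm (unit_tent q x) \<le> 1 / ?m" unfolding unit_tent_def norm_of_real using m0 by (simp add: divide_right_mono)
    thus "norm (unit_tent q x) \<le> ?c / q ^ DIM('v)" using cq by linarith
    show "4 * q < norm x \<Longrightarrow> unit_tent q x = 0" using z[of x] q by auto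
    have "norm (unit_tent q x - unit_tent q y) = \<bar>tent q x - tent q y\<bar> * (1 / ?m)"
      unfolding unit_tent_def of_real_diff[symmetric] norm_of_real using m0 by (simp add: diff_divide_distrib[symmetric])
    also have "\<dots> \<le> (norm (x - y) / q) * (?c / q ^ DIM('v))"
      using tent_lipschitz[OF q, of x y] cq q m0 by (intro mult_mono) auto
    finally show "norm (unit_tent q x - unit_tent q y) \<le> ?c * norm (x - y) / q ^ (DIM('v) + 1)" by (simp add: mult_ac)
  qed
  show "(LINT x|lborel. unit_tent q (x::'v)) = 1" unfolding unit_tent_def using m0 by (simp add: integral_complex_of_real)
qed

lemma bump_double:
  fixes f :: "'v::euclidean_space \<Rightarrow> complex"
  assumes f: "bump c (2 * q) f" and z: "\<And>x. 2 * q < norm x \<Longrightarrow> f x = 0" and q: "q > 0" and c: "c \<ge> 0"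
  shows "bump c q f"
proof -
  have le: "e / (2 * q) ^ n \<le> e / q ^ n" if "e \<ge> 0" for e n
    using that q by (intro divide_left_mono power_mono) auto
  show ?thesis unfolding bump_def
  proof (intro conjI allI impI)
    fix x y :: 'v
    show "norm (f x) \<le> c / q ^ DIM('v)" using f le[OF c, of "DIM('v)"] unfolding bump_def by (meson order_trans)
    show "4 * q < norm x \<Longrightarrow> f x = 0" using z q by auto
    show "norm (f x - f y) \<le> c * norm (x - y) / q ^ (DIM('v) + 1)"
      using f le[of "c * norm (x - y)" "DIM('v) + 1"] c unfolding bump_def by (meson order_trans mult_nonneg_nonneg norm_ge_zero)
  qed
qed

lemma smooth_has_continuous_derivative:
  fixes \<phi> :: "real \<Rightarrow> complex"
  assumes "smooth_on \<phi> UNIV"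
  obtains \<phi>' where "\<And>t. (\<phi> has_vector_derivative \<phi>' t) (at t)" "continuous_on UNIV \<phi>'"
proof -
  have d: "iter_partial bs \<phi> differentiable (at x)" if "set bs \<subseteq> Basis" for bs x
  proof -
    have "times_differentiable_on (Suc (length bs)) \<phi> UNIV" using assms unfolding smooth_on_def by blast
    thus ?thesis using that unfolding times_differentiable_on_def by blast
  qed
  define \<phi>' where "\<phi>' = iter_partial [1] \<phi>"
  have "(\<phi> has_vector_derivative \<phi>' t) (at t)" for t
  proof -
    have "\<phi> differentiable (at t)" using d[of "[]" t] by simp
    hence "(\<phi> has_derivative frechet_derivative \<phi> (at t)) (at t)" by (simp add: frechet_derivative_works)
    moreover from this have "frechet_derivative \<phi> (at t) h = h *\<^sub>R frechet_derivative \<phi> (at t) 1" for h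
      using linear_cmul[OF has_derivative_linear, of \<phi> "frechet_derivative \<phi> (at t)" "at t" h 1] by simp
    ultimately show ?thesis unfolding has_vector_derivative_def \<phi>'_def
      by (metis (no_types, lifting) ext iter_partial.simps)
  qed
  moreover have "continuous_on UNIV \<phi>'"
    using d[of "[1]"] unfolding \<phi>'_def by (intro differentiable_imp_continuous_on) (auto simp: differentiable_on_def)
  ultimately show thesis using that by blast
qed

lemma dyadic_cutoff_bounds:
  assumes "dyadic_cutoff \<phi>"
  obtains \<phi>' M where "\<And>t. (\<phi> has_vector_derivative \<phi>' t) (at t)" "M \<ge> 0"
    "\<And>t. 0 \<le> t \<Longrightarrow> t \<le> 4 \<Longrightarrow> norm (\<phi> t) \<le> M" "\<And>t. 0 \<le> t \<Longrightarrow> t \<le> 4 \<Longrightarrow> norm (\<phi>' t) \<le> M"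
proof -
  obtain \<phi>' where d: "\<And>t. (\<phi> has_vector_derivative \<phi>' t) (at t)" and c: "continuous_on UNIV \<phi>'"
    using smooth_has_continuous_derivative assms unfolding dyadic_cutoff_def by blast
  have c0: "continuous_on {0..4} \<phi>"
    using d by (meson continuous_at_imp_continuous_on has_vector_derivative_continuous)
  obtain M1 where M1: "\<And>t. t \<in> {0..4} \<Longrightarrow> norm (\<phi> t) \<le> M1"
    using compact_imp_bounded[OF compact_continuous_image[OF c0 compact_Icc]] unfolding bounded_iff by blast
  have c1: "continuous_on {0..4} \<phi>'" using c continuous_on_subset by blast
  obtain M2 where M2: "\<And>t. t \<in> {0..4} \<Longrightarrow> norm (\<phi>' t) \<le> M2"
    using compact_imp_bounded[OF compact_continuous_image[OF c1 compact_Icc]] unfolding bounded_iff by blast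
  show thesis
  proof (rule that[of \<phi>' "max 0 (max M1 M2)", OF d])
    show "norm (\<phi> t) \<le> max 0 (max M1 M2)" if "0 \<le> t" "t \<le> 4" for t using M1[of t] that by auto
    show "norm (\<phi>' t) \<le> max 0 (max M1 M2)" if "0 \<le> t" "t \<le> 4" for t using M2[of t] that by auto
  qed auto
qed

lemma norm_linear_le_Basis:
  fixes T :: "'v::euclidean_space \<Rightarrow> complex"
  assumes T: "linear T" and b: "\<And>b. b \<in> Basis \<Longrightarrow> norm (T b) \<le> K"
  shows "norm (T h) \<le> real DIM('v) * K * norm h"
proof -
  have "T h = T (\<Sum>b\<in>Basis. (h \<bullet> b) *\<^sub>R b)" by (simp add: euclidean_representation)
  also have "\<dots> = (\<Sum>b\<in>Basis. (h \<bullet> b) *\<^sub>R T b)" using T by (simp add: linear_sum linear_cmul)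
  also have "norm \<dots> \<le> (\<Sum>b\<in>(Basis::'v set). norm h * K)"
  proof (intro sum_norm_le)
    fix b :: 'v assume b': "b \<in> Basis"
    have "K \<ge> 0" using b[OF b'] norm_ge_zero order_trans by blast
    thus "norm ((h \<bullet> b) *\<^sub>R T b) \<le> norm h * K"
      using b[OF b'] Basis_le_norm[OF b', of h] by (simp add: mult_mono)
  qed
  finally show ?thesis by (simp add: mult_ac)
qed

lemma CZ_kernel_bounds:
  fixes k :: "'v::euclidean_space \<Rightarrow> complex"
  assumes "CZ_kernel k"
  shows "\<exists>C k'. C \<ge> 0 \<and> (\<forall>x. x \<noteq> 0 \<longrightarrow> norm (k x) \<le> C / norm x ^ DIM('v) \<and> (k has_derivative k' x) (at x) \<and>
     (\<forall>h. norm (k' x h) \<le> C / norm x ^ (DIM('v) + 1) * norm h))"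
proof -
  obtain C where C: "\<And>bs x. set bs \<subseteq> Basis \<Longrightarrow> length bs \<le> DIM('v) + 1 \<Longrightarrow> x \<noteq> 0 \<Longrightarrow>
      norm (iter_partial bs k x) \<le> C / norm x ^ (DIM('v) + length bs)"
    using assms unfolding CZ_kernel_def by blast
  have d: "(k has_derivative frechet_derivative k (at x)) (at x)" if "x \<noteq> 0" for x
  proof -
    have "times_differentiable_on (DIM('v) + 1) k (- {0})" using assms unfolding CZ_kernel_def by blast
    hence "iter_partial [] k differentiable (at x)" using that unfolding times_differentiable_on_def by (elim allE[of _ "[]"]) simp
    thus ?thesis by (simp add: frechet_derivative_works)
  qed
  obtain b :: 'v where b: "b \<in> Basis" using nonempty_Basis by blast
  have nb: "norm b = 1" using b by simp
  have C0: "C \<ge> 0"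
  proof -
    have "norm (k b) \<le> C" using C[of "[]" b] nonzero_Basis[OF b] by (simp add: nb)
    thus ?thesis using norm_ge_zero[of "k b"] by linarith
  qed
  have D1: "1 \<le> real DIM('v)" using DIM_positive[where 'a='v] by linarith
  show ?thesis
  proof (rule exI[of _ "real DIM('v) * C"], rule exI[of _ "\<lambda>x. frechet_derivative k (at x)"], intro conjI allI impI)
    show "0 \<le> real DIM('v) * C" using C0 by simp
    fix x :: 'v assume x: "x \<noteq> 0"
    have "norm (k x) \<le> C / norm x ^ DIM('v)" using C[of "[]" x] x by simp
    also have "\<dots> \<le> real DIM('v) * C / norm x ^ DIM('v)"
      using mult_right_mono[OF D1 C0] by (intro divide_right_mono) auto
    finally show "norm (k x) \<le> real DIM('v) * C / norm x ^ DIM('v)" .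
    show "(k has_derivative frechet_derivative k (at x)) (at x)" by (rule d[OF x])
    fix h :: 'v
    have "norm (frechet_derivative k (at x) h) \<le> real DIM('v) * (C / norm x ^ (DIM('v) + 1)) * norm h"
    proof (rule norm_linear_le_Basis)
      show "linear (frechet_derivative k (at x))" using d[OF x] has_derivative_linear by blast
      show "norm (frechet_derivative k (at x) b) \<le> C / norm x ^ (DIM('v) + 1)" if "b \<in> Basis" for b
        using C[of "[b]" x] that x by simp
    qed
    thus "norm (frechet_derivative k (at x) h) \<le> real DIM('v) * C / norm x ^ (DIM('v) + 1) * norm h" by simp
  qed
qed

lemma cutoff_eq_0:
  assumes \<phi>: "dyadic_cutoff \<phi>" and t: "0 \<le> t" "t < 2 powi s \<or> 4 * 2 powi s < t"
  shows "\<phi> (2 powi (- s) * t) = 0"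
proof -
  define q :: real where "q = 2 powi s"
  have q: "q > 0" unfolding q_def by simp
  define u where "u = 2 powi (- s) * t"
  have uq: "u = t / q" unfolding u_def q_def by (simp add: power_int_minus divide_inverse mult.commute)
  have "u < 1 \<or> 4 < u"
    using t q unfolding uq q_def[symmetric] by (simp add: divide_less_eq less_divide_eq)
  moreover have "0 \<le> u" unfolding uq using q t by simp
  ultimately have "u \<notin> {-4..-1} \<union> {1..4}" by auto
  hence "\<phi> u = 0" using \<phi> unfolding dyadic_cutoff_def by blast
  thus ?thesis unfolding u_def .
qed

lemma psi_eq_0:
  assumes "dyadic_cutoff \<phi>" "norm x < 2 powi s \<or> 4 * 2 powi s < norm x"
  shows "psi k \<phi> s x = 0"
  unfolding psi_def using cutoff_eq_0[OF assms(1) norm_ge_zero assms(2)] by simp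

text \<open>
  The kernel is singular at \<open>0\<close>, but the dyadic piece vanishes near \<open>0\<close>, so it is differentiable
  everywhere and the product rule on the annulus gives a global bound for the derivative.
\<close>

lemma ex_psi_bump:
  fixes k :: "'v::euclidean_space \<Rightarrow> complex"
  assumes k: "CZ_kernel k" and \<phi>: "dyadic_cutoff \<phi>"
  shows "\<exists>c\<ge>0. \<forall>s. bump c (2 powi s) (psi k \<phi> s)"
proof -
  obtain \<phi>' M where d: "\<And>t. (\<phi> has_vector_derivative \<phi>' t) (at t)" and M: "M \<ge> 0"
    "\<And>t. 0 \<le> t \<Longrightarrow> t \<le> 4 \<Longrightarrow> norm (\<phi> t) \<le> M" "\<And>t. 0 \<le> t \<Longrightarrow> t \<le> 4 \<Longrightarrow> norm (\<phi>' t) \<le> M"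
    using dyadic_cutoff_bounds[OF \<phi>] by blast
  obtain C k' where C0: "C \<ge> 0" and Cx: "\<forall>x. x \<noteq> 0 \<longrightarrow> norm (k x) \<le> C / norm x ^ DIM('v) \<and> (k has_derivative k' x) (at x) \<and>
     (\<forall>h. norm (k' x h) \<le> C / norm x ^ (DIM('v) + 1) * norm h)"
    using CZ_kernel_bounds[OF k] by (elim exE conjE)
  have C: "C \<ge> 0" "\<And>x. x \<noteq> 0 \<Longrightarrow> norm (k x) \<le> C / norm x ^ DIM('v)"
    "\<And>x. x \<noteq> 0 \<Longrightarrow> (k has_derivative k' x) (at x)"
    "\<And>x h. x \<noteq> 0 \<Longrightarrow> norm (k' x h) \<le> C / norm x ^ (DIM('v) + 1) * norm h"
    using C0 Cx by simp_all
  have "bump (2 * M * C) (2 powi s) (psi k \<phi> s)" for s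
  proof -
    define q :: real where "q = 2 powi s"
    have q: "q > 0" by (simp add: q_def)
    have psi: "psi k \<phi> s = (\<lambda>x. \<phi> (norm x / q) * k x)"
      by (simp add: psi_def q_def power_int_minus fun_eq_iff divide_inverse mult.commute)
    have z: "psi k \<phi> s x = 0" if "norm x < q \<or> 4 * q < norm x" for x
      using psi_eq_0[OF \<phi>] that unfolding q_def by blast
    have MC: "0 \<le> M * C" using M C by simp
    have pw: "e / norm x ^ m \<le> e / q ^ m" if "q \<le> norm x" "e \<ge> 0" for e m and x :: 'v
      using that q by (intro frac_le power_mono zero_less_power) auto
    have kq: "norm (k x) \<le> C / q ^ DIM('v)" if "q \<le> norm x" for x
      using C(2)[of x] pw[OF that C(1), of "DIM('v)"] that q by fastforce
    have k'q: "norm (k' x h) \<le> C / q ^ (DIM('v) + 1) * norm h" if "q \<le> norm x" for x h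
    proof -
      have "norm (k' x h) \<le> C / norm x ^ (DIM('v) + 1) * norm h" using that q by (intro C(4)) auto
      also have "\<dots> \<le> C / q ^ (DIM('v) + 1) * norm h" by (intro mult_right_mono pw that C) auto
      finally show ?thesis .
    qed
    have "\<exists>D. (psi k \<phi> s has_derivative D) (at x) \<and> (\<forall>h. norm (D h) \<le> 2 * M * C / q ^ (DIM('v) + 1) * norm h)" for x
    proof (cases "norm x < q \<or> 4 * q < norm x")
      case True
      have op: "open {x::'v. norm x < q \<or> 4 * q < norm x}"
        by (intro open_Collect_disj open_Collect_less continuous_intros)
      have "(psi k \<phi> s has_derivative (\<lambda>_. 0)) (at x)"
        by (rule has_derivative_transform_within_open[OF has_derivative_const[of 0] op]) (use True z in auto)
      thus ?thesis using M(1) C(1) q by (intro exI[of _ "\<lambda>_. 0"]) simp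
    next
      case False
      hence x: "q \<le> norm x" "norm x \<le> 4 * q" by auto
      hence x0: "x \<noteq> 0" using q by auto
      define t where "t = norm x / q"
      have t: "0 \<le> t" "t \<le> 4" unfolding t_def using x q by (auto simp: field_simps)
      have dn: "((\<lambda>x. norm x / q) has_derivative (\<lambda>h. (h \<bullet> sgn x) / q)) (at x)"
        using x0 q by (auto intro!: derivative_eq_intros has_derivative_norm)
      have d\<phi>: "((\<lambda>x. \<phi> (norm x / q)) has_derivative (\<lambda>h. ((h \<bullet> sgn x) / q) *\<^sub>R \<phi>' t)) (at x)"
        using diff_chain_at[OF dn d[unfolded has_vector_derivative_def, of "norm x / q"]] by (simp add: o_def t_def)
      define D where "D = (\<lambda>h. \<phi> t * k' x h + (((h \<bullet> sgn x) / q) *\<^sub>R \<phi>' t) * k x)"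
      have "(psi k \<phi> s has_derivative D) (at x)"
        unfolding psi D_def t_def using has_derivative_mult[OF d\<phi> C(3)[OF x0]] by (simp add: t_def)
      moreover have "norm (D h) \<le> 2 * M * C / q ^ (DIM('v) + 1) * norm h" for h
      proof -
        have "norm (\<phi> t * k' x h) \<le> M * (C / q ^ (DIM('v) + 1) * norm h)"
          unfolding norm_mult by (intro mult_mono M t k'q x) auto
        moreover have "norm ((((h \<bullet> sgn x) / q) *\<^sub>R \<phi>' t) * k x) \<le> (norm h / q * M) * (C / q ^ DIM('v))"
        proof -
          have "\<bar>h \<bullet> sgn x\<bar> \<le> norm h" using Cauchy_Schwarz_ineq2[of h "sgn x"] x0 by (simp add: norm_sgn)
          hence "\<bar>(h \<bullet> sgn x) / q\<bar> \<le> norm h / q" using q by (simp add: divide_right_mono)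
          thus ?thesis unfolding norm_mult norm_scaleR
            using q M by (intro mult_mono M t kq x) auto
        qed
        ultimately have "norm (D h) \<le> M * (C / q ^ (DIM('v) + 1) * norm h) + (norm h / q * M) * (C / q ^ DIM('v))"
          unfolding D_def by (rule norm_triangle_mono)
        thus ?thesis by (simp add: field_simps)
      qed
      ultimately show ?thesis by blast
    qed
    then obtain D where D: "\<And>x. (psi k \<phi> s has_derivative D x) (at x)" "\<And>x h. norm (D x h) \<le> 2 * M * C / q ^ (DIM('v) + 1) * norm h"
      by metis
    show ?thesis unfolding bump_def q_def[symmetric]
    proof (intro conjI allI impI)
      fix x y :: 'v
      show "norm (psi k \<phi> s x) \<le> 2 * M * C / q ^ DIM('v)"
      proof (cases "norm x < q \<or> 4 * q < norm x")
        case True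
        thus ?thesis using z[of x] MC q by (simp add: mult.assoc)
      next
        case False
        hence x: "q \<le> norm x" "norm x \<le> 4 * q" by auto
        have "norm (psi k \<phi> s x) \<le> M * (C / q ^ DIM('v))"
          unfolding psi norm_mult using x q by (intro mult_mono M kq) (auto simp: field_simps)
        moreover have "0 \<le> M * C / q ^ DIM('v)" using MC q by simp
        moreover have "2 * M * C / q ^ DIM('v) = 2 * (M * C / q ^ DIM('v))" "M * (C / q ^ DIM('v)) = M * C / q ^ DIM('v)" by simp_all
        ultimately show ?thesis by linarith
      qed
      show "4 * q < norm x \<Longrightarrow> psi k \<phi> s x = 0" using z by blast
      have "norm (psi k \<phi> s x - psi k \<phi> s y) \<le> (2 * M * C / q ^ (DIM('v) + 1)) * norm (x - y)"
      proof (rule differentiable_bound[of UNIV])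
        show "(psi k \<phi> s has_derivative D z) (at z within UNIV)" for z using D(1) by simp
        show "onorm (D z) \<le> 2 * M * C / q ^ (DIM('v) + 1)" for z using D(2) by (intro onorm_le) auto
      qed auto
      thus "norm (psi k \<phi> s x - psi k \<phi> s y) \<le> 2 * M * C * norm (x - y) / q ^ (DIM('v) + 1)" by simp
    qed
  qed
  thus ?thesis using M C by (intro exI[of _ "2 * M * C"]) auto
qed

lemma annulus_truncation_measurable:
  fixes k :: "'v::euclidean_space \<Rightarrow> complex"
  assumes "CZ_kernel k" and r: "0 < r"
  shows "annulus_truncation r R k \<in> borel_measurable borel"
proof -
  obtain C k' where C0: "C \<ge> 0" and Cx: "\<forall>x. x \<noteq> 0 \<longrightarrow> norm (k x) \<le> C / norm x ^ DIM('v) \<and> (k has_derivative k' x) (at x) \<and>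
     (\<forall>h. norm (k' x h) \<le> C / norm x ^ (DIM('v) + 1) * norm h)"
    using CZ_kernel_bounds[OF assms(1)] by (elim exE conjE)
  have d: "\<And>x. x \<noteq> 0 \<Longrightarrow> (k has_derivative k' x) (at x)" using Cx by simp
  have "continuous_on (- {0}) k"
    by (intro continuous_at_imp_continuous_on ballI) (use has_derivative_continuous[OF d] in auto)
  hence m: "k \<in> borel_measurable (restrict_space borel (- {0}))"
    by (rule borel_measurable_continuous_on_restrict)
  have "(\<lambda>x. indicator (- {0}) x *\<^sub>R k x) \<in> borel_measurable borel"
    using m by (subst borel_measurable_restrict_space_iff[symmetric]) auto
  moreover have "annulus_truncation r R k = (\<lambda>x. if r < norm x \<and> norm x < R then indicator (- {0}) x *\<^sub>R k x else 0)"
    using r by (auto simp: annulus_truncation_def fun_eq_iff indicator_def)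
  ultimately show ?thesis by simp
qed

lemma integral_reflect:
  fixes f :: "'v::euclidean_space \<Rightarrow> complex"
  assumes "f \<in> borel_measurable borel"
  shows "(LINT y|lborel. f (x - y)) = (LINT y|lborel. f y)"
proof -
  have "lborel = distr lborel borel (\<lambda>y. x - y :: 'v)"
    using lborel_affine[of "-1" x] by (simp add: density_1)
  hence "(LINT y|lborel. f y) = (LINT y|distr lborel borel (\<lambda>y. x - y). f y)" by simp
  also have "\<dots> = (LINT y|lborel. f (x - y))"
    using assms by (subst integral_distr) auto
  finally show ?thesis by simp
qed

text \<open>
  Apply the truncated convolution to the indicator of the ball of radius \<open>2 R\<close>. At every point of the
  ball of radius \<open>R\<close> the kernel is integrated completely, so the output is constantly equal to the
  integral \<open>I\<close> there; the \<open>L\<^sup>2\<close> bound and the ratio \<open>2 ^ DIM('v)\<close> of the volumes then bound \<open>I\<close>.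
\<close>

lemma ex_truncation_integral_bound:
  fixes k :: "'v::euclidean_space \<Rightarrow> complex"
  assumes k: "CZ_kernel k"
  shows "\<exists>A\<ge>0. \<forall>r R. 0 < r \<longrightarrow> integrable lborel (annulus_truncation r R k) \<and> norm (LINT x|lborel. annulus_truncation r R k x) \<le> A"
proof -
  have "\<exists>A. \<forall>r R. 0 < r \<and> r < R \<longrightarrow> (\<forall>f \<in> Lp_space lebesgue 2.
        convolution (annulus_truncation r R k) f \<in> Lp_space lebesgue 2 \<and>
        Lp_norm lebesgue 2 (convolution (annulus_truncation r R k) f) \<le> A * Lp_norm lebesgue 2 f)"
    using k unfolding CZ_kernel_def by (elim conjE)
  then obtain A where A: "\<forall>r R. 0 < r \<and> r < R \<longrightarrow> (\<forall>f \<in> Lp_space lebesgue 2.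
        convolution (annulus_truncation r R k) f \<in> Lp_space lebesgue 2 \<and>
        Lp_norm lebesgue 2 (convolution (annulus_truncation r R k) f) \<le> A * Lp_norm lebesgue 2 f)"
    by (elim exE)
  obtain C k' where C0: "C \<ge> 0" and Cx: "\<forall>x. x \<noteq> 0 \<longrightarrow> norm (k x) \<le> C / norm x ^ DIM('v) \<and> (k has_derivative k' x) (at x) \<and>
     (\<forall>h. norm (k' x h) \<le> C / norm x ^ (DIM('v) + 1) * norm h)"
    using CZ_kernel_bounds[OF k] by (elim exE conjE)
  have C: "C \<ge> 0" "\<And>x. x \<noteq> 0 \<Longrightarrow> norm (k x) \<le> C / norm x ^ DIM('v)" using C0 Cx by simp_all
  define A' where "A' = sqrt (A\<^sup>2 * 2 ^ DIM('v))"
  have "integrable lborel (annulus_truncation r R k) \<and> norm (LINT x|lborel. annulus_truncation r R k x) \<le> A'" if r: "0 < r" for r R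
  proof (cases "r < R")
    case False
    hence "annulus_truncation r R k = (\<lambda>_. 0)" by (auto simp: annulus_truncation_def fun_eq_iff)
    thus ?thesis by (simp add: A'_def)
  next
    case True
    hence R: "R > 0" using r by simp
    define g where "g = annulus_truncation r R k"
    have gm[measurable]: "g \<in> borel_measurable borel" unfolding g_def by (rule annulus_truncation_measurable[OF k r])
    have gi: "integrable lborel g"
    proof (rule integral_bounded_support(1)[OF gm])
      show "norm (g x) \<le> C / r ^ DIM('v)" for x
      proof (cases "r < norm x \<and> norm x < R")
        case True
        hence "norm (g x) \<le> C / norm x ^ DIM('v)" using C(2)[of x] r unfolding g_def annulus_truncation_def by (cases "x = 0") auto
        also have "\<dots> \<le> C / r ^ DIM('v)" using True r C by (intro frac_le power_mono zero_less_power) auto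
        finally show ?thesis .
      next
        case False
        thus ?thesis using C r unfolding g_def annulus_truncation_def by auto
      qed
      show "R < norm x \<Longrightarrow> g x = 0" for x unfolding g_def annulus_truncation_def by auto
    qed (use R in auto)
    define f where "f = (\<lambda>x::'v. complex_of_real (indicator (cball 0 (2 * R)) x))"
    have fn: "norm (f x) powr 2 = indicator (cball 0 (2 * R)) x" for x unfolding f_def by (auto simp: indicator_def)
    have ii: "integrable lebesgue (\<lambda>x. indicator (cball (0::'v) e) x :: real)" for e
      by (subst integrable_completion[OF borel_measurable_integrable[OF integrable_indicator_cball]]) (rule integrable_indicator_cball)
    have iv: "(LINT x|lebesgue. indicator (cball (0::'v) e) x) = unit_ball_vol (real DIM('v)) * e ^ DIM('v)" if "e \<ge> 0" for e
      by (subst integral_completion[OF borel_measurable_integrable[OF integrable_indicator_cball]]) (use that in \<open>simp add: measure_cball_lborel\<close>)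
    have fL: "f \<in> Lp_space lebesgue 2"
    proof -
      have "f \<in> borel_measurable lborel" unfolding f_def
        by (rule measurable_compose[OF borel_measurable_integrable[OF integrable_indicator_cball] borel_measurable_of_real])
      thus ?thesis unfolding Lp_space_def fn mem_Collect_eq using ii by (blast intro: measurable_completion)
    qed
    define h where "h = convolution g f"
    have h: "h \<in> Lp_space lebesgue 2" "Lp_norm lebesgue 2 h \<le> A * Lp_norm lebesgue 2 f"
      using A[rule_format, OF conjI[OF r True] fL] unfolding h_def g_def by blast+
    define I where "I = (LINT x|lborel. g x)"
    have hI: "h x = I" if x: "norm x \<le> R" for x
    proof -
      have "h x = (LINT y|lebesgue. g (x - y))"
        unfolding h_def convolution_def
      proof (rule Bochner_Integration.integral_cong[OF refl])
        fix y
        show "g (x - y) * f y = g (x - y)"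
        proof (cases "norm (x - y) < R")
          case True
          have "norm y \<le> norm x + norm (x - y)" using norm_triangle_ineq4[of x "x - y"] by simp
          hence "f y = 1" using True x unfolding f_def by (simp add: indicator_def)
          thus ?thesis by simp
        next
          case False
          thus ?thesis unfolding g_def annulus_truncation_def by simp
        qed
      qed
      also have "\<dots> = (LINT y|lborel. g (x - y))" by (rule integral_completion) measurable
      finally show ?thesis unfolding I_def by (simp add: integral_reflect[OF gm])
    qed
    have hi: "integrable lebesgue (\<lambda>x. norm (h x) powr 2)" using h unfolding Lp_space_def by auto
    define w where "w = unit_ball_vol (real DIM('v)) * R ^ DIM('v)"
    have w: "w > 0" unfolding w_def using R by simp
    have "(norm I)\<^sup>2 * w = (LINT x|lebesgue. (norm I)\<^sup>2 * indicator (cball (0::'v) R) x)"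
      using iv[of R] R by (simp add: w_def)
    also have "\<dots> \<le> (LINT x|lebesgue. norm (h x) powr 2)"
    proof (rule integral_mono[OF _ hi])
      show "integrable lebesgue (\<lambda>x. (norm I)\<^sup>2 * indicator (cball (0::'v) R) x)" using ii by simp
      show "(norm I)\<^sup>2 * indicator (cball (0::'v) R) x \<le> norm (h x) powr 2" for x
        using hI[of x] by (auto simp: indicator_def)
    qed
    also have "\<dots> = (Lp_norm lebesgue 2 h)\<^sup>2"
      unfolding Lp_norm_def by (simp add: powr_half_sqrt)
    also have "\<dots> \<le> (A * Lp_norm lebesgue 2 f)\<^sup>2"
      using h(2) by (intro power_mono) (auto simp: Lp_norm_def)
    also have "\<dots> = A\<^sup>2 * (LINT x|lebesgue. norm (f x) powr 2)"
      unfolding Lp_norm_def by (simp add: powr_half_sqrt power_mult_distrib)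
    also have "\<dots> = A\<^sup>2 * 2 ^ DIM('v) * w"
      unfolding fn using iv[of "2 * R"] R by (simp add: w_def power_mult_distrib)
    finally have "(norm I)\<^sup>2 \<le> A\<^sup>2 * 2 ^ DIM('v)" using w by simp
    hence "norm I \<le> A'" unfolding A'_def by (rule real_le_rsqrt)
    thus ?thesis using gi unfolding I_def g_def by simp
  qed
  thus ?thesis by (intro exI[of _ A']) (simp add: A'_def)
qed

lemma cutoff_sum_eq_1:
  assumes \<phi>: "dyadic_cutoff \<phi>" and t: "2 powi (a + 2) < t" "t < 2 powi b"
  shows "(\<Sum>s=a..b. \<phi> (2 powi (- s) * t)) = 1"
proof -
  have t0: "t > 0" using t(1) by (rule less_trans[rotated]) simp
  have tot: "((\<lambda>s::int. \<phi> (2 powi (- s) * t)) has_sum 1) UNIV"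
    using \<phi> less_imp_neq[OF t0, symmetric] unfolding dyadic_cutoff_def by blast
  have z: "\<phi> (2 powi (- s) * t) = 0" if "s \<notin> {a..b}" for s
  proof (rule cutoff_eq_0[OF \<phi>])
    show "t < 2 powi s \<or> 4 * 2 powi s < t"
    proof (cases "s < a")
      case True
      have "4 * (2::real) powi s = 2 powi (s + 2)" by (simp add: power_int_add)
      also have "\<dots> \<le> 2 powi (a + 2)" using True by (intro power_int_increasing) auto
      finally show ?thesis using t by linarith
    next
      case False
      hence "(2::real) powi b \<le> 2 powi s" using that by (intro power_int_increasing) auto
      thus ?thesis using t by linarith
    qed
  qed (use t0 in simp)
  have "((\<lambda>s::int. \<phi> (2 powi (- s) * t)) has_sum 1) UNIV \<longleftrightarrow> ((\<lambda>s::int. \<phi> (2 powi (- s) * t)) has_sum 1) {a..b}"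
    by (rule has_sum_cong_neutral) (use z in blast)+
  hence "((\<lambda>s::int. \<phi> (2 powi (- s) * t)) has_sum 1) {a..b}" using tot by blast
  moreover have "((\<lambda>s::int. \<phi> (2 powi (- s) * t)) has_sum (\<Sum>s=a..b. \<phi> (2 powi (- s) * t))) {a..b}"
    by (rule has_sum_finite) simp
  ultimately show ?thesis using has_sum_unique by blast
qed

text \<open>
  The sum over \<open>{a..b}\<close> is the sharp truncation to \<open>2 powi (a + 2) < |x| < 2 powi b\<close>, where the cutoffs add up
  to \<open>1\<close>, up to the at most six scales that meet the two ends of this annulus.
\<close>

lemma ex_psi_sum_integral_bound:
  fixes k :: "'v::euclidean_space \<Rightarrow> complex"
  assumes k: "CZ_kernel k" and \<phi>: "dyadic_cutoff \<phi>"
  shows "\<exists>A\<ge>0. \<forall>a b. norm (LINT x|lborel. psi_sum k \<phi> {a..b} x) \<le> A"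
proof -
  obtain A where A: "A \<ge> 0" "\<And>r R. 0 < r \<Longrightarrow> integrable lborel (annulus_truncation r R k)"
     "\<And>r R. 0 < r \<Longrightarrow> norm (LINT x|lborel. annulus_truncation r R k x) \<le> A"
    using ex_truncation_integral_bound[OF k] by blast
  obtain c where c: "c \<ge> 0" "\<And>s. bump c (2 powi s) (psi k \<phi> s)" using ex_psi_bump[OF k \<phi>] by blast
  define B where "B = c * unit_ball_vol (real DIM('v)) * 4 ^ DIM('v)"
  have i: "integrable lborel (psi k \<phi> s)" and B: "(LINT x|lborel. norm (psi k \<phi> s x)) \<le> B" for s
    using bump_integral(1,2)[OF c(2) _ c(1)] unfolding B_def by auto
  have B0: "B \<ge> 0" unfolding B_def using c by simp
  have "norm (LINT x|lborel. psi_sum k \<phi> {a..b} x) \<le> A + 6 * B" for a b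
  proof -
    define T where "T = {a..a+2} \<union> {b-2..b}"
    have fT: "finite T" "card T \<le> 6"
    proof -
      have "card T \<le> card {a..a+2} + card {b-2..b}" unfolding T_def by (rule card_Un_le)
      thus "card T \<le> 6" by simp
    qed (simp add: T_def)
    define g where "g = annulus_truncation (2 powi (a + 2)) (2 powi b) k"
    have gi: "integrable lborel g" unfolding g_def by (rule A) simp
    have Si: "integrable lborel (psi_sum k \<phi> {a..b})" unfolding psi_sum_def using i by simp
    have pt: "norm (psi_sum k \<phi> {a..b} x - g x) \<le> (\<Sum>s\<in>T. norm (psi k \<phi> s x))" for x
    proof (cases "2 powi (a + 2) < norm x \<and> norm x < 2 powi b")
      case True
      have "psi_sum k \<phi> {a..b} x = (\<Sum>s=a..b. \<phi> (2 powi (- s) * norm x)) * k x"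
        unfolding psi_sum_def psi_def by (simp add: sum_distrib_right)
      hence "psi_sum k \<phi> {a..b} x = g x" using cutoff_sum_eq_1[OF \<phi>] True unfolding g_def annulus_truncation_def by simp
      thus ?thesis by (simp add: sum_nonneg)
    next
      case False
      have "psi k \<phi> s x = 0" if s: "s \<in> {a..b} - T" for s
      proof (rule psi_eq_0[OF \<phi>])
        have s': "a + 2 < s" "s + 2 < b" using s unfolding T_def by auto
        have "(2::real) powi (a + 2) < 2 powi s" using s' by (intro power_int_strict_increasing) auto
        moreover have "4 * (2::real) powi s = 2 powi (s + 2)" by (simp add: power_int_add)
        moreover have "(2::real) powi (s + 2) < 2 powi b" using s' by (intro power_int_strict_increasing) auto
        ultimately show "norm x < 2 powi s \<or> 4 * 2 powi s < norm x" using False by linarith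
      qed
      hence "(\<Sum>s\<in>{a..b}. norm (psi k \<phi> s x)) = (\<Sum>s\<in>{a..b} \<inter> T. norm (psi k \<phi> s x))"
        by (intro sum.mono_neutral_right) auto
      also have "\<dots> \<le> (\<Sum>s\<in>T. norm (psi k \<phi> s x))" using fT by (intro sum_mono2) auto
      finally have "norm (psi_sum k \<phi> {a..b} x) \<le> (\<Sum>s\<in>T. norm (psi k \<phi> s x))"
        unfolding psi_sum_def by (rule order_trans[OF norm_sum])
      moreover have "g x = 0" unfolding g_def annulus_truncation_def by (rule if_not_P[OF False])
      ultimately show ?thesis by simp
    qed
    have "norm (LINT x|lborel. psi_sum k \<phi> {a..b} x - g x) \<le> (LINT x|lborel. norm (psi_sum k \<phi> {a..b} x - g x))"
      by (rule integral_norm_bound)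
    also have "\<dots> \<le> (LINT x|lborel. (\<Sum>s\<in>T. norm (psi k \<phi> s x)))"
      using Si gi i pt by (intro integral_mono) auto
    also have "\<dots> = (\<Sum>s\<in>T. LINT x|lborel. norm (psi k \<phi> s x))" using i by (intro Bochner_Integration.integral_sum) auto
    also have "\<dots> \<le> (\<Sum>s\<in>T. B)" by (intro sum_mono B)
    also have "\<dots> \<le> 6 * B" using fT(2) B0 by (simp add: mult_right_mono)
    finally have "norm ((LINT x|lborel. psi_sum k \<phi> {a..b} x) - (LINT x|lborel. g x)) \<le> 6 * B"
      using Si gi by simp
    moreover have "norm (LINT x|lborel. g x) \<le> A" unfolding g_def by (rule A) simp
    ultimately show ?thesis
      using norm_triangle_sub[of "LINT x|lborel. psi_sum k \<phi> {a..b} x" "LINT x|lborel. g x"] by linarith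
  qed
  thus ?thesis using A(1) B0 by (intro exI[of _ "A + 6 * B"]) auto
qed

text \<open>
  Summation by parts: with \<open>m s\<close> the integral of the scales \<open>a\<close> to \<open>s\<close> and \<open>\<theta> s\<close> a tent of integral \<open>1\<close>
  at scale \<open>2\<^sup>s\<close>, the kernel \<open>\<psi>\<^sub>s + m (s - 1) \<theta> s - m s \<theta> (s + 1)\<close> has mean zero, and the correction
  terms telescope to \<open>- m b \<theta> (b + 1)\<close>. The bound on \<open>m\<close> makes the constants uniform.
\<close>

lemma ex_mean_zero_kernels:
  fixes k :: "'v::euclidean_space \<Rightarrow> complex"
  assumes k: "CZ_kernel k" and \<phi>: "dyadic_cutoff \<phi>"
  shows "\<exists>B\<ge>0. \<forall>a b. \<exists>\<eta> \<rho>. scale_kernels B {a..b} \<eta> \<and> integrable lborel \<rho> \<and> (LINT v|lborel. norm (\<rho> v)) \<le> B \<and>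
     psi_sum k \<phi> {a..b} = (\<lambda>v. (\<Sum>s=a..b. \<eta> s v) + \<rho> v)"
proof -
  obtain A where A: "A \<ge> 0" "\<And>a b. norm (LINT x|lborel. psi_sum k \<phi> {a..b} x) \<le> A"
    using ex_psi_sum_integral_bound[OF k \<phi>] by blast
  obtain c where c: "c \<ge> 0" "\<And>s. bump c (2 powi s) (psi k \<phi> s)" using ex_psi_bump[OF k \<phi>] by blast
  have i: "integrable lborel (psi k \<phi> s)" for s using bump_integral(1)[OF c(2) _ c(1)] by auto
  define d where "d = 2 ^ (DIM('v) + 1) / unit_ball_vol (real DIM('v))"
  have d: "d \<ge> 0" unfolding d_def by simp
  define \<theta> where "\<theta> = (\<lambda>s::int. (unit_tent (2 powi s) :: 'v \<Rightarrow> complex))"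
  have \<theta>b: "bump d (2 powi s) (\<theta> s)" and \<theta>1: "(LINT x|lborel. \<theta> s x) = 1" for s
    unfolding \<theta>_def d_def by (rule unit_tent_bump; simp)+
  have \<theta>b': "bump d (2 powi s) (\<theta> (s + 1))" for s
  proof (rule bump_double)
    have e: "(2::real) powi (s + 1) = 2 * 2 powi s" by (simp add: power_int_add)
    show "bump d (2 * 2 powi s) (\<theta> (s + 1))" using \<theta>b[of "s + 1"] unfolding e .
    show "\<theta> (s + 1) x = 0" if "2 * 2 powi s < norm x" for x
      unfolding \<theta>_def e by (rule unit_tent_bump(2)[OF _ that]) simp
  qed (use d in auto)
  have \<theta>i: "integrable lborel (\<theta> s)" for s using bump_integral(1)[OF \<theta>b _ d] by simp
  define e where "e = c + (A * d + A * d)"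
  have e: "e \<ge> 0" unfolding e_def using A c d by simp
  define B where "B = max 4 (max (e * unit_ball_vol (real DIM('v)) * (2 * 5 ^ DIM('v))) (A * (d * unit_ball_vol (real DIM('v)) * 4 ^ DIM('v))))"
  show ?thesis
  proof (rule exI[of _ B], intro conjI allI)
    show "B \<ge> 0" unfolding B_def by simp
    fix a b :: int
    define m where "m = (\<lambda>s. LINT x|lborel. psi_sum k \<phi> {a..s} x)"
    define \<eta> where "\<eta> = (\<lambda>s x. psi k \<phi> s x + (m (s - 1) * \<theta> s x + (- m s) * \<theta> (s + 1) x))"
    define \<rho> where "\<rho> = (\<lambda>x. m b * \<theta> (b + 1) x)"
    have mA: "norm (m s) \<le> A" for s unfolding m_def by (rule A)
    have ms: "m s = m (s - 1) + (LINT x|lborel. psi k \<phi> s x)" if "a \<le> s" for s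
    proof -
      have "{a..s} = insert s {a..s - 1}" using that by auto
      hence e: "psi_sum k \<phi> {a..s} x = psi_sum k \<phi> {a..s - 1} x + psi k \<phi> s x" for x
        unfolding psi_sum_def by simp
      have "integrable lborel (\<lambda>x. psi_sum k \<phi> {a..s - 1} x)" unfolding psi_sum_def using i by simp
      thus ?thesis unfolding m_def e using i by (intro Bochner_Integration.integral_add) auto
    qed
    have "scale_kernels B {a..b} \<eta>"
    proof (rule scale_kernels_bump[OF _ _ e])
      fix s assume s: "s \<in> {a..b}"
      show "bump e (2 powi s) (\<eta> s)" unfolding \<eta>_def e_def
        using mA by (intro bump_add bump_scale c(2) \<theta>b \<theta>b' d) auto
      have "(LINT v|lborel. \<eta> s v) = (LINT v|lborel. psi k \<phi> s v) + (m (s - 1) - m s)"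
        unfolding \<eta>_def using i \<theta>i \<theta>1 by simp
      thus "(LINT v|lborel. \<eta> s v) = 0" using ms[of s] s by simp
    qed (simp_all add: B_def)
    moreover have "integrable lborel \<rho>" unfolding \<rho>_def using \<theta>i by simp
    moreover have "(LINT v|lborel. norm (\<rho> v)) \<le> B"
    proof -
      have "(LINT v|lborel. norm (\<rho> v)) = norm (m b) * (LINT v|lborel. norm (\<theta> (b + 1) v))"
        unfolding \<rho>_def norm_mult by simp
      also have "\<dots> \<le> A * (d * unit_ball_vol (real DIM('v)) * 4 ^ DIM('v))"
        using mA A(1) bump_integral(2)[OF \<theta>b _ d] by (intro mult_mono) (auto intro!: integral_nonneg_AE)
      finally show ?thesis unfolding B_def by simp
    qed
    moreover have "psi_sum k \<phi> {a..b} x = (\<Sum>s=a..b. \<eta> s x) + \<rho> x" for x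
    proof (cases "a \<le> b")
      case False
      thus ?thesis by (simp add: \<rho>_def m_def psi_sum_def)
    next
      case True
      hence "(\<Sum>s=a..b. m (s - 1) * \<theta> s x + (- m s) * \<theta> (s + 1) x) = - (m b * \<theta> (b + 1) x)"
      proof (induction b rule: int_ge_induct)
        case base
        show ?case by (simp add: m_def psi_sum_def)
      next
        case (step b)
        have "{a..b+1} = insert (b+1) {a..b}" using step by auto
        thus ?case using step by simp
      qed
      thus ?thesis unfolding \<eta>_def \<rho>_def psi_sum_def by (simp add: sum.distrib)
    qed
    ultimately show "\<exists>\<eta> \<rho>. scale_kernels B {a..b} \<eta> \<and> integrable lborel \<rho> \<and> (LINT v|lborel. norm (\<rho> v)) \<le> B \<and>
     psi_sum k \<phi> {a..b} = (\<lambda>v. (\<Sum>s=a..b. \<eta> s v) + \<rho> v)" by blast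
  qed
qed

section \<open>The truncated simplex form\<close>

lemma ex_psi_sum_power_estimate:
  fixes k :: "'v::euclidean_space \<Rightarrow> complex"
  assumes k: "CZ_kernel k" and \<phi>: "dyadic_cutoff \<phi>" and I: "finite I"
    and p0: "\<forall>i\<in>I. 0 < p i" and p1: "(\<Sum>i\<in>I. 1 / p i) = 1"
  shows "\<exists>C \<delta>. 0 \<le> C \<and> 0 < \<delta> \<and> \<delta> \<le> 1 \<and>
    (\<forall>a b F. Lp_unit_family I p F \<longrightarrow>
       norm (index_form I (psi_sum k \<phi> {a..b}) F) \<le> C * real (card {a..b}) powr (1 - \<delta>))"
proof -
  note p = p0[rule_format] p1
  obtain B where B: "B \<ge> 0" and dec: "\<forall>a b. \<exists>\<eta> \<rho>. scale_kernels B {a..b} \<eta> \<and> integrable lborel \<rho> \<and> (LINT v|lborel. norm (\<rho> v)) \<le> B \<and>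
     psi_sum k \<phi> {a..b} = (\<lambda>v. (\<Sum>s=a..b. \<eta> s v) + \<rho> v)"
    using ex_mean_zero_kernels[OF k \<phi>] by (elim exE conjE)
  obtain C \<delta> where C: "0 \<le> C" "0 < \<delta>" "\<delta> \<le> 1" and est: "\<forall>a b. \<forall>\<eta> :: int \<Rightarrow> 'v \<Rightarrow> complex. \<forall>F. scale_kernels B {a..b} \<eta> \<longrightarrow>
       Lp_unit_family I p F \<longrightarrow>
       norm (index_form I (\<lambda>v. \<Sum>s=a..b. \<eta> s v) F) \<le> C * real (card {a..b}) powr (1 - \<delta>)"
    using ex_power_estimate[OF I B p0 p1, where 'v='v] by (elim exE conjE)
  show ?thesis
  proof (rule exI[of _ "C + real (card I) * B"], rule exI[of _ \<delta>], intro conjI allI impI C)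
    show "0 \<le> C + real (card I) * B" using C B by simp
    fix a b :: int and F :: "nat \<Rightarrow> (nat \<Rightarrow> 'v) \<Rightarrow> complex"
    assume F: "Lp_unit_family I p F"
    show "norm (index_form I (psi_sum k \<phi> {a..b}) F) \<le> (C + real (card I) * B) * real (card {a..b}) powr (1 - \<delta>)"
    proof (cases "a \<le> b")
      case False
      thus ?thesis by (simp add: index_form_def psi_sum_def)
    next
      case True
      obtain \<eta> \<rho> where \<eta>: "scale_kernels B {a..b} \<eta>" and \<rho>: "integrable lborel \<rho>" "(LINT v|lborel. norm (\<rho> v)) \<le> B"
        and eq: "psi_sum k \<phi> {a..b} = (\<lambda>v. (\<Sum>s=a..b. \<eta> s v) + \<rho> v)"
        using dec by meson
      have \<eta>i: "integrable lborel (\<lambda>v. \<Sum>s=a..b. \<eta> s v)" using scale_kernelsD(1)[OF \<eta>] by auto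
      have F': "F i \<in> borel_measurable (lebesgue_power (I - {i}))"
           "integrable (lebesgue_power (I - {i})) (\<lambda>x. norm (F i x) powr p i)"
           "(LINT x|lebesgue_power (I - {i}). norm (F i x) powr p i) \<le> 1" if "i \<in> I" for i
        using F that unfolding Lp_unit_family_def by auto
      have L1: "integrable (lebesgue_power I) (\<lambda>x. (\<Prod>i\<in>I. F i (restrict x (I - {i}))) * K (\<Sum>i\<in>I. x i))"
        and L5: "norm (index_form I K F) \<le> real (card I) * (LINT v|lborel. norm (K v))" if "integrable lborel K" for K
        by (rule index_form_Lp[OF I p F' that]; assumption)+
      have N: "1 \<le> real (card {a..b}) powr (1 - \<delta>)" using True C(3) by (intro ge_one_powr_ge_zero) auto
      have "index_form I (psi_sum k \<phi> {a..b}) F = index_form I (\<lambda>v. \<Sum>s=a..b. \<eta> s v) F + index_form I \<rho> F"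
        unfolding index_form_def eq distrib_left by (rule Bochner_Integration.integral_add[OF L1[OF \<eta>i] L1[OF \<rho>(1)]])
      also have "norm \<dots> \<le> C * real (card {a..b}) powr (1 - \<delta>) + real (card I) * B"
      proof (rule norm_triangle_mono)
        show "norm (index_form I (\<lambda>v. \<Sum>s=a..b. \<eta> s v) F) \<le> C * real (card {a..b}) powr (1 - \<delta>)"
          using est \<eta> F by blast
        show "norm (index_form I \<rho> F) \<le> real (card I) * B"
          using L5[OF \<rho>(1)] \<rho>(2) mult_left_mono[OF \<rho>(2), of "real (card I)"] by linarith
      qed
      also have "real (card I) * B \<le> real (card I) * B * real (card {a..b}) powr (1 - \<delta>)"
        using mult_left_mono[OF N, of "real (card I) * B"] B by simp
      finally show ?thesis by (simp add: distrib_right)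
    qed
  qed
qed

lemma measurable_omit:
  assumes "i \<le> n"
  shows "omit n i \<in> measurable (lebesgue_power ({..n} - {i})) (lebesgue_power {..<n} :: (nat \<Rightarrow> 'v::euclidean_space) measure)"
  unfolding omit_def
proof (rule measurable_restrict)
  fix j assume "j \<in> {..<n}"
  hence "j < i \<Longrightarrow> j \<in> {..n} - {i}" "\<not> j < i \<Longrightarrow> Suc j \<in> {..n} - {i}" by auto
  thus "(\<lambda>x. if j < i then x j else x (Suc j)) \<in> measurable (lebesgue_power ({..n} - {i})) (lborel :: 'v measure)"
    by (cases "j < i") auto
qed

text \<open>
  Omitting the coordinate \<open>i\<close> renumbers the remaining ones, which preserves product measure.
\<close>

lemma distr_omit:
  assumes i: "i \<le> n"
  shows "distr (lebesgue_power ({..n} - {i})) (lebesgue_power {..<n}) (omit n i) = (lebesgue_power {..<n} :: (nat \<Rightarrow> 'v::euclidean_space) measure)"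
proof (rule lborel_product.PiM_eqI)
  let ?J = "{..n} - {i}"
  define s where "s = (\<lambda>j. if j < i then j else Suc j)"
  define r where "r = (\<lambda>l. if l < i then l else l - 1)"
  have bij: "bij_betw s {..<n} ?J"
    by (rule bij_betw_byWitness[where f'=r]) (use i in \<open>auto simp: s_def r_def\<close>)
  have rs: "r (s j) = j" for j by (auto simp: r_def s_def)
  have om: "omit n i x = (\<lambda>j\<in>{..<n}. x (s j))" for x :: "nat \<Rightarrow> 'v" unfolding omit_def s_def by (auto simp: restrict_def)
  fix A :: "nat \<Rightarrow> 'v set" assume A: "\<And>j. j \<in> {..<n} \<Longrightarrow> A j \<in> sets lborel"
  have AP: "Pi\<^sub>E {..<n} A \<in> sets (lebesgue_power {..<n})" using A by (intro sets_PiM_I_finite) auto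
  have Ar: "A (r l) \<in> sets lborel" if "l \<in> ?J" for l
    using that bij A rs unfolding bij_betw_def by (metis imageE)
  have pre: "omit n i -` Pi\<^sub>E {..<n} A \<inter> space (lebesgue_power ?J) = Pi\<^sub>E ?J (\<lambda>l. A (r l))"
  proof (intro equalityI subsetI)
    fix x assume x: "x \<in> omit n i -` Pi\<^sub>E {..<n} A \<inter> space (lebesgue_power ?J)"
    have "x l \<in> A (r l)" if l: "l \<in> ?J" for l
    proof -
      obtain j where j: "j \<in> {..<n}" "l = s j" using l bij unfolding bij_betw_def by blast
      have "omit n i x j \<in> A j" using x j(1) by (auto simp: PiE_def)
      thus ?thesis using j rs unfolding om by simp
    qed
    thus "x \<in> Pi\<^sub>E ?J (\<lambda>l. A (r l))" using x by (auto simp: space_PiM PiE_def)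
  next
    fix x assume x: "x \<in> Pi\<^sub>E ?J (\<lambda>l. A (r l))"
    have "x (s j) \<in> A j" if "j \<in> {..<n}" for j
    proof -
      have "s j \<in> ?J" using bij that unfolding bij_betw_def by blast
      thus ?thesis using x rs[of j] by (metis PiE_mem)
    qed
    thus "x \<in> omit n i -` Pi\<^sub>E {..<n} A \<inter> space (lebesgue_power ?J)"
      using x unfolding om by (auto simp: space_PiM PiE_def)
  qed
  have "emeasure (distr (lebesgue_power ?J) (lebesgue_power {..<n}) (omit n i)) (Pi\<^sub>E {..<n} A)
    = emeasure (lebesgue_power ?J) (Pi\<^sub>E ?J (\<lambda>l. A (r l)))"
    by (subst emeasure_distr[OF measurable_omit[OF i] AP]) (simp only: pre)
  also have "\<dots> = (\<Prod>l\<in>?J. emeasure lborel (A (r l)))"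
    by (rule lborel_product.emeasure_PiM) (use Ar in auto)
  also have "\<dots> = (\<Prod>j\<in>{..<n}. emeasure lborel (A (r (s j))))"
    by (rule prod.reindex_bij_betw[OF bij, symmetric])
  finally show "emeasure (distr (lebesgue_power ?J) (lebesgue_power {..<n}) (omit n i)) (Pi\<^sub>E {..<n} A)
    = (\<Prod>j\<in>{..<n}. emeasure lborel (A j))" by (simp add: rs)
qed auto

lemma omit_restrict:
  assumes "i \<le> n"
  shows "omit n i (restrict x ({..n} - {i})) = omit n i x"
  using assms by (auto simp: omit_def restrict_def fun_eq_iff)

lemma measurable_omit_all:
  assumes "i \<le> n"
  shows "omit n i \<in> measurable (lebesgue_power {..n}) (lebesgue_power {..<n} :: (nat \<Rightarrow> 'v::euclidean_space) measure)"
  using measurable_compose[OF measurable_restrict_coordinate measurable_omit[OF assms]] 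
  by (simp add: omit_restrict[OF assms])

text \<open>
  The functions in the theorem are given only up to null sets of \<open>n\<close> variables. A null set that does
  not constrain the omitted variable stays a null set in \<open>n + 1\<close> variables.
\<close>

lemma AE_omit:
  assumes i: "i \<le> n" and P: "AE z in (lebesgue_power {..<n} :: (nat \<Rightarrow> 'v::euclidean_space) measure). P z"
  shows "AE x in lebesgue_power {..n}. P (omit n i x)"
proof -
  let ?L = "lebesgue_power {..<n} :: (nat \<Rightarrow> 'v) measure" and ?J = "{..n} - {i}"
  obtain N where N: "{z \<in> space ?L. \<not> P z} \<subseteq> N" "N \<in> null_sets ?L"
    using P by (auto simp: eventually_ae_filter)
  have Nm[measurable]: "N \<in> sets ?L" using N by auto
  note [measurable] = measurable_omit_all[OF i, where 'v='v]
  have "AE z in lebesgue_power ?J. omit n i z \<notin> N"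
  proof (rule AE_distrD[OF measurable_omit[OF i]])
    show "AE z in distr (lebesgue_power ?J) ?L (omit n i). z \<notin> N"
      unfolding distr_omit[OF i] using AE_not_in[OF N(2)] .
  qed
  hence z: "AE z in lebesgue_power ?J. (\<integral>\<^sup>+ u. indicator N (omit n i (z(i := u))) \<partial>(lborel :: 'v measure)) = 0"
  proof eventually_elim
    case (elim z)
    have "omit n i (z(i := u)) = omit n i z" for u
      unfolding omit_def by (auto simp: restrict_def fun_eq_iff)
    thus ?case using elim by simp
  qed
  have I: "insert i ?J = {..n}" using i by auto
  have "(\<integral>\<^sup>+ x. indicator N (omit n i x) \<partial>lebesgue_power {..n}) = (\<integral>\<^sup>+ z. (\<integral>\<^sup>+ u. indicator N (omit n i (z(i := u))) \<partial>(lborel :: 'v measure)) \<partial>lebesgue_power ?J)"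
    using lborel_product.product_nn_integral_insert[of ?J i "\<lambda>x. indicator N (omit n i x)", unfolded I] by simp
  also have "\<dots> = (\<integral>\<^sup>+ z. 0 \<partial>(lebesgue_power ?J :: (nat \<Rightarrow> 'v) measure))" by (rule nn_integral_cong_AE[OF z])
  finally have "(\<integral>\<^sup>+ x. indicator N (omit n i x) \<partial>lebesgue_power {..n}) = 0" by simp
  hence "AE x in lebesgue_power {..n}. (indicator N (omit n i x) :: ennreal) = 0"
    by (subst (asm) nn_integral_0_iff_AE) auto
  moreover have "AE x in lebesgue_power {..n}. omit n i x \<in> space ?L"
    by (intro AE_I2 measurable_space[OF measurable_omit_all[OF i]])
  ultimately show ?thesis
    by eventually_elim (use N(1) in \<open>auto simp: indicator_def split: if_splits\<close>)
qed

lemma completion_ex_borel_measurable_complex: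
  fixes f :: "'a \<Rightarrow> complex"
  assumes f: "f \<in> borel_measurable (completion M)"
  obtains g where "g \<in> borel_measurable M" "AE x in M. f x = g x"
proof -
  obtain g1 where g1: "g1 \<in> borel_measurable M" "AE x in M. Re (f x) = g1 x"
    using completion_ex_borel_measurable_real[of "\<lambda>x. Re (f x)" M] f by auto
  obtain g2 where g2: "g2 \<in> borel_measurable M" "AE x in M. Im (f x) = g2 x"
    using completion_ex_borel_measurable_real[of "\<lambda>x. Im (f x)" M] f by auto
  have "(\<lambda>x. Complex (g1 x) (g2 x)) \<in> borel_measurable M"
    unfolding Complex_eq using g1(1) g2(1) by measurable
  moreover have "AE x in M. f x = Complex (g1 x) (g2 x)"
    using g1(2) g2(2) by eventually_elim (simp add: complex_eq_iff)
  ultimately show thesis by (rule that)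
qed

lemma simplex_form_eq_index_form:
  fixes k :: "'v::euclidean_space \<Rightarrow> complex"
  assumes F: "\<And>i. i \<le> n \<Longrightarrow> F i \<in> borel_measurable (power_lebesgue n)"
    and G: "\<And>i. i \<le> n \<Longrightarrow> G i \<in> borel_measurable (lebesgue_power {..<n})"
    and FG: "\<And>i. i \<le> n \<Longrightarrow> AE z in lebesgue_power {..<n}. F i z = G i z"
    and K[measurable]: "psi_sum k \<phi> S \<in> borel_measurable borel"
  shows "simplex_form n k \<phi> S F = index_form {..n} (psi_sum k \<phi> S) (\<lambda>i z. G i (omit n i z))"
proof -
  let ?M = "lebesgue_power {..n} :: (nat \<Rightarrow> 'v) measure"
  have pM: "power_lebesgue (Suc n) = completion ?M" unfolding power_lebesgue_def lessThan_Suc_atMost ..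
  have S: "(\<lambda>x. psi_sum k \<phi> S (\<Sum>i\<le>n. x i)) \<in> borel_measurable ?M"
    by measurable
  have oc: "omit n i \<in> measurable (completion ?M) (completion (lebesgue_power {..<n}))" if i: "i \<le> n" for i
  proof (rule completion.measurable_completion2)
    show m: "omit n i \<in> measurable (completion ?M) (lebesgue_power {..<n})"
      by (rule measurable_completion[OF measurable_omit_all[OF i]])
    show "null_sets (lebesgue_power {..<n}) \<subseteq> null_sets (distr (completion ?M) (lebesgue_power {..<n}) (omit n i))"
    proof
      fix N assume N: "N \<in> null_sets (lebesgue_power {..<n} :: (nat \<Rightarrow> 'v) measure)"
      have "AE x in ?M. omit n i x \<notin> N" by (rule AE_omit[OF i AE_not_in[OF N]])
      hence "AE x in completion ?M. omit n i x \<notin> N" by (rule AE_completion)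
      moreover have "{z \<in> space (lebesgue_power {..<n}). z \<notin> N} \<in> sets (lebesgue_power {..<n} :: (nat \<Rightarrow> 'v) measure)"
        using N by auto
      ultimately have "AE z in distr (completion ?M) (lebesgue_power {..<n}) (omit n i). z \<notin> N"
        using AE_distr_iff[OF m, of "\<lambda>z. z \<notin> N"] by blast
      thus "N \<in> null_sets (distr (completion ?M) (lebesgue_power {..<n}) (omit n i))"
        using N by (subst (asm) AE_iff_null_sets[symmetric]) auto
    qed
  qed
  have "simplex_form n k \<phi> S F = (LINT x|completion ?M. (\<Prod>i\<le>n. G i (omit n i x)) * psi_sum k \<phi> S (\<Sum>i\<le>n. x i))"
    unfolding simplex_form_def pM
  proof (rule integral_cong_AE)
    show "(\<lambda>x. (\<Prod>i\<le>n. F i (omit n i x)) * psi_sum k \<phi> S (\<Sum>i\<le>n. x i)) \<in> borel_measurable (completion ?M)"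
      using F unfolding power_lebesgue_def
      by (intro borel_measurable_times borel_measurable_prod measurable_completion[OF S] measurable_compose[OF oc]) auto
    show "(\<lambda>x. (\<Prod>i\<le>n. G i (omit n i x)) * psi_sum k \<phi> S (\<Sum>i\<le>n. x i)) \<in> borel_measurable (completion ?M)"
      using G
      by (intro borel_measurable_times borel_measurable_prod measurable_completion[OF S] measurable_completion[OF measurable_compose[OF measurable_omit_all]]) auto
    have "AE x in ?M. \<forall>i\<in>{..n}. F i (omit n i x) = G i (omit n i x)"
      using AE_omit FG by (intro AE_finite_allI) auto
    hence "AE x in ?M. (\<Prod>i\<le>n. F i (omit n i x)) * psi_sum k \<phi> S (\<Sum>i\<le>n. x i) = (\<Prod>i\<le>n. G i (omit n i x)) * psi_sum k \<phi> S (\<Sum>i\<le>n. x i)"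
      by eventually_elim simp
    thus "AE x in completion ?M. (\<Prod>i\<le>n. F i (omit n i x)) * psi_sum k \<phi> S (\<Sum>i\<le>n. x i) = (\<Prod>i\<le>n. G i (omit n i x)) * psi_sum k \<phi> S (\<Sum>i\<le>n. x i)"
      by (rule AE_completion)
  qed
  also have "\<dots> = (LINT x|?M. (\<Prod>i\<le>n. G i (omit n i x)) * psi_sum k \<phi> S (\<Sum>i\<le>n. x i))"
    using G by (intro integral_completion borel_measurable_times borel_measurable_prod S measurable_compose[OF measurable_omit_all]) auto
  also have "\<dots> = index_form {..n} (psi_sum k \<phi> S) (\<lambda>i z. G i (omit n i z))"
    unfolding index_form_def by (simp add: omit_restrict)
  finally show ?thesis .
qed

text \<open>
  Homogeneity reduces to norms at most \<open>1\<close>. Dividing by the norm plus \<open>e\<close> and letting \<open>e\<close> tend to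
  \<open>0\<close> treats functions of norm zero along with the others.
\<close>

lemma simplex_form_le:
  fixes k :: "'v::euclidean_space \<Rightarrow> complex"
  assumes est: "\<And>G. Lp_unit_family {..n} p G \<Longrightarrow>
         norm (index_form {..n} (psi_sum k \<phi> S) G) \<le> c"
    and p: "\<And>i. i \<le> n \<Longrightarrow> 0 < p i" and K: "psi_sum k \<phi> S \<in> borel_measurable borel"
    and F: "\<And>i. i \<le> n \<Longrightarrow> F i \<in> Lp_space (power_lebesgue n) (p i)"
  shows "norm (simplex_form n k \<phi> S F) \<le> c * (\<Prod>i\<le>n. Lp_norm (power_lebesgue n) (p i) (F i))"
proof -
  let ?L = "lebesgue_power {..<n} :: (nat \<Rightarrow> 'v) measure"
  have Fm: "F i \<in> borel_measurable (completion ?L)" and Fi: "integrable (completion ?L) (\<lambda>x. norm (F i x) powr p i)" if "i \<le> n" for i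
    using F[OF that] unfolding Lp_space_def power_lebesgue_def by auto
  have "\<exists>g. g \<in> borel_measurable ?L \<and> (AE z in ?L. F i z = g z)" if "i \<le> n" for i
    using completion_ex_borel_measurable_complex[OF Fm[OF that]] by blast
  then obtain G where G: "\<And>i. i \<le> n \<Longrightarrow> G i \<in> borel_measurable ?L" "\<And>i. i \<le> n \<Longrightarrow> AE z in ?L. F i z = G i z"
    by metis
  define L where "L = (\<lambda>i. Lp_norm (power_lebesgue n) (p i) (F i))"
  have L0: "L i \<ge> 0" for i unfolding L_def Lp_norm_def by simp
  have GI: "integrable ?L (\<lambda>x. norm (G i x) powr p i)" and GL: "(LINT x|?L. norm (G i x) powr p i) = L i powr p i" if i: "i \<le> n" for i
  proof -
    have Gm: "(\<lambda>x. norm (G i x) powr p i) \<in> borel_measurable ?L" using G(1)[OF i] by measurable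
    have ae: "AE x in completion ?L. norm (F i x) powr p i = norm (G i x) powr p i"
      using AE_completion[OF G(2)[OF i]] by eventually_elim simp
    have Fm': "(\<lambda>x. norm (F i x) powr p i) \<in> borel_measurable (completion ?L)" using Fm[OF i] by measurable
    have "integrable (completion ?L) (\<lambda>x. norm (G i x) powr p i)"
      using Fi[OF i] integrable_cong_AE[OF Fm' measurable_completion[OF Gm] ae] by simp
    thus "integrable ?L (\<lambda>x. norm (G i x) powr p i)" by (simp only: integrable_completion[OF Gm])
    have "(LINT x|completion ?L. norm (F i x) powr p i) = (LINT x|?L. norm (G i x) powr p i)"
      using integral_cong_AE[OF Fm' measurable_completion[OF Gm] ae] integral_completion[OF Gm] by simp
    moreover have "L i powr p i = (LINT x|completion ?L. norm (F i x) powr p i)"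
      unfolding L_def Lp_norm_def power_lebesgue_def using p[OF i] integral_nonneg_AE[of "\<lambda>x. norm (F i x) powr p i" "completion ?L"]
      by (simp add: powr_powr)
    ultimately show "(LINT x|?L. norm (G i x) powr p i) = L i powr p i" by simp
  qed
  have bound: "norm (simplex_form n k \<phi> S F) \<le> c * (\<Prod>i\<le>n. L i + e)" if e: "e > 0" for e
  proof -
    define H where "H = (\<lambda>i z. G i (omit n i z) / of_real (L i + e))"
    have t: "L i + e > 0" for i using L0[of i] e by linarith
    have "norm (index_form {..n} (psi_sum k \<phi> S) H) \<le> c"
    proof (rule est, unfold Lp_unit_family_def, rule ballI)
      fix i assume "i \<in> {..n}"
      hence i: "i \<le> n" by simp
      let ?J = "lebesgue_power ({..n} - {i}) :: (nat \<Rightarrow> 'v) measure"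
      have Gm: "(\<lambda>x. norm (G i x) powr p i) \<in> borel_measurable ?L" using G(1)[OF i] by measurable
      have gi: "integrable ?J (\<lambda>z. norm (G i (omit n i z)) powr p i)"
        using integrable_distr_eq[OF measurable_omit[OF i] Gm] GI[OF i] unfolding distr_omit[OF i] by simp
      have gl: "(LINT z|?J. norm (G i (omit n i z)) powr p i) = L i powr p i"
        using integral_distr[OF measurable_omit[OF i] Gm] GL[OF i] unfolding distr_omit[OF i] by simp
      have Hn: "norm (H i z) powr p i = norm (G i (omit n i z)) powr p i / (L i + e) powr p i" for z
        unfolding H_def norm_divide norm_of_real using t[of i] by (simp add: powr_divide)
      have "L i powr p i \<le> (L i + e) powr p i" using L0 e p[OF i] by (intro powr_mono2) (auto simp: less_imp_le)
      moreover have "0 < (L i + e) powr p i" using t[of i] by simp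
      ultimately have "(LINT z|?J. norm (H i z) powr p i) \<le> 1" unfolding Hn using gl by simp
      moreover have "integrable ?J (\<lambda>z. norm (H i z) powr p i)" unfolding Hn using gi by simp
      moreover have "H i \<in> borel_measurable ?J" unfolding H_def
        using measurable_compose[OF measurable_omit[OF i] G(1)[OF i]] by measurable
      ultimately show "H i \<in> borel_measurable ?J \<and> integrable ?J (\<lambda>x. norm (H i x) powr p i) \<and> (LINT x|?J. norm (H i x) powr p i) \<le> 1"
        by blast
    qed
    moreover have "simplex_form n k \<phi> S F = of_real (\<Prod>i\<le>n. L i + e) * index_form {..n} (psi_sum k \<phi> S) H"
    proof -
      have GH: "G i (omit n i z) = of_real (L i + e) * H i z" for i z
        unfolding H_def using t[of i] by (metis nonzero_mult_div_cancel_left of_real_eq_0_iff order_less_irrefl times_divide_eq_right)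
      have "simplex_form n k \<phi> S F = index_form {..n} (psi_sum k \<phi> S) (\<lambda>i z. G i (omit n i z))"
        using F unfolding Lp_space_def by (intro simplex_form_eq_index_form G K) auto
      also have "\<dots> = of_real (\<Prod>i\<le>n. L i + e) * index_form {..n} (psi_sum k \<phi> S) H"
        unfolding index_form_def GH prod.distrib of_real_prod mult.assoc by simp
      finally show ?thesis .
    qed
    ultimately show ?thesis
      using t mult_left_mono[of "norm (index_form {..n} (psi_sum k \<phi> S) H)" c "\<Prod>i\<le>n. L i + e"]
      by (simp only: norm_mult norm_of_real) (simp add: prod_nonneg less_imp_le mult.commute)
  qed
  have "(\<lambda>m. c * (\<Prod>i\<le>n. L i + inverse (real (Suc m)))) \<longlonglongrightarrow> c * (\<Prod>i\<le>n. L i + 0)"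
    by (intro tendsto_intros LIMSEQ_inverse_real_of_nat)
  hence "norm (simplex_form n k \<phi> S F) \<le> c * (\<Prod>i\<le>n. L i + 0)"
    by (rule LIMSEQ_le_const) (intro exI[of _ 0] allI impI bound, simp)
  thus ?thesis by (simp add: L_def)
qed

theorem theorem1p4p4:
  fixes k :: "real ^ 'd \<Rightarrow> complex" and \<phi> :: "real \<Rightarrow> complex"
    and n :: nat and p :: "nat \<Rightarrow> real"
  assumes "CZ_kernel k"
    and "dyadic_cutoff \<phi>"
    and "n \<ge> 1"
    and "\<And>i. i \<le> n \<Longrightarrow> 1 < p i"
    and "(\<Sum>i\<le>n. 1 / p i) = 1"
  shows "\<exists>c :: nat \<Rightarrow> real.
           (\<forall>N. 0 \<le> c N) \<and>
           (\<lambda>N. c N / real N) \<longlonglongrightarrow> 0 \<and>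
           (\<forall>(a::int) b. \<forall>F :: nat \<Rightarrow> (nat \<Rightarrow> real ^ 'd) \<Rightarrow> complex.
              (\<forall>i\<le>n. F i \<in> Lp_space (power_lebesgue n) (p i)) \<longrightarrow>
              norm (simplex_form n k \<phi> {a..b} F)
                \<le> c (card {a..b}) * (\<Prod>i\<le>n. Lp_norm (power_lebesgue n) (p i) (F i)))"
proof -
  have p0: "\<forall>i\<in>{..n}. 0 < p i" using assms(4) by (auto intro: less_trans[OF zero_less_one])
  obtain C \<delta> where C: "0 \<le> C" "0 < \<delta>" and est: "\<forall>a b F. Lp_unit_family {..n} p F \<longrightarrow>
       norm (index_form {..n} (psi_sum k \<phi> {a..b}) F) \<le> C * real (card {a..b}) powr (1 - \<delta>)"
    using ex_psi_sum_power_estimate[OF assms(1,2) finite_atMost p0 assms(5)] by (elim exE conjE)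
  obtain c where c: "c \<ge> 0" "\<forall>s. bump c (2 powi s) (psi k \<phi> s)" using ex_psi_bump[OF assms(1,2)] by (elim exE conjE)
  have K: "psi_sum k \<phi> S \<in> borel_measurable borel" for S
    unfolding psi_sum_def[abs_def] using bump_measurable c(2) by (intro borel_measurable_sum) blast
  show ?thesis
  proof (rule exI[of _ "\<lambda>N. C * real N powr (1 - \<delta>)"], intro conjI allI impI)
    show "0 \<le> C * real N powr (1 - \<delta>)" for N using C by simp
    have "((\<lambda>N. real N powr (- \<delta>)) \<longlongrightarrow> 0) sequentially"
      using C by (intro tendsto_neg_powr filterlim_real_sequentially) auto
    hence "(\<lambda>N. C * real N powr (- \<delta>)) \<longlonglongrightarrow> 0" by (rule tendsto_mult_right_zero)
    moreover have "\<forall>\<^sub>F N in sequentially. C * real N powr (- \<delta>) = C * real N powr (1 - \<delta>) / real N"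
      using eventually_gt_at_top[of 0] by eventually_elim (simp add: powr_diff powr_minus field_simps)
    ultimately show "(\<lambda>N. C * real N powr (1 - \<delta>) / real N) \<longlonglongrightarrow> 0" by (rule Lim_transform_eventually)
    fix a b :: int and F :: "nat \<Rightarrow> (nat \<Rightarrow> real ^ 'd) \<Rightarrow> complex"
    assume F: "\<forall>i\<le>n. F i \<in> Lp_space (power_lebesgue n) (p i)"
    show "norm (simplex_form n k \<phi> {a..b} F)
                \<le> C * real (card {a..b}) powr (1 - \<delta>) * (\<Prod>i\<le>n. Lp_norm (power_lebesgue n) (p i) (F i))"
      by (rule simplex_form_le[OF _ _ K]) (use est p0 F in auto)
  qed
qed

end
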